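(* The bilinear form $\langle\,,\rangle$ on $\mathbf{sNCSym}$ determined by $\langle m_I,h_J\rangle=(-1)^{\binom m2}n!\,\delta_{I,J}$ (for set superpartitions $I,J$, with $(n,m)$ the bidegree of $I$) is an inner product on $\mathbf{sNCSym}$. Furthermore, with this inner product, the lifting map $\tilde\rho:\mathbf{sSym}\to\mathbf{sNCSym}$ is an isometry, i.e. $\langle\tilde\rho(f),\tilde\rho(g)\rangle=\langle f,g\rangle$ for all $f,g\in\mathbf{sSym}$, where $\mathbf{sSym}$ carries the inner product determined by $\langle m_\Lambda,h_\Omega\rangle=(-1)^{\binom{m}{2}}\delta_{\Lambda,\Omega}$ (for superpartitions $\Lambda,\Omega$, with $m$ the fermionic degree of $\Lambda$).
   Context: Combinatorial objects. $[n]=\{1,\dots,n\}$, $[n]_0=[n]\cup\{0\}$, and $A^+=A\setminus\{0\}$. For $0\le m\le n+1$, a partial set supercomposition of bidegree $(n,m)$ is a tuple $K=(K_1,\dots,K_q)$ of nonempty subsets of $[n]_0$ (blocks) such that $K_1^+\cup\dots\cup K_q^+=[n]$, $K_i\cap K_j\subseteq\{0\}$ for $i\ne j$, $0\in K_i$ exactly for $i\le m$ (the fermionic blocks), and the nonfermionic blocks are ordered by increasing minimum. $s\mathcal C_{n,m}$ is the set of these. A set superpartition is a partial set supercomposition $I=(I_1,\dots,I_k)$ with $I_i\ne I_j$ and $\min(I_i\setminus I_j)<\min(I_j\setminus I_i)$ for all $i<j$, where $\min(\emptyset):=0$. For $K,L\in s\mathcal C_{n,m}$ write $K\sqsubseteq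 L$ if, for every $i\in[m]$, the $i$th fermionic block of $L$ is the union of the $i$th fermionic block of $K$ with some (possibly no) nonfermionic blocks of $K$, and each nonfermionic block of $L$ is a union of nonfermionic blocks of $K$; this is a meet-semilattice order with meet $\sqcap$. For a tuple of sets $N=(N_1,\dots,N_r)$, $N!=|N_1|!\cdots|N_r|!$ (the element $0$ is counted). Noncommuting functions. Let $\mathcal A$ be the $\mathbb Q$-algebra of formal power series of bounded degree in $x_1,x_2,\dots$ and $\theta_1,\theta_2,\dots$ subject only to $x_i\theta_j=\theta_jx_i$ and $\theta_i\theta_j=-\theta_j\theta_i$ (so $\theta_i^2=0$; the $x_i$ do not commute with each other). $\mathbf{sNCSym}\subset\mathcal A$ is the subalgebra of elements invariant under all finite permutations acting simultaneously on indices of $x$ and $\theta$. For $K\in s\mathcal C_{n,m}$, $M(K)$ is the set of words $\theta_{a_1}\cdots\theta_{a_m}x_{b_1}\cdots x_{b_n}$ with positive integer indices such that, for $i\in[m]$, $a_i=b_j$ iff $j\in K_i^+$, and, for $i,j\in[n]$, $b_i=b_j$ iff $i,j$ lie in the same block of $K$; $m_K$ is the sum of the words in $M(K)$. Also $h_K=\sum_u c_u\,u$, over all words $u=\theta_{a_1}\cdots\theta_{a_m}x_{b_1}\cdots x_{b_n}$ with $a_1,\dots,a_m$ pairwise distinct and $\{a_1,\dots,a_m\}\setminus\{b_1,\dots,b_n\}$ having at most one element, where $c_u=(K\sqcap L)!$ and $L$ is the unique element of $s\mathcal C_{n,m}$ with $u\in M(L)$. Both $\{m_I\}$ and $\{h_I\}$,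 $I$ over all set superpartitions, are bases of $\mathbf{sNCSym}$. Commuting side. $\mathbf{sSym}$ is the algebra of symmetric functions in commuting variables in superspace: the image of $\mathbf{sNCSym}$ when one additionally imposes $x_ix_j=x_jx_i$. A superpartition of bidegree $(n,m)$ (degree $n$, fermionic degree $m$) is $\Lambda=(\Lambda_1,\dots,\Lambda_m;\Lambda_{m+1},\dots,\Lambda_k)$ of nonnegative integers with sum $n$, with $\Lambda_1>\dots>\Lambda_m\ge0$ and $\Lambda_{m+1}\ge\dots\ge\Lambda_k\geq 1$; $\Lambda!=\Lambda_1!\cdots\Lambda_k!$. $m_\Lambda$ is the sum, without repetition, of all distinct terms $\theta_{i_1}\cdots\theta_{i_m}x_{i_1}^{\Lambda_1}\cdots x_{i_k}^{\Lambda_k}$ with $i_1,\dots,i_k$ pairwise distinct positive integers. $h_\Lambda=\tilde h_{\Lambda_1}\cdots\tilde h_{\Lambda_m}h_{\Lambda_{m+1}}\cdots h_{\Lambda_k}$ with $\tilde h_k=\sum(\Omega_1+1)m_\Omega$ over superpartitions $\Omega$ of bidegree $(k,1)$ and $h_r=\sum m_\Omega$ over those of bidegree $(r,0)$. Both $\{m_\Lambda\}$ and $\{h_\Lambda\}$ are bases of $\mathbf{sSym}$, and the inner product on $\mathbf{sSym}$ in the claim is the one known from the literature. For a set superpartition $I=(I_1,\dots,I_k)$ of fermionic degree $m$ whose fermionic blocks have pairwise different sizes, $\Lambda(I)$ is the superpartition whose fermionic part is the decreasing rearrangement of $(|I_1|-1,\dots,|I_m|-1)$ and whose other part is the decreasing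 rearrangement of $(|I_{m+1}|,\dots,|I_k|)$; $\varepsilon(I)$ is the minimal number of transpositions needed to sort $(|I_1|-1,\dots,|I_m|-1)$ decreasingly. The lifting map $\tilde\rho:\mathbf{sSym}\to\mathbf{sNCSym}$ is the linear map with $\tilde\rho(m_\Lambda)=\frac{\Lambda!}{n!}\sum_{I:\,\Lambda(I)=\Lambda}(-1)^{\varepsilon(I)}m_I$ for $\Lambda$ of degree $n$.
   Formalization: "Inner product" is read as a symmetric nondegenerate bilinear form with (-1)^{binom m 2}<f,f> > 0 for nonzero f of bidegree (n,m); literal positive definiteness fails, e.g. I=({0},{0,1}) has h_I=m_I and <m_I,m_I>=-1. *)

theory Defs
  imports Complex_Main "HOL-Library.Multiset" "HOL-Combinatorics.Permutations"
begin

section \<open>Series in superspace\<close>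

text \<open>
  A series is the function of its coefficients. Since the \<open>\<theta>\<^sub>i\<close> anticommute and commute with the
  \<open>x\<^sub>j\<close>, every monomial equals, up to sign, a unique \<open>\<theta>\<^sub>A w\<close>, where \<open>\<theta>\<^sub>A\<close> is the product of
  the \<open>\<theta>\<^sub>a\<close>, \<open>a \<in> A\<close>, in increasing order, and \<open>w\<close> is a monomial in the \<open>x\<^sub>j\<close> alone. This \<open>w\<close> is
  stored as the list of its indices (noncommuting \<open>x\<close>) or as their multiset (commuting \<open>x\<close>).
  The index \<open>i :: nat\<close> stands for the variables \<open>\<theta>\<close>, \<open>x\<close> numbered \<open>i + 1\<close>, so that all of
  \<open>nat\<close> serves as index set.
\<close>

type_synonym 'w series = "nat set \<times> 'w \<Rightarrow> rat"
type_synonym nc_series = "nat list series"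
type_synonym com_series = "nat multiset series"

definition theta_sign :: "nat list \<Rightarrow> rat" where
  "theta_sign a = (- 1) ^ card {(i, j). i < j \<and> j < length a \<and> a ! i > a ! j}"

text \<open>The series \<open>\<theta>\<^bsub>a ! 0\<^esub> \<theta>\<^bsub>a ! 1\<^esub> \<dots> w\<close>, which is zero if \<open>a\<close> has a repetition.\<close>

definition monom :: "nat list \<Rightarrow> 'w \<Rightarrow> 'w series" where
  "monom a w = (\<lambda>(A, v). if distinct a \<and> set a = A \<and> w = v then theta_sign a else 0)"

text \<open>
  Formal sum of a family of series, for \<open>S\<close> possibly infinite. It is meaningful when each
  coefficient is nonzero in only finitely many members of the family, as in all uses below.
\<close>

definition formal_sum :: "'i set \<Rightarrow> ('i \<Rightarrow> 'w series) \<Rightarrow> 'w series" where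
  "formal_sum S F = (\<lambda>t. \<Sum>i\<in>{i \<in> S. F i t \<noteq> 0}. F i t)"

definition bounded_degree :: "nc_series \<Rightarrow> bool" where
  "bounded_degree f \<longleftrightarrow>
     (\<exists>d. \<forall>A b. f (A, b) \<noteq> 0 \<longrightarrow> finite A \<and> card A + length b \<le> d)"

definition permute_indices :: "(nat \<Rightarrow> nat) \<Rightarrow> nc_series \<Rightarrow> nc_series" where
  "permute_indices \<sigma> f =
     formal_sum UNIV (\<lambda>(A, b) t. f (A, b) * monom (map \<sigma> (sorted_list_of_set A)) (map \<sigma> b) t)"

definition sNCSym :: "nc_series set" where
  "sNCSym = {f. bounded_degree f \<and>
     (\<forall>\<sigma> S. finite S \<longrightarrow> \<sigma> permutes S \<longrightarrow> permute_indices \<sigma> f = f)}"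

definition has_bidegree :: "nc_series \<Rightarrow> nat \<Rightarrow> nat \<Rightarrow> bool" where
  "has_bidegree f n m \<longleftrightarrow> (\<forall>A b. f (A, b) \<noteq> 0 \<longrightarrow> length b = n \<and> finite A \<and> card A = m)"

definition abelianize :: "nc_series \<Rightarrow> com_series" where
  "abelianize f =
     formal_sum UNIV (\<lambda>(A, b) t. f (A, b) * monom (sorted_list_of_set A) (mset b) t)"

definition sSym :: "com_series set" where
  "sSym = abelianize ` sNCSym"

definition com_one :: com_series where
  "com_one = monom [] {#}"

definition com_mult :: "com_series \<Rightarrow> com_series \<Rightarrow> com_series" where
  "com_mult f g = formal_sum UNIV (\<lambda>((A, u), (B, v)) t.
     f (A, u) * g (B, v) * monom (sorted_list_of_set A @ sorted_list_of_set B) (u + v) t)"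


section \<open>Set supercompositions and set superpartitions\<close>

text \<open>
  Blocks are listed from index 0, so \<open>take m K\<close> are the fermionic and \<open>drop m K\<close> the
  nonfermionic blocks.
\<close>

definition set_supercomp :: "nat \<Rightarrow> nat \<Rightarrow> nat set list set" where
  "set_supercomp n m = {K. m \<le> n + 1 \<and> m \<le> length K \<and>
     (\<forall>B\<in>set K. B \<noteq> {} \<and> B \<subseteq> {0..n}) \<and>
     (\<Union>B\<in>set K. B - {0}) = {1..n} \<and>
     (\<forall>i<length K. \<forall>j<length K. i \<noteq> j \<longrightarrow> K ! i \<inter> K ! j \<subseteq> {0}) \<and>
     (\<forall>i<length K. 0 \<in> K ! i \<longleftrightarrow> i < m) \<and>
     (\<forall>i j. m \<le> i \<longrightarrow> i < j \<longrightarrow> j < length K \<longrightarrow> Min (K ! i) < Min (K ! j))}"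

definition min0 :: "nat set \<Rightarrow> nat" where
  "min0 S = (if S = {} then 0 else Min S)"

definition set_superpart :: "nat \<Rightarrow> nat \<Rightarrow> nat set list set" where
  "set_superpart n m = {I \<in> set_supercomp n m. \<forall>i j. i < j \<longrightarrow> j < length I \<longrightarrow>
     I ! i \<noteq> I ! j \<and> min0 (I ! i - I ! j) < min0 (I ! j - I ! i)}"

definition refines :: "nat \<Rightarrow> nat set list \<Rightarrow> nat set list \<Rightarrow> bool" where
  "refines m K L \<longleftrightarrow>
     (\<forall>i<m. \<exists>N \<subseteq> set (drop m K). L ! i = K ! i \<union> \<Union>N) \<and>
     (\<forall>B\<in>set (drop m L). \<exists>N \<subseteq> set (drop m K). B = \<Union>N)"

definition meet :: "nat \<Rightarrow> nat \<Rightarrow> nat set list \<Rightarrow> nat set list \<Rightarrow> nat set list" where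
  "meet n m K L = (THE J. J \<in> set_supercomp n m \<and> refines m J K \<and> refines m J L \<and>
     (\<forall>J'\<in>set_supercomp n m. refines m J' K \<longrightarrow> refines m J' L \<longrightarrow> refines m J' J))"

definition blocks_fact :: "nat set list \<Rightarrow> nat" where
  "blocks_fact N = (\<Prod>B\<leftarrow>N. fact (card B))"


section \<open>Bases in noncommuting variables\<close>

text \<open>
  The pair \<open>(a, b)\<close> is the word with \<open>\<theta>\<close>-indices \<open>a\<close> and \<open>x\<close>-indices \<open>b\<close>; the positions
  in \<open>b\<close> are the elements \<open>1, \<dots>, n\<close> of the blocks.
\<close>

definition words :: "nat \<Rightarrow> nat \<Rightarrow> nat set list \<Rightarrow> (nat list \<times> nat list) set" where
  "words n m K = {(a, b). length a = m \<and> length b = n \<and>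
     (\<forall>i<m. \<forall>j\<in>{1..n}. a ! i = b ! (j - 1) \<longleftrightarrow> j \<in> K ! i - {0}) \<and>
     (\<forall>i\<in>{1..n}. \<forall>j\<in>{1..n}. b ! (i - 1) = b ! (j - 1) \<longleftrightarrow> (\<exists>B\<in>set K. i \<in> B \<and> j \<in> B))}"

definition nc_m :: "nat \<Rightarrow> nat \<Rightarrow> nat set list \<Rightarrow> nc_series" where
  "nc_m n m K = formal_sum (words n m K) (\<lambda>(a, b). monom a b)"

definition nc_h_coeff :: "nat \<Rightarrow> nat \<Rightarrow> nat set list \<Rightarrow> nat list \<times> nat list \<Rightarrow> nat" where
  "nc_h_coeff n m K u =
     blocks_fact (meet n m K (THE L. L \<in> set_supercomp n m \<and> u \<in> words n m L))"

definition nc_h :: "nat \<Rightarrow> nat \<Rightarrow> nat set list \<Rightarrow> nc_series" where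
  "nc_h n m K = formal_sum
     {(a, b). length a = m \<and> length b = n \<and> distinct a \<and> card (set a - set b) \<le> 1}
     (\<lambda>(a, b) t. of_nat (nc_h_coeff n m K (a, b)) * monom a b t)"


section \<open>Bases in commuting variables\<close>

definition superpart :: "nat \<Rightarrow> nat \<Rightarrow> (nat list \<times> nat list) set" where
  "superpart n m = {(F, P). length F = m \<and> sorted_wrt (>) F \<and> sorted_wrt (\<ge>) P \<and>
     (\<forall>p\<in>set P. 1 \<le> p) \<and> sum_list F + sum_list P = n}"

definition superpart_fact :: "nat list \<times> nat list \<Rightarrow> nat" where
  "superpart_fact \<Lambda> = (\<Prod>k\<leftarrow>fst \<Lambda> @ snd \<Lambda>. fact k)"

definition com_terms :: "nat list \<times> nat list \<Rightarrow> com_series set" where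
  "com_terms \<Lambda> = (let e = fst \<Lambda> @ snd \<Lambda> in
     {monom (take (length (fst \<Lambda>)) is) (\<Sum>j<length e. replicate_mset (e ! j) (is ! j)) |is.
        length is = length e \<and> distinct is})"

definition com_m :: "nat list \<times> nat list \<Rightarrow> com_series" where
  "com_m \<Lambda> = formal_sum (com_terms \<Lambda>) (\<lambda>s. s)"

definition com_h_tilde :: "nat \<Rightarrow> com_series" where
  "com_h_tilde k = (\<lambda>t. \<Sum>\<Omega>\<in>superpart k 1. of_nat (hd (fst \<Omega>) + 1) * com_m \<Omega> t)"

definition com_h_row :: "nat \<Rightarrow> com_series" where
  "com_h_row r = (\<lambda>t. \<Sum>\<Omega>\<in>superpart r 0. com_m \<Omega> t)"

definition com_h :: "nat list \<times> nat list \<Rightarrow> com_series" where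
  "com_h \<Lambda> = foldr com_mult (map com_h_tilde (fst \<Lambda>) @ map com_h_row (snd \<Lambda>)) com_one"


section \<open>Bilinear forms and the lifting map\<close>

text \<open>
  Forms and maps on a subspace are taken to be zero outside of it, so that they can be unique.
\<close>

definition linear_on :: "'w series set \<Rightarrow> ('w series \<Rightarrow> 'v series) \<Rightarrow> bool" where
  "linear_on V R \<longleftrightarrow>
     (\<forall>f\<in>V. \<forall>g\<in>V. \<forall>c d. R (\<lambda>t. c * f t + d * g t) = (\<lambda>t. c * R f t + d * R g t)) \<and>
     (\<forall>f. f \<notin> V \<longrightarrow> R f = (\<lambda>t. 0))"

definition bilinear_form_on :: "'w series set \<Rightarrow> ('w series \<Rightarrow> 'w series \<Rightarrow> rat) \<Rightarrow> bool" where
  "bilinear_form_on V B \<longleftrightarrow>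
     (\<forall>f\<in>V. \<forall>g\<in>V. \<forall>h\<in>V. \<forall>c d.
        B (\<lambda>t. c * f t + d * g t) h = c * B f h + d * B g h \<and>
        B h (\<lambda>t. c * f t + d * g t) = c * B h f + d * B h g) \<and>
     (\<forall>f g. f \<notin> V \<or> g \<notin> V \<longrightarrow> B f g = 0)"

definition sNCSym_form :: "(nc_series \<Rightarrow> nc_series \<Rightarrow> rat) \<Rightarrow> bool" where
  "sNCSym_form B \<longleftrightarrow> bilinear_form_on sNCSym B \<and>
     (\<forall>n m n' m'. \<forall>I\<in>set_superpart n m. \<forall>J\<in>set_superpart n' m'.
        B (nc_m n m I) (nc_h n' m' J) = (if I = J then (- 1) ^ (m choose 2) * fact n else 0))"

definition sSym_form :: "(com_series \<Rightarrow> com_series \<Rightarrow> rat) \<Rightarrow> bool" where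
  "sSym_form C \<longleftrightarrow> bilinear_form_on sSym C \<and>
     (\<forall>n m n' m'. \<forall>\<Lambda>\<in>superpart n m. \<forall>\<Omega>\<in>superpart n' m'.
        C (com_m \<Lambda>) (com_h \<Omega>) = (if \<Lambda> = \<Omega> then (- 1) ^ (m choose 2) else 0))"

text \<open>
  The sign \<open>(- 1) ^ (m choose 2)\<close> makes the form negative on some vectors: for the set
  superpartition \<open>I = ({0}, {0, 1})\<close>, of bidegree \<open>(1, 2)\<close>, one has \<open>m\<^sub>I = h\<^sub>I\<close> and
  \<open>\<langle>m\<^sub>I, m\<^sub>I\<rangle> = - 1\<close>. An inner product in superspace is therefore a nondegenerate symmetric
  bilinear form for which the positivity of \<open>\<langle>f, f\<rangle>\<close> is required up to this sign, in each bidegree.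
\<close>

definition super_inner_product :: "(nc_series \<Rightarrow> nc_series \<Rightarrow> rat) \<Rightarrow> bool" where
  "super_inner_product B \<longleftrightarrow> bilinear_form_on sNCSym B \<and>
     (\<forall>f\<in>sNCSym. \<forall>g\<in>sNCSym. B f g = B g f) \<and>
     (\<forall>f\<in>sNCSym. f \<noteq> (\<lambda>t. 0) \<longrightarrow> (\<exists>g\<in>sNCSym. B f g \<noteq> 0)) \<and>
     (\<forall>n m. \<forall>f\<in>sNCSym. has_bidegree f n m \<longrightarrow> f \<noteq> (\<lambda>t. 0) \<longrightarrow>
        (- 1) ^ (m choose 2) * B f f > 0)"

definition superpart_of :: "nat \<Rightarrow> nat set list \<Rightarrow> nat list \<times> nat list" where
  "superpart_of m I =
     (rev (sort (map (\<lambda>B. card B - 1) (take m I))), rev (sort (map card (drop m I))))"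

text \<open>\<open>swapidseq k p\<close> says that \<open>p\<close> is a composition of \<open>k\<close> transpositions.\<close>

definition sort_swaps :: "nat \<Rightarrow> nat set list \<Rightarrow> nat" where
  "sort_swaps m I = (LEAST k. \<exists>p. p permutes {..<m} \<and> swapidseq k p \<and>
     sorted_wrt (>) (permute_list p (map (\<lambda>B. card B - 1) (take m I))))"

definition lifting_map :: "(com_series \<Rightarrow> nc_series) \<Rightarrow> bool" where
  "lifting_map R \<longleftrightarrow> linear_on sSym R \<and> R ` sSym \<subseteq> sNCSym \<and>
     (\<forall>n m. \<forall>\<Lambda>\<in>superpart n m. R (com_m \<Lambda>) = (\<lambda>t. of_nat (superpart_fact \<Lambda>) / fact n *
        (\<Sum>I\<in>{I \<in> set_superpart n m. distinct (map card (take m I)) \<and> superpart_of m I = \<Lambda>}.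
           (- 1) ^ sort_swaps m I * nc_m n m I t)))"

end

(*
  Encode a word (a, b) by the list a @ b. The coefficient of a word w in nc_h K is then the number of
  permutations of the positions which fix both w and a word of kernel K, because the blocks of the
  meet are the joint fibres of the two words. The transition matrix from nc_m to nc_h is therefore an
  antisymmetrized Gram matrix. It is positive definite: a permutation whose cycles are exactly the
  fibres of a word w fixes only the words that are at least as coarse as w. Hence nc_h is a basis, and
  the form, whose Gram matrix on nc_h is this matrix up to sign and factorials, is symmetric and
  definite in each bidegree.

  The lifting has the explicit form of averaging a commutative monomial over its rearrangements, so it
  is a section of the abelianization, and its composite with the abelianization is the symmetrization
  over positions. The abelianization of the complete function of any word is a multiple of com_h or
  zero. The isometry follows by pairing a lifted com_m with the position symmetrization of nc_h.
*)

theory Submission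
  imports Defs "HOL-Combinatorics.Multiset_Permutations" "HOL-Library.Nat_Bijection"
begin

section \<open>Signs and permutations of lists\<close>

text \<open>Two difficulties shape the proof. A series stores its thetas as a set, whereas the
  arguments are about words; \<open>word_coeff\<close> therefore reads a series on any ordering of
  the thetas, where relabelling indices costs no sign and reordering costs the sign of a
  permutation. And a set superpartition fixes one ordering of the thetas, which permutations of
  positions destroy; \<open>hword\<close> therefore indexes complete functions by all words, at the
  price of signs and zeros. The form on the commutative side is obtained by pulling back along the
  lifting, so the isometry amounts to recognizing this pull-back by its values on
  \<open>com_m\<close> and \<open>com_h\<close>; for this it is enough that both families span. The
  factorials balance: the lifting spreads a coefficient over n!/Lambda! words, the form carries n!,
  and abelianizing a complete function yields Lambda! times \<open>com_h\<close>.\<close>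

lemma theta_sign_Nil [simp]: "theta_sign [] = 1"
  by (simp add: theta_sign_def)

text \<open>Inversions that use position 0 come from the tail letters below \<open>x\<close>; the
  others are the inversions of the tail, shifted by one. This recursion replaces the counting
  definition in inductions over lists.\<close>

lemma theta_sign_Cons:
  "theta_sign (x # xs) = (- 1) ^ length (filter (\<lambda>y. y < x) xs) * theta_sign xs"
proof -
  let ?I = "\<lambda>a. {(i, j). i < j \<and> j < length a \<and> a ! i > a ! j}"
  have fin: "finite (?I xs)"
    by (rule finite_subset[of _ "{..<length xs} \<times> {..<length xs}"]) auto
  have eq: "?I (x # xs) = (\<lambda>j. (0, Suc j)) ` {j. j < length xs \<and> xs ! j < x} \<union> map_prod Suc Suc ` ?I xs"
    (is "_ = ?X \<union> ?Y")
  proof (intro equalityI subsetI)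
    fix z assume z: "z \<in> ?I (x # xs)"
    obtain i j where ij: "z = (i, j)" by (cases z)
    then obtain j' where j': "j = Suc j'" using z by (cases j) auto
    show "z \<in> ?X \<union> ?Y"
    proof (cases i)
      case 0
      then show ?thesis using z ij j' by auto
    next
      case (Suc i')
      then have "(i', j') \<in> ?I xs" using z ij j' by auto
      then have "map_prod Suc Suc (i', j') \<in> ?Y" by (rule imageI)
      then show ?thesis using ij j' Suc by simp
    qed
  qed auto
  have "card (?I (x # xs)) = card ?X + card ?Y"
    unfolding eq by (rule card_Un_disjoint) (use fin in auto)
  also have "card ?X = length (filter (\<lambda>y. y < x) xs)"
    by (subst card_image) (auto simp: inj_on_def length_filter_conv_card)
  also have "card ?Y = card (?I xs)"
    by (rule card_image) (auto simp: inj_on_def)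
  finally show ?thesis
    by (simp add: theta_sign_def power_add)
qed

lemma theta_sign_square [simp]: "theta_sign a * theta_sign a = 1"
  by (simp add: theta_sign_def flip: power_add mult_2)

lemma theta_sign_nz [simp]: "theta_sign a \<noteq> 0"
  by (simp add: theta_sign_def)

lemma theta_sign_sorted: "sorted a \<Longrightarrow> theta_sign a = 1"
proof (induction a)
  case (Cons x xs)
  then have "filter (\<lambda>y. y < x) xs = []" by (auto simp: filter_empty_conv)
  then show ?case using Cons by (simp add: theta_sign_Cons)
qed simp

lemma theta_sign_adjacent:
  "x \<noteq> y \<Longrightarrow> theta_sign (xs @ x # y # ys) = - theta_sign (xs @ y # x # ys)"
  by (induction xs) (auto simp: theta_sign_Cons)

lemma permute_list_adjacent:
  assumes "Suc i < length a"
  shows "permute_list (Transposition.transpose i (Suc i)) a =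
    take i a @ a ! Suc i # a ! i # drop (Suc (Suc i)) a"
  using assms
  by (intro nth_equalityI)
     (auto simp: permute_list_def nth_append nth_Cons Transposition.transpose_def le_Suc_eq not_less
       split: nat.split intro!: arg_cong[where f = "nth a"])

lemma theta_sign_permute_adjacent:
  assumes "Suc i < length a" "distinct a"
  shows "theta_sign (permute_list (Transposition.transpose i (Suc i)) a) = - theta_sign a"
proof -
  have a: "a = take i a @ a ! i # a ! Suc i # drop (Suc (Suc i)) a"
    using assms by (metis Cons_nth_drop_Suc Suc_lessD append_take_drop_id)
  have "a ! i \<noteq> a ! Suc i" using assms by (simp add: nth_eq_iff_index_eq)
  then show ?thesis
    using theta_sign_adjacent[of "a ! Suc i" "a ! i" "take i a" "drop (Suc (Suc i)) a"] assms(1)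
    by (simp add: permute_list_adjacent flip: a)
qed

lemma theta_sign_apply_adj_transps:
  assumes "\<forall>i\<in>set is. Suc i < length a" "distinct a"
  shows "theta_sign (permute_list (apply_adj_transps is) a) = (- 1) ^ length is * theta_sign a"
  using assms
proof (induction "is" rule: rev_induct)
  case (snoc i xs)
  have p: "apply_adj_transps xs permutes {..<length a}"
    by (rule permutes_apply_adj_transps) (use snoc.prems in auto)
  have t: "Transposition.transpose i (Suc i) permutes {..<length a}"
    by (rule permutes_swap_id) (use snoc.prems in auto)
  have "permute_list (apply_adj_transps (xs @ [i])) a =
      permute_list (Transposition.transpose i (Suc i)) (permute_list (apply_adj_transps xs) a)"
    using permute_list_compose[OF t] by simp
  also have "theta_sign \<dots> = - theta_sign (permute_list (apply_adj_transps xs) a)"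
    by (rule theta_sign_permute_adjacent) (use snoc.prems p in auto)
  also have "theta_sign (permute_list (apply_adj_transps xs) a) = (- 1) ^ length xs * theta_sign a"
    using snoc by simp
  finally show ?case by (simp only: length_append_singleton power_Suc mult_minus_left mult_1_left)
qed simp

text \<open>The transposition factors into an odd number of adjacent ones, each of which flips the
  sign.\<close>

lemma theta_sign_permute_transpose:
  assumes "i < j" "j < length a" "distinct a"
  shows "theta_sign (permute_list (Transposition.transpose i j) a) = - theta_sign a"
proof -
  have "theta_sign (permute_list (apply_adj_transps (adj_transp_seq i j)) a) =
      (- 1) ^ length (adj_transp_seq i j) * theta_sign a"
    by (rule theta_sign_apply_adj_transps) (use assms in \<open>auto simp: set_adj_transp_seq\<close>)
  then show ?thesis
    using assms(1) by (simp add: adj_transp_seq_correct length_adj_transp_seq)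
qed

text \<open>The anticommutation rule for words in the thetas. Induction over transpositions reduces
  it to one swap of positions; it turns sums over orderings into signed sums over
  permutations.\<close>

lemma theta_sign_permute:
  assumes "p permutes {..<length a}" "distinct a"
  shows "theta_sign (permute_list p a) = of_int (sign p) * theta_sign a"
  using finite_lessThan assms(1)
proof (induction rule: permutes_rev_induct)
  case (swap i j p)
  have perm: "permutation p" "permutation (Transposition.transpose i j)"
    using swap by (auto intro: permutes_imp_permutation permutation_swap_id)
  have t: "Transposition.transpose i j permutes {..<length a}"
    by (rule permutes_swap_id) (use swap in auto)
  have "permute_list (p \<circ> Transposition.transpose i j) a =
      permute_list (Transposition.transpose i j) (permute_list p a)"
    by (rule permute_list_compose[OF t])
  also have "theta_sign \<dots> = - theta_sign (permute_list p a)"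
  proof (cases "i < j")
    case True
    then show ?thesis
      by (intro theta_sign_permute_transpose) (use swap assms in auto)
  next
    case False
    then show ?thesis
      by (subst transpose_commute, intro theta_sign_permute_transpose) (use swap assms in auto)
  qed
  also have "\<dots> = of_int (sign (p \<circ> Transposition.transpose i j)) * theta_sign a"
    using swap perm by (simp add: sign_compose sign_swap_id)
  finally show ?case .
qed simp

text \<open>Relabelling by \<open>f\<close> multiplies the sign by a factor that is the same for all
  orderings of one set, since the permutation of positions that relates \<open>a\<close> and
  \<open>c\<close> also relates their images. With \<open>c\<close> sorted this compares an
  arbitrary word with the normal form in \<open>permute_indices\<close>.\<close>

lemma theta_sign_map:
  assumes "distinct a" "distinct c" "set a = set c" "inj_on f (set a)"
  shows "theta_sign (map f a) = theta_sign a * theta_sign c * theta_sign (map f c)"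
proof -
  have "mset a = mset c" using assms set_eq_iff_mset_eq_distinct by blast
  then obtain p where p: "p permutes {..<length c}" "permute_list p c = a"
    by (rule mset_eq_permutation)
  have "map f a = permute_list p (map f c)" using p permute_list_map by metis
  then have "theta_sign (map f a) = of_int (sign p) * theta_sign (map f c)"
    using theta_sign_permute[of p "map f c"] p assms by (simp add: distinct_map)
  moreover have "theta_sign a = of_int (sign p) * theta_sign c"
    using theta_sign_permute[of p c] p assms by simp
  ultimately show ?thesis by (simp add: algebra_simps)
qed

lemma theta_sign_append_cross:
  "theta_sign (a @ b) = theta_sign a * theta_sign b *
    (- 1) ^ sum_mset (image_mset (\<lambda>x. size (filter_mset (\<lambda>y. y < x) (mset b))) (mset a))"
  by (induction a) (simp_all add: theta_sign_Cons power_add flip: mset_filter)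

text \<open>Inversions between \<open>a\<close> and \<open>b\<close> depend only on the two sets of
  letters, and in the concatenation of the sorted lists they are the only inversions. The last
  factor supplies exactly this cross sign, in the form in which \<open>com_mult\<close> produces
  it.\<close>

lemma theta_sign_append:
  assumes "distinct a" "distinct b"
  shows "theta_sign (a @ b) = theta_sign a * theta_sign b *
    theta_sign (sorted_list_of_set (set a) @ sorted_list_of_set (set b))"
proof -
  have "mset (sorted_list_of_set (set c)) = mset c" if "distinct c" for c :: "nat list"
    using that by (metis distinct_sorted_list_of_set finite_set set_eq_iff_mset_eq_distinct set_sorted_list_of_set)
  then show ?thesis
    using assms by (simp add: theta_sign_append_cross theta_sign_sorted)
qed

section \<open>Rearrangements of a word and their stabilizers\<close>

text \<open>One quantity serves for all products of factorials: N! for the blocks of a kernel,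
  Lambda! for the exponents of a monomial, and the order of the stabilizer of a word under
  permutations of its positions.\<close>

definition mfact :: "'a multiset \<Rightarrow> nat" where
  "mfact M = (\<Prod>x\<in>set_mset M. fact (count M x))"

lemma mfact_eq_prod:
  assumes "finite S" "set_mset M \<subseteq> S"
  shows "mfact M = (\<Prod>x\<in>S. fact (count M x))"
  unfolding mfact_def using assms by (intro prod.mono_neutral_left) (auto simp: not_in_iff)

lemma mfact_pos [simp]: "mfact M > 0"
  by (simp add: mfact_def prod_pos)

lemma mfact_nz [simp]: "mfact M \<noteq> 0"
  using mfact_pos[of M] by simp

lemma mfact_empty [simp]: "mfact {#} = 1"
  by (simp add: mfact_def)

lemma mfact_union_disjoint:
  assumes "set_mset M \<inter> set_mset N = {}"
  shows "mfact (M + N) = mfact M * mfact N"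
proof -
  have "mfact (M + N) = (\<Prod>x\<in>set_mset M. fact (count (M + N) x)) * (\<Prod>x\<in>set_mset N. fact (count (M + N) x))"
    unfolding mfact_def set_mset_union by (rule prod.union_disjoint) (use assms in auto)
  also have "(\<Prod>x\<in>set_mset M. fact (count (M + N) x)) = mfact M"
    unfolding mfact_def using assms by (intro prod.cong) (auto simp: not_in_iff disjoint_iff)
  also have "(\<Prod>x\<in>set_mset N. fact (count (M + N) x)) = mfact N"
    unfolding mfact_def
  proof (intro prod.cong refl)
    fix x assume "x \<in># N"
    then have "count M x = 0" using assms by (auto simp flip: not_in_iff)
    then show "fact (count (M + N) x) = fact (count N x)" by simp
  qed
  finally show ?thesis .
qed

lemma mfact_image_inj:
  assumes "inj_on f (set_mset M)"
  shows "mfact (image_mset f M) = mfact M"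
proof -
  have c: "count (image_mset f M) (f x) = count M x" if "x \<in># M" for x
  proof -
    have "{y \<in> set_mset M. f y = f x} = {x}" using assms that by (auto dest: inj_onD)
    then show ?thesis by (simp add: count_image_mset vimage_def Int_def conj_commute)
  qed
  show ?thesis
    unfolding mfact_def by (simp add: prod.reindex[OF assms] c)
qed

lemma card_permutations_of_multiset_mfact:
  "card (permutations_of_multiset M) * mfact M = fact (size M)"
  unfolding mfact_def by (rule card_permutations_of_multiset_aux)

text \<open>The permutations that carry \<open>l\<close> to \<open>l'\<close> form a coset of the
  stabilizer of \<open>l\<close>, with representative \<open>q\<close>.\<close>

lemma card_permute_list_fiber:
  assumes "mset l' = mset l"
  shows "card {p. p permutes {..<length l} \<and> permute_list p l = l'} =
    card {p. p permutes {..<length l} \<and> permute_list p l = l}"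
proof -
  obtain q where q: "q permutes {..<length l}" "permute_list q l = l'"
    using mset_eq_permutation[OF assms] by auto
  have "bij_betw (\<lambda>p. p \<circ> q) {p. p permutes {..<length l} \<and> permute_list p l = l}
      {p. p permutes {..<length l} \<and> permute_list p l = l'}"
  proof (rule bij_betw_byWitness[where f' = "\<lambda>p. p \<circ> inv q"])
    show "\<forall>p\<in>{p. p permutes {..<length l} \<and> permute_list p l = l}. p \<circ> q \<circ> inv q = p"
      using permutes_inv_o[OF q(1)] by (simp add: comp_assoc)
    show "\<forall>p\<in>{p. p permutes {..<length l} \<and> permute_list p l = l'}. p \<circ> inv q \<circ> q = p"
      using permutes_inv_o[OF q(1)] by (simp add: comp_assoc)
    show "(\<lambda>p. p \<circ> q) ` {p. p permutes {..<length l} \<and> permute_list p l = l}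
        \<subseteq> {p. p permutes {..<length l} \<and> permute_list p l = l'}"
      using q by (auto simp: permutes_compose permute_list_compose)
    have iq: "inv q permutes {..<length l}" using permutes_inv q by blast
    have "permute_list (inv q) l' = l"
      using q permute_list_compose[OF iq, of q] permutes_inv_o[OF q(1)] by simp
    then show "(\<lambda>p. p \<circ> inv q) ` {p. p permutes {..<length l} \<and> permute_list p l = l'}
        \<subseteq> {p. p permutes {..<length l} \<and> permute_list p l = l}"
      using iq by (auto simp: permutes_compose permute_list_compose)
  qed
  then show ?thesis by (simp add: bij_betw_same_card)
qed

text \<open>Orbit counting: the orbit of \<open>l\<close> is the set of rearrangements of its
  letters, and \<open>mfact\<close> times its size is the number of all permutations.\<close>

lemma card_stabilizer:
  "card {p. p permutes {..<length l} \<and> permute_list p l = l} = mfact (mset l)"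
proof -
  let ?P = "{p. p permutes {..<length l}}"
  have "fact (length l) = card ?P" by (simp add: card_permutations)
  also have "\<dots> = (\<Sum>l'\<in>permutations_of_multiset (mset l). card {p \<in> ?P. permute_list p l = l'})"
  proof -
    have "card ?P = (\<Sum>p\<in>?P. 1)" by simp
    also have "\<dots> = (\<Sum>l'\<in>permutations_of_multiset (mset l). \<Sum>p\<in>{p \<in> ?P. permute_list p l = l'}. 1)"
      by (rule sum.group[symmetric])
       (simp_all add: finite_permutations image_subset_iff permutations_of_multisetI)
    finally show ?thesis by simp
  qed
  also have "\<dots> = (\<Sum>l'\<in>permutations_of_multiset (mset l). card {p \<in> ?P. permute_list p l = l})"
    unfolding mem_Collect_eq
    by (intro sum.cong refl card_permute_list_fiber) (rule permutations_of_multisetD)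
  finally have "card (permutations_of_multiset (mset l)) * mfact (mset l) =
      card (permutations_of_multiset (mset l)) * card {p \<in> ?P. permute_list p l = l}"
    using card_permutations_of_multiset_mfact[of "mset l"] by simp
  then show ?thesis by simp
qed

lemma sum_permute_list:
  fixes f :: "'a list \<Rightarrow> rat"
  shows "(\<Sum>p | p permutes {..<length l}. f (permute_list p l)) =
    of_nat (mfact (mset l)) * (\<Sum>l'\<in>permutations_of_multiset (mset l). f l')"
proof -
  let ?P = "{p. p permutes {..<length l}}"
  have "(\<Sum>p\<in>?P. f (permute_list p l)) =
      (\<Sum>l'\<in>permutations_of_multiset (mset l). \<Sum>p\<in>{p \<in> ?P. permute_list p l = l'}. f (permute_list p l))"
    by (rule sum.group[symmetric])
       (simp_all add: finite_permutations image_subset_iff permutations_of_multisetI)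
  also have "\<dots> = (\<Sum>l'\<in>permutations_of_multiset (mset l). of_nat (mfact (mset l)) * f l')"
  proof (intro sum.cong refl)
    fix l' assume "l' \<in> permutations_of_multiset (mset l)"
    then have "card {p \<in> ?P. permute_list p l = l'} = mfact (mset l)"
      using trans[OF card_permute_list_fiber[of l' l] card_stabilizer]
      by (simp only: mem_Collect_eq permutations_of_multisetD)
    then show "(\<Sum>p\<in>{p \<in> ?P. permute_list p l = l'}. f (permute_list p l)) = of_nat (mfact (mset l)) * f l'"
      by simp
  qed
  finally show ?thesis by (simp add: sum_distrib_left)
qed

text \<open>The permutation is a single cycle on each fibre of \<open>f\<close>.\<close>

lemma ex_permutation_generating_fibres:
  fixes f :: "'a \<Rightarrow> 'b"
  assumes "finite S"
  shows "\<exists>p. p permutes S \<and> (\<forall>x. f (p x) = f x) \<and>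
    (\<forall>g :: 'a \<Rightarrow> 'c. (\<forall>x\<in>S. g (p x) = g x) \<longrightarrow> (\<forall>x\<in>S. \<forall>y\<in>S. f x = f y \<longrightarrow> g x = g y))"
  using assms
proof (induction S)
  case empty
  then show ?case by (intro exI[of _ id]) auto
next
  case (insert x S)
  then obtain p where p: "p permutes S" "\<forall>x. f (p x) = f x"
    "\<And>g :: 'a \<Rightarrow> 'c. \<forall>x\<in>S. g (p x) = g x \<Longrightarrow> \<forall>x\<in>S. \<forall>y\<in>S. f x = f y \<longrightarrow> g x = g y" by metis
  have px: "p x = x" using p insert.hyps by (simp add: permutes_not_in)
  show ?case
  proof (cases "\<exists>y\<in>S. f y = f x")
    case True
    then obtain y where y: "y \<in> S" "f y = f x" by blast
    then have xy: "x \<noteq> y" using insert.hyps by auto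
    \<comment> \<open>Splices \<open>x\<close> into the cycle of \<open>y\<close>: as
      \<open>p\<close> fixes \<open>x\<close>, the new permutation sends \<open>y\<close> to
      \<open>x\<close> and \<open>x\<close> to \<open>p y\<close>, and agrees with \<open>p\<close>
      elsewhere.\<close>
    let ?q = "p \<circ> Transposition.transpose x y"
    have "?q permutes insert x S"
      using p y by (intro permutes_compose permutes_swap_id) (auto intro: permutes_subset)
    moreover have "f (?q z) = f z" for z
      using p y by (simp add: Transposition.transpose_def)
    moreover have "g z = g z'" if g: "\<forall>z\<in>insert x S. g (?q z) = g z" and z: "z \<in> insert x S" "z' \<in> insert x S" "f z = f z'"
      for g :: "'a \<Rightarrow> 'c" and z z'
    proof -
      have gx: "g (p y) = g x" and gy: "g x = g y" using bspec[OF g, of x] bspec[OF g, of y] y xy px by auto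
      have "g (p w) = g w" if "w \<in> S" for w
      proof (cases "w = y")
        case False
        then have "?q w = p w" using that insert.hyps by (auto simp: Transposition.transpose_def)
        then show ?thesis using bspec[OF g, of w] that by simp
      qed (use gx gy in simp)
      then have *: "\<forall>u\<in>S. \<forall>v\<in>S. f u = f v \<longrightarrow> g u = g v" by (intro p(3)) auto
      define r where "r w = (if w = x then y else w)" for w
      have "g (r w) = g w" "f (r w) = f w" for w using gy y by (auto simp: r_def)
      moreover have "r z \<in> S" "r z' \<in> S" using z y by (auto simp: r_def)
      ultimately show ?thesis using * z by metis
    qed
    ultimately show ?thesis by (intro exI[of _ ?q]) blast
  next
    case False
    have "p permutes insert x S" using p by (auto intro: permutes_subset)
    moreover have "g z = g z'" if g: "\<forall>z\<in>insert x S. g (p z) = g z" and z: "z \<in> insert x S" "z' \<in> insert x S" "f z = f z'"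
      for g :: "'a \<Rightarrow> 'c" and z z'
    proof -
      have *: "\<forall>u\<in>S. \<forall>v\<in>S. f u = f v \<longrightarrow> g u = g v" by (intro p(3)) (use g in auto)
      show ?thesis using z False * by (metis insert_iff)
    qed
    ultimately show ?thesis using p(2) by blast
  qed
qed

text \<open>Words with the same equality pattern differ by a relabelling of indices. Invariance is
  only demanded for permutations of finite sets, so the bijection between the letters of the two
  words has to be completed to one.\<close>

lemma ex_permutes_map:
  assumes len: "length u = length v"
    and ker: "\<And>i j. i < length u \<Longrightarrow> j < length u \<Longrightarrow> u ! i = u ! j \<longleftrightarrow> v ! i = v ! j"
  shows "\<exists>\<sigma> S. finite S \<and> \<sigma> permutes S \<and> v = map \<sigma> u"
proof -
  define g where "g x = v ! (LEAST i. i < length u \<and> u ! i = x)" for x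
  have g: "g (u ! i) = v ! i" if "i < length u" for i
  proof -
    let ?k = "LEAST k. k < length u \<and> u ! k = u ! i"
    have "?k < length u \<and> u ! ?k = u ! i" by (rule LeastI[of _ i]) (use that in simp)
    then show ?thesis unfolding g_def using ker[of ?k i] that by simp
  qed
  have vg: "v = map g u" using len g by (auto intro!: nth_equalityI)
  have inj: "inj_on g (set u)"
    by (rule inj_onI) (metis g in_set_conv_nth ker)
  let ?T = "set u \<union> set v"
  have "card (set v) = card (set u)" using vg inj by (simp add: card_image)
  \<comment> \<open>Both complements in the union of the letters have the same size, so any
    bijection between them completes \<open>g\<close>.\<close>
  then have "card (?T - set u) = card (?T - set v)"
    by (simp add: card_Diff_subset)
  then obtain h where h: "bij_betw h (?T - set u) (?T - set v)"
    using finite_same_card_bij[of "?T - set u" "?T - set v"] by auto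
  define \<sigma> where "\<sigma> x = (if x \<in> set u then g x else if x \<in> ?T then h x else x)" for x
  have b1: "bij_betw \<sigma> (set u) (set v)"
    unfolding bij_betw_def using inj vg by (auto simp: \<sigma>_def inj_on_def)
  have b2: "bij_betw \<sigma> (?T - set u) (?T - set v)"
    using h by (subst bij_betw_cong[where g = h]) (auto simp: \<sigma>_def)
  have "bij_betw \<sigma> (set u \<union> (?T - set u)) (set v \<union> (?T - set v))"
    by (rule bij_betw_combine[OF b1 b2]) auto
  moreover have "set u \<union> (?T - set u) = ?T" "set v \<union> (?T - set v) = ?T" by auto
  ultimately have "bij_betw \<sigma> ?T ?T" by simp
  then have "\<sigma> permutes ?T" by (rule bij_imp_permutes) (auto simp: \<sigma>_def)
  moreover have "v = map \<sigma> u" using vg by (simp add: \<sigma>_def)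
  ultimately show ?thesis by blast
qed

section \<open>Set superpartitions as kernels of words\<close>

lemma sorted_wrt_key_iff:
  fixes f :: "'a \<Rightarrow> 'b :: linorder"
  shows "sorted_wrt (\<lambda>x y. f x < f y) xs \<longleftrightarrow> sorted (map f xs) \<and> distinct (map f xs)"
  using strict_sorted_iff[of "map f xs"] by (simp add: sorted_wrt_map)

text \<open>Used with three keys: \<open>Min\<close> for nonfermionic blocks, the first occurrence
  for thetas in canonical order, and the multiplicity for thetas in the commutative setting.\<close>

lemma sorted_wrt_key_unique:
  fixes f :: "'a \<Rightarrow> 'b :: linorder"
  assumes "sorted_wrt (\<lambda>x y. f x < f y) xs" "sorted_wrt (\<lambda>x y. f x < f y) ys" "set xs = set ys"
  shows "xs = ys"
proof -
  have "map f xs = map f ys"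
    by (rule sorted_distinct_set_unique) (use assms in \<open>auto simp: sorted_wrt_key_iff\<close>)
  moreover have "inj_on f (set xs \<union> set ys)"
    using assms by (simp add: sorted_wrt_key_iff distinct_map)
  ultimately show ?thesis by (rule map_inj_on)
qed

lemma ex_sorted_wrt_key:
  fixes f :: "'a \<Rightarrow> 'b :: linorder"
  assumes "finite S" "inj_on f S"
  shows "\<exists>xs. set xs = S \<and> sorted_wrt (\<lambda>x y. f x < f y) xs"
proof -
  obtain ys where "set ys = S" "distinct ys" using finite_distinct_list[OF assms(1)] by blast
  then show ?thesis
    using assms(2) by (intro exI[of _ "sort_key f ys"]) (simp add: sorted_wrt_key_iff distinct_map)
qed

lemma sorted_wrt_key_distinct:
  fixes f :: "'a \<Rightarrow> 'b :: linorder"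
  shows "sorted_wrt (\<lambda>x y. f x < f y) xs \<Longrightarrow> distinct xs"
  by (auto simp: sorted_wrt_key_iff distinct_map)

section \<open>Letters, their positions and the blocks of a kernel\<close>

text \<open>Positions start at 1 because 0 marks the fermionic blocks. A nonfermionic block is some
  \<open>occ b c\<close>, and a fermionic one is \<open>insert 0 (occ b c)\<close> with
  \<open>c\<close> the index of its \<theta>.\<close>

definition occ :: "nat list \<Rightarrow> nat \<Rightarrow> nat set" where
  "occ b c = {j \<in> {1..length b}. b ! (j - 1) = c}"

lemma mem_occ: "j \<in> occ b c \<longleftrightarrow> 1 \<le> j \<and> j \<le> length b \<and> b ! (j - 1) = c"
  by (auto simp: occ_def)

lemma finite_occ [simp]: "finite (occ b c)"
  by (simp add: occ_def)

lemma zero_notin_occ [simp]: "0 \<notin> occ b c"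
  by (simp add: occ_def)

lemma card_occ: "card (occ b c) = count (mset b) c"
proof -
  have "occ b c = Suc ` {i. i < length b \<and> b ! i = c}"
  proof (intro equalityI subsetI)
    fix j assume "j \<in> occ b c"
    then have "j = Suc (j - 1)" "j - 1 \<in> {i. i < length b \<and> b ! i = c}" by (auto simp: occ_def)
    then show "j \<in> Suc ` {i. i < length b \<and> b ! i = c}" by blast
  qed (auto simp: occ_def)
  then show ?thesis
    by (simp add: card_image count_mset count_list_eq_length_filter length_filter_conv_card eq_commute)
qed

lemma occ_empty_iff: "occ b c = {} \<longleftrightarrow> c \<notin> set b"
  by (metis card_0_eq card_occ count_eq_zero_iff finite_occ set_mset_mset)

lemma occ_disjoint: "c \<noteq> d \<Longrightarrow> occ b c \<inter> occ b d = {}"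
  by (auto simp: occ_def)

lemma inj_on_occ: "inj_on (occ b) (set b)"
  by (rule inj_onI) (metis inf.idem occ_disjoint occ_empty_iff)

lemma supercompD:
  assumes "K \<in> set_supercomp n m"
  shows "m \<le> n + 1" "m \<le> length K"
    "\<And>i. i < length K \<Longrightarrow> K ! i \<noteq> {}"
    "\<And>i. i < length K \<Longrightarrow> K ! i \<subseteq> {0..n}"
    "\<And>j. j \<in> {1..n} \<Longrightarrow> \<exists>i<length K. j \<in> K ! i"
    "\<And>i i' j. i < length K \<Longrightarrow> i' < length K \<Longrightarrow> j \<in> K ! i \<Longrightarrow> j \<in> K ! i' \<Longrightarrow> j \<noteq> 0 \<Longrightarrow> i = i'"
    "\<And>i. i < length K \<Longrightarrow> 0 \<in> K ! i \<longleftrightarrow> i < m"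
    "sorted_wrt (\<lambda>B C. Min B < Min C) (drop m K)"
proof -
  show "\<exists>i<length K. j \<in> K ! i" if "j \<in> {1..n}" for j
  proof -
    have "j \<in> (\<Union>B\<in>set K. B - {0})" using assms that by (simp add: set_supercomp_def)
    then show ?thesis by (auto simp: in_set_conv_nth)
  qed
  show "i = i'" if "i < length K" "i' < length K" "j \<in> K ! i" "j \<in> K ! i'" "j \<noteq> 0" for i i' j
    using assms that unfolding set_supercomp_def by blast
  show "sorted_wrt (\<lambda>B C. Min B < Min C) (drop m K)"
    using assms unfolding set_supercomp_def by (auto simp: sorted_wrt_iff_nth_less)
qed (use assms in \<open>auto simp: set_supercomp_def\<close>)

lemma wordsD:
  assumes "(a, b) \<in> words n m K"
  shows "length a = m" "length b = n"
    "\<And>i j. i < m \<Longrightarrow> j \<in> {1..n} \<Longrightarrow> a ! i = b ! (j - 1) \<longleftrightarrow> j \<in> K ! i"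
    "\<And>i j. i \<in> {1..n} \<Longrightarrow> j \<in> {1..n} \<Longrightarrow> b ! (i - 1) = b ! (j - 1) \<longleftrightarrow> (\<exists>B\<in>set K. i \<in> B \<and> j \<in> B)"
  using assms by (auto simp: words_def)

lemma supercomp_fermionic:
  assumes "K \<in> set_supercomp n m" "(a, b) \<in> words n m K" "i < m"
  shows "K ! i = insert 0 (occ b (a ! i))"
proof -
  note K = supercompD[OF assms(1)] and w = wordsD[OF assms(2)]
  have i: "i < length K" using assms(3) K(2) by simp
  show ?thesis
  proof (intro equalityI subsetI)
    fix j assume "j \<in> K ! i"
    then show "j \<in> insert 0 (occ b (a ! i))"
      using K(4)[OF i] w(2) w(3)[OF assms(3), of j] by (cases "j = 0") (auto simp: mem_occ)
  next
    fix j assume "j \<in> insert 0 (occ b (a ! i))"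
    then show "j \<in> K ! i"
      using K(7)[OF i] w(2) w(3)[OF assms(3), of j] assms(3) by (auto simp: mem_occ)
  qed
qed

text \<open>Every point \<open>j\<close> of such a block recovers it as the set of positions of the
  letter at \<open>j\<close>. That letter is not a theta index, as the block of the theta would then
  share the nonzero element \<open>j\<close>.\<close>

lemma supercomp_bosonic:
  assumes "K \<in> set_supercomp n m" "(a, b) \<in> words n m K"
  shows "set (drop m K) = occ b ` (set b - set a)"
proof -
  note K = supercompD[OF assms(1)] and w = wordsD[OF assms(2)]
  have block: "K ! i = occ b (b ! (j - 1))" if i: "m \<le> i" "i < length K" and j: "j \<in> K ! i" for i j
  proof -
    have Ki: "K ! i \<subseteq> {1..n}"
    proof
      fix x assume x: "x \<in> K ! i"
      then have "x \<noteq> 0" using K(7)[OF i(2)] i by (metis not_le)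
      then show "x \<in> {1..n}" using x K(4)[OF i(2)] by auto
    qed
    then have jn: "j \<in> {1..n}" using j by blast
    show ?thesis
    proof (intro equalityI subsetI)
      fix x assume x: "x \<in> K ! i"
      then have "b ! (x - 1) = b ! (j - 1)"
        using w(4)[of x j] Ki jn j i by force
      then show "x \<in> occ b (b ! (j - 1))" using x Ki w(2) by (auto simp: mem_occ)
    next
      fix x assume "x \<in> occ b (b ! (j - 1))"
      then have "x \<in> {1..n}" "b ! (x - 1) = b ! (j - 1)" using w(2) by (auto simp: mem_occ)
      then obtain B where B: "B \<in> set K" "x \<in> B" "j \<in> B" using w(4)[of x j] jn by blast
      then obtain i' where "i' < length K" "B = K ! i'" by (auto simp: in_set_conv_nth)
      then show "x \<in> K ! i" using K(6)[of i i' j] i j B jn by auto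
    qed
  qed
  show ?thesis
  proof (intro equalityI subsetI)
    fix B assume "B \<in> set (drop m K)"
    then obtain i where i: "m \<le> i" "i < length K" "B = K ! i"
      by (auto simp: in_set_conv_nth intro!: that[of "m + _"])
    obtain j where j: "j \<in> K ! i" using K(3)[OF i(2)] by blast
    have j0: "j \<noteq> 0" using K(7)[OF i(2)] i j by (metis not_le)
    then have jn: "j \<in> {1..n}" using K(4)[OF i(2)] j by auto
    have "b ! (j - 1) \<notin> set a"
    proof
      assume "b ! (j - 1) \<in> set a"
      then obtain i' where i': "i' < m" "a ! i' = b ! (j - 1)" using w(1) by (auto simp: in_set_conv_nth)
      then have "j \<in> K ! i'" using w(3) jn by blast
      then show False using K(6)[of i i' j] i i' j j0 K(2) by auto
    qed
    moreover have "b ! (j - 1) \<in> set b" using jn w(2) by auto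
    ultimately show "B \<in> occ b ` (set b - set a)" using block[OF i(1,2) j] i(3) by blast
  next
    fix B assume "B \<in> occ b ` (set b - set a)"
    then obtain c where c: "B = occ b c" "c \<in> set b" "c \<notin> set a" by blast
    then obtain k where k: "k < n" "b ! k = c" using w(2) by (auto simp: in_set_conv_nth)
    then have jn: "Suc k \<in> {1..n}" by simp
    then obtain i where i: "i < length K" "Suc k \<in> K ! i" using K(5) by blast
    have "m \<le> i"
    proof (rule ccontr)
      assume "\<not> m \<le> i"
      then have "a ! i = b ! k" using w(3)[of i "Suc k"] jn i by simp
      then show False using c k w(1) \<open>\<not> m \<le> i\<close> by (metis not_le nth_mem)
    qed
    then have "K ! i \<in> set (drop m K)" using i by (auto simp: in_set_conv_nth intro!: exI[of _ "i - m"])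
    then show "B \<in> set (drop m K)" using block[OF \<open>m \<le> i\<close> i] c k by simp
  qed
qed

lemma supercomp_unique:
  assumes "K \<in> set_supercomp n m" "K' \<in> set_supercomp n m" "(a, b) \<in> words n m K" "(a, b) \<in> words n m K'"
  shows "K = K'"
proof -
  have "take m K = take m K'"
    using assms supercomp_fermionic supercompD(2) by (intro nth_equalityI) auto
  moreover have "drop m K = drop m K'"
    by (rule sorted_wrt_key_unique[of Min]) (use assms supercompD(8) supercomp_bosonic in auto)
  ultimately show ?thesis by (metis append_take_drop_id)
qed

text \<open>The blocks are read off the word: a theta whose index is absent from \<open>b\<close>
  gives {0}, and the letters that are not theta indices are listed by first occurrence.\<close>

lemma ex_supercomp:
  assumes a: "distinct a" and len: "length a = m" "length b = n" "m \<le> n + 1"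
  shows "\<exists>K\<in>set_supercomp n m. (a, b) \<in> words n m K"
proof -
  have "inj_on Min (occ b ` (set b - set a))"
  proof (rule inj_onI)
    fix B C assume "B \<in> occ b ` (set b - set a)" "C \<in> occ b ` (set b - set a)" and eq: "Min B = Min C"
    then obtain c d where cd: "B = occ b c" "C = occ b d" "c \<in> set b" "d \<in> set b" by blast
    then have "Min B \<in> B" "Min C \<in> C" by (auto intro!: Min_in simp: occ_empty_iff)
    then have "c = d" using eq cd mem_occ by metis
    then show "B = C" using cd by simp
  qed
  then obtain Bs where Bs: "set Bs = occ b ` (set b - set a)" "sorted_wrt (\<lambda>B C. Min B < Min C) Bs"
    using ex_sorted_wrt_key[of "occ b ` (set b - set a)" Min] by auto
  then have dist: "distinct Bs" using sorted_wrt_key_distinct by blast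
  define K where "K = map (\<lambda>c. insert 0 (occ b c)) a @ Bs"
  have fer: "K ! i = insert 0 (occ b (a ! i))" if "i < m" for i
    using that len by (simp add: K_def nth_append)
  have bos: "\<exists>c\<in>set b - set a. K ! i = occ b c" if "m \<le> i" "i < length K" for i
  proof -
    have "K ! i \<in> set Bs" using that len by (simp add: K_def nth_append)
    then show ?thesis using Bs by auto
  qed
  have setK: "set K = insert 0 ` occ b ` set a \<union> occ b ` (set b - set a)"
    by (auto simp: K_def Bs)
  \<comment> \<open>Remembers which letter a block came from; blocks meet only in 0 because
    different blocks carry different letters.\<close>
  define letter where "letter i = (if i < m then a ! i else SOME c. c \<in> set b - set a \<and> K ! i = occ b c)" for i
  have letter: "letter i \<in> set b - set a \<and> K ! i = occ b (letter i)" if "m \<le> i" "i < length K" for i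
    using someI_ex[of "\<lambda>c. c \<in> set b - set a \<and> K ! i = occ b c"] bos[OF that] that by (auto simp: letter_def)
  have Klet: "K ! i - {0} = occ b (letter i)" if "i < length K" for i
  proof (cases "i < m")
    case False
    then have "K ! i = occ b (letter i)" using letter that by simp
    then show ?thesis using zero_notin_occ by (metis Diff_empty Diff_insert0)
  qed (simp add: fer letter_def)
  have inj: "i = j" if ij: "i < length K" "j < length K" "letter i = letter j" for i j
  proof -
    consider "i < m" "j < m" | "i < m" "m \<le> j" | "m \<le> i" "j < m" | "m \<le> i" "m \<le> j" by linarith
    then show ?thesis
    proof cases
      case 1 then show ?thesis using ij a len by (simp add: letter_def nth_eq_iff_index_eq)
    next
      case 2 then have "letter i \<in> set a" using len by (simp add: letter_def)
      then show ?thesis using letter[of j] 2 ij by auto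
    next
      case 3 then have "letter j \<in> set a" using len by (simp add: letter_def)
      then show ?thesis using letter[of i] 3 ij by auto
    next
      case 4
      then have "K ! i = K ! j" using letter ij by metis
      then have "Bs ! (i - m) = Bs ! (j - m)" using 4 ij len by (simp add: K_def nth_append)
      moreover have "i - m < length Bs" "j - m < length Bs" using 4 ij len by (auto simp: K_def)
      ultimately show ?thesis using dist 4 by (simp add: nth_eq_iff_index_eq)
    qed
  qed
  have "K \<in> set_supercomp n m"
    unfolding set_supercomp_def
  proof (intro CollectI conjI)
    show "m \<le> length K" using len by (simp add: K_def)
    show "\<forall>B\<in>set K. B \<noteq> {} \<and> B \<subseteq> {0..n}"
      using len by (auto simp: setK occ_empty_iff) (auto simp: mem_occ)
    show "(\<Union>B\<in>set K. B - {0}) = {1..n}"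
    proof (intro equalityI subsetI)
      fix j assume "j \<in> {1..n}"
      then have "j \<in> occ b (b ! (j - 1))" "b ! (j - 1) \<in> set b" "j \<noteq> 0" using len by (auto simp: mem_occ)
      then show "j \<in> (\<Union>B\<in>set K. B - {0})" unfolding setK by (cases "b ! (j - 1) \<in> set a") auto
    qed (use len in \<open>auto simp: setK mem_occ split: if_splits\<close>)
    show "\<forall>i<length K. \<forall>j<length K. i \<noteq> j \<longrightarrow> K ! i \<inter> K ! j \<subseteq> {0}"
    proof (intro allI impI)
      fix i j assume "i < length K" "j < length K" "i \<noteq> j"
      then have "occ b (letter i) \<inter> occ b (letter j) = {}" using inj occ_disjoint by blast
      then show "K ! i \<inter> K ! j \<subseteq> {0}" using Klet \<open>i < length K\<close> \<open>j < length K\<close> by blast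
    qed
    show "\<forall>i<length K. 0 \<in> K ! i \<longleftrightarrow> i < m"
      using fer bos by (metis insertI1 not_le zero_notin_occ)
    show "\<forall>i j. m \<le> i \<longrightarrow> i < j \<longrightarrow> j < length K \<longrightarrow> Min (K ! i) < Min (K ! j)"
      using Bs(2) len by (auto simp: sorted_wrt_iff_nth_less K_def nth_append)
  qed (use len in auto)
  moreover have "(a, b) \<in> words n m K"
    unfolding words_def
  proof (intro CollectI case_prodI conjI ballI allI impI)
    fix i j assume "i < m" "j \<in> {1..n}"
    then show "a ! i = b ! (j - 1) \<longleftrightarrow> j \<in> K ! i - {0}" using fer len by (auto simp: mem_occ)
  next
    fix i j assume ij: "i \<in> {1..n}" "j \<in> {1..n}"
    show "b ! (i - 1) = b ! (j - 1) \<longleftrightarrow> (\<exists>B\<in>set K. i \<in> B \<and> j \<in> B)"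
    proof
      assume eq: "b ! (i - 1) = b ! (j - 1)"
      have "i \<in> occ b (b ! (i - 1))" "j \<in> occ b (b ! (i - 1))" "b ! (i - 1) \<in> set b"
        using ij len eq by (auto simp: mem_occ)
      then show "\<exists>B\<in>set K. i \<in> B \<and> j \<in> B" unfolding setK by (cases "b ! (i - 1) \<in> set a") auto
    qed (use ij in \<open>auto simp: setK mem_occ\<close>)
  qed (use len in auto)
  ultimately show ?thesis by blast
qed

lemma the_supercomp:
  assumes "K \<in> set_supercomp n m" "(a, b) \<in> words n m K"
  shows "(THE L. L \<in> set_supercomp n m \<and> (a, b) \<in> words n m L) = K"
  by (rule the_equality) (use assms supercomp_unique in auto)

text \<open>The list index of the block that contains a position serves as its letter. Fermionic
  blocks come first, so with the thetas \<open>[0..<m]\<close> this is a concrete word of kernel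
  \<open>K\<close>.\<close>

definition can_word :: "nat \<Rightarrow> nat set list \<Rightarrow> nat list" where
  "can_word n K = map (\<lambda>k. THE i. i < length K \<and> Suc k \<in> K ! i) [0..<n]"

lemma length_can_word [simp]: "length (can_word n K) = n"
  by (simp add: can_word_def)

lemma can_word_words:
  assumes "K \<in> set_supercomp n m"
  shows "([0..<m], can_word n K) \<in> words n m K"
proof -
  note K = supercompD[OF assms]
  have cw: "can_word n K ! (j - 1) = i" if "j \<in> {1..n}" "i < length K" "j \<in> K ! i" for i j
  proof -
    have "(THE i. i < length K \<and> Suc (j - 1) \<in> K ! i) = i"
      by (rule the_equality) (use that K(6) in auto)
    then show ?thesis using that by (auto simp: can_word_def)
  qed
  show ?thesis
    unfolding words_def
  proof (intro CollectI case_prodI conjI ballI allI impI)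
    fix i j assume i: "i < m" and j: "j \<in> {1..n}"
    then obtain i' where "i' < length K" "j \<in> K ! i'" using K(5) by blast
    then show "[0..<m] ! i = can_word n K ! (j - 1) \<longleftrightarrow> j \<in> K ! i - {0}"
      using cw j i K(2) K(6)[of i i' j] by auto
  next
    fix i j assume ij: "i \<in> {1..n}" "j \<in> {1..n}"
    obtain i' where i': "i' < length K" "i \<in> K ! i'" using K(5) ij by blast
    obtain j' where j': "j' < length K" "j \<in> K ! j'" using K(5) ij by blast
    have "i' = j' \<longleftrightarrow> (\<exists>B\<in>set K. i \<in> B \<and> j \<in> B)"
    proof
      assume "\<exists>B\<in>set K. i \<in> B \<and> j \<in> B"
      then obtain l where "l < length K" "i \<in> K ! l" "j \<in> K ! l" by (auto simp: in_set_conv_nth)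
      moreover have "i \<noteq> 0" "j \<noteq> 0" using ij by auto
      ultimately show "i' = j'" using K(6)[of i' l i] K(6)[of j' l j] i' j' by metis
    next
      assume "i' = j'"
      then show "\<exists>B\<in>set K. i \<in> B \<and> j \<in> B" using i' j' by (intro bexI[of _ "K ! i'"]) auto
    qed
    then show "can_word n K ! (i - 1) = can_word n K ! (j - 1) \<longleftrightarrow> (\<exists>B\<in>set K. i \<in> B \<and> j \<in> B)"
      using cw[OF ij(1) i'] cw[OF ij(2) j'] by simp
  qed auto
qed

text \<open>A word \<open>(a, b)\<close> is treated as the list \<open>a @ b\<close>; equality of its letters is its kernel.\<close>

lemma refines_iff:
  assumes K: "K \<in> set_supercomp n m" "(a, b) \<in> words n m K"
    and L: "L \<in> set_supercomp n m" "(a', b') \<in> words n m L"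
    and dist: "distinct a" "distinct a'"
  shows "refines m K L \<longleftrightarrow>
    (\<forall>i<m + n. \<forall>j<m + n. (a @ b) ! i = (a @ b) ! j \<longrightarrow> (a' @ b') ! i = (a' @ b') ! j)"
    (is "_ \<longleftrightarrow> ?R")
proof -
  note wK = wordsD(1,2)[OF K(2)] and wL = wordsD(1,2)[OF L(2)]
  note fK = supercomp_fermionic[OF K] and fL = supercomp_fermionic[OF L]
  note bK = supercomp_bosonic[OF K] and bL = supercomp_bosonic[OF L]
  show ?thesis
  proof
    assume "refines m K L"
    then have refF: "\<And>i. i < m \<Longrightarrow> \<exists>N\<subseteq>set (drop m K). L ! i = K ! i \<union> \<Union>N"
      and refB: "\<And>B. B \<in> set (drop m L) \<Longrightarrow> \<exists>N\<subseteq>set (drop m K). B = \<Union>N"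
      unfolding refines_def by simp_all
    have bb: "b' ! i = b' ! j" if ij: "i < n" "j < n" "b ! i = b ! j" for i j
    proof -
      \<comment> \<open>Two positions with equal letters in \<open>b\<close> lie in the same block,
        so a union of blocks contains both or neither.\<close>
      have uni: "Suc j \<in> \<Union>N" if N: "N \<subseteq> occ b ` (set b - set a)" "Suc i \<in> \<Union>N" for N
      proof -
        from N(2) obtain B where B: "B \<in> N" "Suc i \<in> B" by blast
        then obtain c where "B = occ b c" using N(1) by blast
        then show ?thesis using B ij wK by (intro UnionI[of B]) (auto simp: mem_occ)
      qed
      have bi: "b' ! i \<in> set b'" using ij wL by auto
      have "(\<exists>k<m. b' ! i = a' ! k) \<or> b' ! i \<in> set b' - set a'"
        using bi wL(1) by (auto simp: in_set_conv_nth)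
      then consider k where "k < m" "b' ! i = a' ! k" | "b' ! i \<in> set b' - set a'"
        by blast
      then show ?thesis
      proof cases
        case 1
        obtain N where N: "N \<subseteq> set (drop m K)" "L ! k = K ! k \<union> \<Union>N"
          using refF[OF 1(1)] by blast
        have "Suc i \<in> L ! k" using fL[OF 1(1)] 1 ij wL by (simp add: mem_occ)
        moreover have "Suc j \<in> K ! k" if "Suc i \<in> K ! k"
          using that ij wK by (simp add: fK[OF 1(1)] mem_occ)
        ultimately have "Suc j \<in> L ! k" using N uni unfolding bK by auto
        then show ?thesis using fL[OF 1(1)] 1 by (simp add: mem_occ)
      next
        case 2
        then have "occ b' (b' ! i) \<in> set (drop m L)" using bL by simp
        then obtain N where N: "N \<subseteq> set (drop m K)" "occ b' (b' ! i) = \<Union>N"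
          using refB by blast
        have "Suc i \<in> occ b' (b' ! i)" using ij wL by (simp add: mem_occ)
        then have "Suc j \<in> occ b' (b' ! i)" using N uni unfolding bK by auto
        then show ?thesis by (simp add: mem_occ)
      qed
    qed
    have ab: "a' ! i = b' ! j" if ij: "i < m" "j < n" "a ! i = b ! j" for i j
    proof -
      have "K ! i \<subseteq> L ! i" using refF[OF ij(1)] by blast
      moreover have "Suc j \<in> K ! i" using fK[OF ij(1)] ij wK by (simp add: mem_occ)
      ultimately show ?thesis using fL[OF ij(1)] by (auto simp: mem_occ)
    qed
    show ?R
    proof (intro allI impI)
      fix i j assume ij: "i < m + n" "j < m + n" and eq: "(a @ b) ! i = (a @ b) ! j"
      consider "i < m" "j < m" | "i < m" "m \<le> j" | "m \<le> i" "j < m" | "m \<le> i" "m \<le> j" by linarith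
      then show "(a' @ b') ! i = (a' @ b') ! j"
      proof cases
        case 1
        then show ?thesis using eq dist wK by (simp add: nth_append nth_eq_iff_index_eq)
      next
        case 2
        then show ?thesis using eq ij wK wL ab[of i "j - m"] by (simp add: nth_append)
      next
        case 3
        then show ?thesis using eq ij wK wL ab[of j "i - m"] by (simp add: nth_append)
      next
        case 4
        then show ?thesis using eq ij wK wL bb[of "i - m" "j - m"] by (simp add: nth_append)
      qed
    qed
  next
    assume R: ?R
    have bb: "b' ! i = b' ! j" if "i < n" "j < n" "b ! i = b ! j" for i j
      using R[rule_format, of "m + i" "m + j"] that wK wL by (simp add: nth_append)
    have ab: "a' ! i = b' ! j" if "i < m" "j < n" "a ! i = b ! j" for i j
      using R[rule_format, of i "m + j"] that wK wL by (simp add: nth_append)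
    have occ_sub: "occ b c \<subseteq> occ b' d" if "c \<in> set b" "occ b c \<inter> occ b' d \<noteq> {}" for c d
    proof
      fix x assume x: "x \<in> occ b c"
      from that(2) obtain y where y: "y \<in> occ b c" "y \<in> occ b' d" by blast
      then show "x \<in> occ b' d" using x wK wL bb[of "x - 1" "y - 1"] by (auto simp: mem_occ)
    qed
    show "refines m K L"
      unfolding refines_def
    proof (intro conjI allI impI ballI)
      fix i assume i: "i < m"
      \<comment> \<open>All nonfermionic blocks of \<open>K\<close> that meet the block of
        \<open>L\<close>; by \<open>occ_sub\<close> they lie inside it.\<close>
      let ?N = "{B \<in> occ b ` (set b - set a). B \<inter> occ b' (a' ! i) \<noteq> {}}"
      have "L ! i = K ! i \<union> \<Union>?N"
      proof (intro equalityI subsetI)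
        fix x assume "x \<in> L ! i"
        then have "x = 0 \<or> x \<in> occ b' (a' ! i)" using fL[OF i] by simp
        then show "x \<in> K ! i \<union> \<Union>?N"
        proof
          assume x: "x \<in> occ b' (a' ! i)"
          then have xb: "x \<in> occ b (b ! (x - 1))" "b ! (x - 1) \<in> set b" using wK wL by (auto simp: mem_occ)
          show ?thesis
          proof (cases "b ! (x - 1) \<in> set a")
            case True
            \<comment> \<open>The fermionic block \<open>k\<close> of \<open>K\<close> sits in the
              fermionic block \<open>k\<close> of \<open>L\<close>; distinctness of
              \<open>a'\<close> then forces \<open>k = i\<close>.\<close>
            then obtain k where k: "k < m" "a ! k = b ! (x - 1)" using wK by (auto simp: in_set_conv_nth)
            then have "a' ! k = a' ! i" using ab[of k "x - 1"] x wL by (auto simp: mem_occ)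
            then have "k = i" using k i dist wL by (simp add: nth_eq_iff_index_eq)
            then show ?thesis using fK[OF i] k xb by simp
          next
            case False
            then show ?thesis using xb x by blast
          qed
        qed (simp add: fK[OF i])
      next
        fix x assume "x \<in> K ! i \<union> \<Union>?N"
        then show "x \<in> L ! i"
        proof
          assume "x \<in> K ! i"
          then show ?thesis using fK[OF i] fL[OF i] ab[OF i, of "x - 1"] wK wL by (auto simp: mem_occ)
        next
          assume "x \<in> \<Union>?N"
          then show ?thesis using occ_sub fL[OF i] by blast
        qed
      qed
      then show "\<exists>N\<subseteq>set (drop m K). L ! i = K ! i \<union> \<Union>N" unfolding bK by (intro exI[of _ ?N]) auto
    next
      fix B assume "B \<in> set (drop m L)"
      then obtain d where d: "B = occ b' d" "d \<in> set b'" "d \<notin> set a'" using bL by auto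
      let ?N = "{B \<in> occ b ` (set b - set a). B \<inter> occ b' d \<noteq> {}}"
      have "B = \<Union>?N"
      proof (intro equalityI subsetI)
        fix x assume "x \<in> B"
        then have x: "x \<in> occ b' d" using d by simp
        then have xb: "x \<in> occ b (b ! (x - 1))" "b ! (x - 1) \<in> set b" using wK wL by (auto simp: mem_occ)
        have "b ! (x - 1) \<notin> set a"
        proof
          assume "b ! (x - 1) \<in> set a"
          then obtain k where k: "k < m" "a ! k = b ! (x - 1)" using wK by (auto simp: in_set_conv_nth)
          then have "a' ! k = d" using ab[of k "x - 1"] x wL by (auto simp: mem_occ)
          then show False using d k wL by auto
        qed
        then show "x \<in> \<Union>?N" using xb x by blast
      next
        fix x assume "x \<in> \<Union>?N"
        then show "x \<in> B" using occ_sub d by blast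
      qed
      then show "\<exists>N\<subseteq>set (drop m K). B = \<Union>N" unfolding bK by (intro exI[of _ ?N]) auto
    qed
  qed
qed

lemma supercomp_eqI_kernel:
  assumes K: "K \<in> set_supercomp n m" "(a, b) \<in> words n m K"
    and L: "L \<in> set_supercomp n m" "(a', b') \<in> words n m L"
    and ker: "\<And>i j. i < m + n \<Longrightarrow> j < m + n \<Longrightarrow> (a @ b) ! i = (a @ b) ! j \<longleftrightarrow> (a' @ b') ! i = (a' @ b') ! j"
  shows "K = L"
proof (rule supercomp_unique[OF K(1) L(1) K(2)])
  note wK = wordsD[OF K(2)] and wL = wordsD[OF L(2)]
  show "(a, b) \<in> words n m L"
    unfolding words_def
  proof (intro CollectI case_prodI conjI ballI allI impI)
    fix i j assume ij: "i < m" "j \<in> {1..n}"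
    then obtain j' where "j = Suc j'" "j' < n" by (cases j) auto
    then have "a ! i = b ! (j - 1) \<longleftrightarrow> a' ! i = b' ! (j - 1)"
      using ker[of i "m + j'"] wK(1,2) wL(1,2) ij(1) by (simp add: nth_append)
    then show "a ! i = b ! (j - 1) \<longleftrightarrow> j \<in> L ! i - {0}" using wL(3)[OF ij] ij by auto
  next
    fix i j assume ij: "i \<in> {1..n}" "j \<in> {1..n}"
    then obtain i' j' where "i = Suc i'" "i' < n" "j = Suc j'" "j' < n" by (cases i; cases j) auto
    then have "b ! (i - 1) = b ! (j - 1) \<longleftrightarrow> b' ! (i - 1) = b' ! (j - 1)"
      using ker[of "m + i'" "m + j'"] wK(1,2) wL(1,2) by (simp add: nth_append)
    then show "b ! (i - 1) = b ! (j - 1) \<longleftrightarrow> (\<exists>B\<in>set L. i \<in> B \<and> j \<in> B)" using wL(4)[OF ij] by simp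
  qed (use wK in auto)
qed

text \<open>The element 0 of a fermionic block is matched by the occurrence of its letter in
  \<open>a\<close>, so the size of any block is the multiplicity of its letter in \<open>a\<close>
  and \<open>b\<close> together.\<close>

lemma blocks_fact_word:
  assumes K: "K \<in> set_supercomp n m" "(a, b) \<in> words n m K" and dist: "distinct a"
  shows "blocks_fact K = mfact (mset a + mset b)"
proof -
  note w = wordsD(1,2)[OF K(2)]
  have take: "take m K = map (\<lambda>c. insert 0 (occ b c)) a"
    using supercomp_fermionic[OF K] supercompD(2)[OF K(1)] w by (intro nth_equalityI) auto
  have distK: "distinct (drop m K)"
    using supercompD(8)[OF K(1)] by (rule sorted_wrt_key_distinct)
  have ca: "count (mset a + mset b) c = (if c \<in> set a then Suc (count (mset b) c) else count (mset b) c)" for c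
    using dist by (auto simp: distinct_count_atmost_1)
  have "blocks_fact K = (\<Prod>B\<leftarrow>take m K. fact (card B)) * (\<Prod>B\<leftarrow>drop m K. fact (card B))"
    unfolding blocks_fact_def by (metis append_take_drop_id map_append prod_list.append)
  also have "(\<Prod>B\<leftarrow>take m K. fact (card B)) = (\<Prod>c\<in>set a. fact (count (mset a + mset b) c))"
    unfolding take prod.distinct_set_conv_list[OF dist]
    by (intro arg_cong[where f = prod_list]) (simp add: ca card_occ del: fact_Suc count_union)
  also have "(\<Prod>B\<leftarrow>drop m K. fact (card B)) = (\<Prod>B\<in>occ b ` (set b - set a). fact (card B))"
    by (simp add: prod.distinct_set_conv_list[OF distK, symmetric] supercomp_bosonic[OF K])
  also have "\<dots> = (\<Prod>c\<in>set b - set a. fact (count (mset a + mset b) c))"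
    by (subst prod.reindex)
       (auto simp: card_occ ca simp del: count_union intro!: inj_on_subset[OF inj_on_occ] prod.cong)
  also have "(\<Prod>c\<in>set a. fact (count (mset a + mset b) c)) * \<dots> = (\<Prod>c\<in>set a \<union> set b. fact (count (mset a + mset b) c))"
    by (subst prod.union_disjoint[symmetric]) (auto intro: prod.cong)
  finally show ?thesis by (simp add: mfact_def)
qed

text \<open>The pairs of letters at equal positions name the joint fibres of the two words, so this
  is the product of the factorials of their sizes. It expresses the coefficient in
  \<open>nc_h\<close> without set supercompositions and meets.\<close>

definition kappa :: "nat list \<times> nat list \<Rightarrow> nat list \<times> nat list \<Rightarrow> nat" where
  "kappa k w = mfact (mset (zip (fst k) (fst w)) + mset (zip (snd k) (snd w)))"

text \<open>The word of pairs has as kernel the intersection of the two kernels, and by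
  \<open>refines_iff\<close> the order is inclusion of kernels; hence its set supercomposition is
  the greatest lower bound.\<close>

lemma blocks_fact_meet:
  assumes K: "K \<in> set_supercomp n m" "(a, b) \<in> words n m K" "distinct a"
    and L: "L \<in> set_supercomp n m" "(a', b') \<in> words n m L" "distinct a'"
  shows "blocks_fact (meet n m K L) = kappa (a, b) (a', b')"
proof -
  note wK = wordsD(1,2)[OF K(2)] and wL = wordsD(1,2)[OF L(2)]
  \<comment> \<open>\<open>prod_encode\<close> turns pairs back into natural numbers, so that the
    lemmas about words apply.\<close>
  define a'' where "a'' = map prod_encode (zip a a')"
  define b'' where "b'' = map prod_encode (zip b b')"
  have len: "length a'' = m" "length b'' = n" using wK wL by (auto simp: a''_def b''_def)
  have da: "distinct a''" using K(3) wK wL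
    by (auto simp: a''_def distinct_map distinct_zipI1 intro: inj_on_subset[OF inj_prod_encode])
  obtain J where J: "J \<in> set_supercomp n m" "(a'', b'') \<in> words n m J"
    using ex_supercomp[OF da len supercompD(1)[OF K(1)]] by blast
  have nth: "(a'' @ b'') ! i = prod_encode ((a @ b) ! i, (a' @ b') ! i)" if "i < m + n" for i
    using that wK wL by (auto simp: a''_def b''_def nth_append)
  have ker: "(a'' @ b'') ! i = (a'' @ b'') ! j \<longleftrightarrow> (a @ b) ! i = (a @ b) ! j \<and> (a' @ b') ! i = (a' @ b') ! j"
    if "i < m + n" "j < m + n" for i j
    using that by (simp add: nth prod_encode_eq)
  have inf: "refines m J' J \<longleftrightarrow> refines m J' K \<and> refines m J' L" if J': "J' \<in> set_supercomp n m" for J'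
    unfolding refines_iff[OF J' can_word_words[OF J'] J distinct_upt da]
      refines_iff[OF J' can_word_words[OF J'] K(1,2) distinct_upt K(3)]
      refines_iff[OF J' can_word_words[OF J'] L(1,2) distinct_upt L(3)]
    using ker by meson
  have refl: "refines m M M" if M: "M \<in> set_supercomp n m" for M
    unfolding refines_iff[OF M can_word_words[OF M] M can_word_words[OF M] distinct_upt distinct_upt] by blast
  have "meet n m K L = J"
    unfolding meet_def
  proof (rule the_equality)
    show "J \<in> set_supercomp n m \<and> refines m J K \<and> refines m J L \<and>
      (\<forall>J'\<in>set_supercomp n m. refines m J' K \<longrightarrow> refines m J' L \<longrightarrow> refines m J' J)"
      using J inf[OF J(1)] refl[OF J(1)] inf by blast
  next
    fix M assume M: "M \<in> set_supercomp n m \<and> refines m M K \<and> refines m M L \<and>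
      (\<forall>J'\<in>set_supercomp n m. refines m J' K \<longrightarrow> refines m J' L \<longrightarrow> refines m J' M)"
    then have M': "M \<in> set_supercomp n m" by blast
    have "refines m M J" "refines m J M" using M inf[OF M'] inf[OF J(1)] refl[OF J(1)] J(1) by blast+
    then show "M = J"
      unfolding refines_iff[OF M' can_word_words[OF M'] J distinct_upt da]
        refines_iff[OF J M' can_word_words[OF M'] da distinct_upt]
      by (intro supercomp_eqI_kernel[OF M' can_word_words[OF M'] J]) blast
  qed
  then have "blocks_fact (meet n m K L) = mfact (mset a'' + mset b'')"
    using blocks_fact_word[OF J da] by simp
  also have "mset a'' + mset b'' = image_mset prod_encode (mset (zip a a') + mset (zip b b'))"
    by (simp add: a''_def b''_def)
  also have "mfact \<dots> = kappa (a, b) (a', b')"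
    unfolding kappa_def by (subst mfact_image_inj) (auto intro: inj_on_subset[OF inj_prod_encode])
  finally show ?thesis .
qed

section \<open>Canonical order of the thetas\<close>

definition first :: "nat list \<Rightarrow> nat \<Rightarrow> nat" where
  "first b c = min0 (occ b c)"

text \<open>The order condition on the fermionic blocks of a set superpartition, read off a word:
  thetas stand in the order in which their indices first occur in \<open>b\<close>, and one that
  does not occur has key 0 and stands in front.\<close>

definition canon :: "nat list \<Rightarrow> nat list \<Rightarrow> bool" where
  "canon a b \<longleftrightarrow> sorted_wrt (\<lambda>c d. first b c < first b d) a"

lemma canon_distinct: "canon a b \<Longrightarrow> distinct a"
  unfolding canon_def by (rule sorted_wrt_key_distinct)

lemma canon_unique: "canon a b \<Longrightarrow> canon a' b \<Longrightarrow> set a = set a' \<Longrightarrow> a = a'"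
  unfolding canon_def by (rule sorted_wrt_key_unique)

lemma first_0: "c \<notin> set b \<Longrightarrow> first b c = 0"
  using occ_empty_iff[of b c] by (simp add: first_def min0_def)

lemma first_mem: "c \<in> set b \<Longrightarrow> first b c \<in> occ b c"
  using occ_empty_iff[of b c] by (simp add: first_def min0_def)

lemma canon_card:
  assumes "canon a b"
  shows "card (set a - set b) \<le> 1"
proof (rule ccontr)
  assume "\<not> ?thesis"
  then have "\<not> (\<exists>x. set a - set b \<subseteq> {x})" by (metis card_mono card.empty card_insert_le_m1 finite.emptyI finite.insertI is_singletonI is_singleton_altdef le_numeral_extra(4))
  then obtain c d where "c \<noteq> d" "c \<in> set a - set b" "d \<in> set a - set b" by blast
  moreover have "inj_on (first b) (set a)"
    using assms by (simp add: canon_def sorted_wrt_key_iff distinct_map)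
  ultimately show False using first_0 by (metis DiffD1 DiffD2 inj_onD)
qed

lemma canon_length:
  assumes "canon a b"
  shows "length a \<le> length b + 1"
proof -
  have "length a = card (set a)" using canon_distinct[OF assms] by (simp add: distinct_card)
  also have "\<dots> \<le> card (set a - set b) + card (set b)"
    by (metis card_mono card_Un_le finite_set finite_UnI finite_Diff le_trans Un_Diff_cancel2 Un_upper1)
  also have "\<dots> \<le> 1 + length b" using canon_card[OF assms] card_length[of b] by linarith
  finally show ?thesis by simp
qed

lemma ex_canon:
  assumes "finite A" "card (A - set b) \<le> 1"
  shows "\<exists>a. set a = A \<and> canon a b"
proof -
  have "inj_on (first b) A"
  proof (rule inj_onI)
    fix c d assume cd: "c \<in> A" "d \<in> A" "first b c = first b d"
    show "c = d"
    proof (cases "c \<in> set b \<or> d \<in> set b")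
      case True
      then have "c \<in> set b \<and> d \<in> set b" by (metis cd(3) first_0 first_mem zero_notin_occ)
      then have "first b c \<in> occ b c \<inter> occ b d" using first_mem cd(3) by (metis IntI)
      then show ?thesis using occ_disjoint by blast
    next
      case False
      then show ?thesis using assms cd card_le_Suc0_iff_eq[of "A - set b"] by auto
    qed
  qed
  then show ?thesis unfolding canon_def using ex_sorted_wrt_key assms(1) by blast
qed

text \<open>Two fermionic blocks both contain 0, so their differences are plain sets of positions
  and the condition compares first occurrences. For a pair whose second block is nonfermionic the
  inequality holds in every set supercomposition, by the 0 in the first block or by the order of the
  minima.\<close>

lemma superpart_iff_canon:
  assumes K: "K \<in> set_supercomp n m" "(a, b) \<in> words n m K"
  shows "K \<in> set_superpart n m \<longleftrightarrow> canon a b"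
proof -
  note sc = supercompD[OF K(1)] and w = wordsD(1,2)[OF K(2)] and fer = supercomp_fermionic[OF K]
  have A: "min0 (K ! i - K ! j) < min0 (K ! j - K ! i) \<longleftrightarrow> first b (a ! i) < first b (a ! j)"
    if ij: "i < m" "j < m" for i j
  proof (cases "a ! i = a ! j")
    case False
    then have "K ! i - K ! j = occ b (a ! i)" "K ! j - K ! i = occ b (a ! j)"
      using occ_disjoint[OF False, of b] by (auto simp: fer ij)
    then show ?thesis by (simp add: first_def)
  qed (simp add: fer ij)
  have B: "min0 (K ! i - K ! j) < min0 (K ! j - K ! i)" if ij: "i < j" "m \<le> j" "j < length K" for i j
  proof -
    have fin: "finite (K ! l)" if "l < length K" for l using sc(4)[OF that] finite_subset by blast
    have j0: "0 \<notin> K ! j" "K ! j \<noteq> {}" using sc(7)[of j] sc(3)[of j] ij by auto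
    have disj: "K ! j - K ! i = K ! j"
      using sc(6)[of i j] ij j0 by (auto dest: gr0I)
    show ?thesis
    proof (cases "i < m")
      case True
      then have "0 \<in> K ! i - K ! j" using sc(7)[of i] ij j0 by auto
      then have "min0 (K ! i - K ! j) = 0"
        using Min_le[of "K ! i - K ! j" 0] fin[of i] ij by (auto simp: min0_def)
      moreover have "min0 (K ! j) \<in> K ! j" using j0 fin[of j] ij by (simp add: min0_def)
      then have "min0 (K ! j) \<noteq> 0" using j0 by metis
      ultimately show ?thesis using disj by simp
    next
      case False
      have "K ! i - K ! j = K ! i" using disj sc(7)[of i] False ij by blast
      moreover have "Min (K ! i) < Min (K ! j)"
        using K(1) False ij unfolding set_supercomp_def by auto
      moreover have "K ! i \<noteq> {}" using sc(3)[of i] ij by auto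
      ultimately show ?thesis using disj j0 by (simp add: min0_def)
    qed
  qed
  have "K \<in> set_superpart n m \<longleftrightarrow>
      (\<forall>i j. i < j \<longrightarrow> j < length K \<longrightarrow> min0 (K ! i - K ! j) < min0 (K ! j - K ! i))"
    using K(1) unfolding set_superpart_def by fastforce
  also have "\<dots> \<longleftrightarrow> (\<forall>i j. i < j \<longrightarrow> j < m \<longrightarrow> first b (a ! i) < first b (a ! j))"
  proof (intro iffI allI impI)
    fix i j assume h: "\<forall>i j. i < j \<longrightarrow> j < length K \<longrightarrow> min0 (K ! i - K ! j) < min0 (K ! j - K ! i)"
      and "i < j" "j < m"
    then show "first b (a ! i) < first b (a ! j)" using A sc(2) by (meson less_le_trans less_trans)
  next
    fix i j assume h: "\<forall>i j. i < j \<longrightarrow> j < m \<longrightarrow> first b (a ! i) < first b (a ! j)"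
      and "i < j" "j < length K"
    then show "min0 (K ! i - K ! j) < min0 (K ! j - K ! i)"
      using A B by (metis not_le less_trans)
  qed
  also have "\<dots> \<longleftrightarrow> canon a b"
    unfolding canon_def sorted_wrt_iff_nth_less w(1) by blast
  finally show ?thesis .
qed

lemma superpart_supercomp: "I \<in> set_superpart n m \<Longrightarrow> I \<in> set_supercomp n m"
  by (simp add: set_superpart_def)

lemma ex_superpart:
  assumes "canon a b" "length a = m" "length b = n"
  shows "\<exists>I\<in>set_superpart n m. (a, b) \<in> words n m I"
  using ex_supercomp[of a m b n] assms canon_distinct canon_length superpart_iff_canon by fastforce

lemma can_word_canon: "I \<in> set_superpart n m \<Longrightarrow> canon [0..<m] (can_word n I)"
  using superpart_iff_canon can_word_words superpart_supercomp by blast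

lemma finite_set_superpart: "finite (set_superpart n m)"
proof -
  have "set_superpart n m \<subseteq> {K. set K \<subseteq> Pow {0..n} \<and> distinct K}"
  proof (rule subsetI, rule CollectI, rule conjI)
    fix K assume K: "K \<in> set_superpart n m"
    have "B \<subseteq> {0..n}" if "B \<in> set K" for B
      using supercompD(4)[OF superpart_supercomp[OF K]] that by (metis in_set_conv_nth)
    then show "set K \<subseteq> Pow {0..n}" by blast
    show "distinct K"
      using K unfolding distinct_conv_nth set_superpart_def by (metis (mono_tags, lifting) mem_Collect_eq nat_neq_iff)
  qed
  then show ?thesis using finite_subset_distinct[of "Pow {0..n}"] by (auto intro: finite_subset)
qed

section \<open>Noncommutative series and their coefficients on words\<close>

text \<open>The coefficient of the word with thetas in the order \<open>a\<close>, for
  \<open>a\<close> without repetition, where the series itself stores only the sorted order. It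
  serves for noncommuting and for commuting \<open>x\<close>.\<close>

definition word_coeff :: "'w series \<Rightarrow> nat list \<Rightarrow> 'w \<Rightarrow> rat" where
  "word_coeff f a w = theta_sign a * f (set a, w)"

lemma word_coeff_sorted:
  assumes "finite A"
  shows "word_coeff f (sorted_list_of_set A) w = f (A, w)"
  using assms by (simp add: word_coeff_def theta_sign_sorted)

lemma word_coeff_permute:
  assumes "p permutes {..<length a}" "distinct a"
  shows "word_coeff f (permute_list p a) w = of_int (sign p) * word_coeff f a w"
  using assms by (simp add: word_coeff_def theta_sign_permute)

lemma word_coeff_eq_0_iff [simp]: "word_coeff f a w = 0 \<longleftrightarrow> f (set a, w) = 0"
  by (simp add: word_coeff_def)

lemma word_coeff_linear:
  "word_coeff (\<lambda>t. c * f t + d * g t) a w = c * word_coeff f a w + d * word_coeff g a w"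
  by (simp add: word_coeff_def algebra_simps)

lemma word_coeff_sum:
  "word_coeff (\<lambda>t. \<Sum>i\<in>T. c i * u i t) a w = (\<Sum>i\<in>T. c i * word_coeff (u i) a w)"
  by (simp add: word_coeff_def sum_distrib_left algebra_simps)

lemma word_coeff_0 [simp]: "word_coeff (\<lambda>t. 0) a w = 0"
  by (simp add: word_coeff_def)

lemma permute_indices_apply:
  assumes \<sigma>: "\<sigma> permutes S" and fin: "\<And>A b. f (A, b) \<noteq> 0 \<Longrightarrow> finite A"
  shows "permute_indices \<sigma> f (\<sigma> ` A, map \<sigma> b) =
    f (A, b) * theta_sign (map \<sigma> (sorted_list_of_set A))"
proof -
  let ?G = "\<lambda>(A, b) t. f (A, b) * monom (map \<sigma> (sorted_list_of_set A)) (map \<sigma> b) t"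
  have inj: "inj \<sigma>" using \<sigma> by (rule permutes_inj)
  have sub: "{i \<in> UNIV. ?G i (\<sigma> ` A, map \<sigma> b) \<noteq> 0} \<subseteq> {(A, b)}"
  proof
    fix i assume "i \<in> {i \<in> UNIV. ?G i (\<sigma> ` A, map \<sigma> b) \<noteq> 0}"
    moreover obtain A' b' where i: "i = (A', b')" by (cases i)
    ultimately have ne: "f (A', b') \<noteq> 0" and "\<sigma> ` set (sorted_list_of_set A') = \<sigma> ` A" "map \<sigma> b' = map \<sigma> b"
      by (auto simp: monom_def split: if_splits)
    moreover have "finite A'" using ne by (rule fin)
    ultimately have "A' = A" "b' = b" using inj by (auto simp: inj_image_eq_iff dest: map_injective)
    then show "i \<in> {(A, b)}" using i by simp
  qed
  have "permute_indices \<sigma> f (\<sigma> ` A, map \<sigma> b) = ?G (A, b) (\<sigma> ` A, map \<sigma> b)"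
  proof -
    have "permute_indices \<sigma> f (\<sigma> ` A, map \<sigma> b) = (\<Sum>i\<in>{(A, b)}. ?G i (\<sigma> ` A, map \<sigma> b))"
      unfolding permute_indices_def formal_sum_def by (rule sum.mono_neutral_left) (use sub in auto)
    then show ?thesis by simp
  qed
  also have "\<dots> = f (A, b) * theta_sign (map \<sigma> (sorted_list_of_set A))"
  proof (cases "f (A, b) = 0")
    case False
    then show ?thesis using fin inj by (auto simp: monom_def distinct_map inj_on_subset)
  qed simp
  finally show ?thesis .
qed

text \<open>On words, relabelling the indices produces no sign, so invariance becomes equality of
  coefficients; \<open>word_coeff\<close> absorbs the signs of sorting.\<close>

lemma sNCSymI:
  assumes deg: "\<And>A b. f (A, b) \<noteq> 0 \<Longrightarrow> finite A \<and> card A + length b \<le> d"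
    and inv: "\<And>\<sigma> S a b. finite S \<Longrightarrow> \<sigma> permutes S \<Longrightarrow> distinct a \<Longrightarrow>
      word_coeff f (map \<sigma> a) (map \<sigma> b) = word_coeff f a b"
  shows "f \<in> sNCSym"
proof -
  have "permute_indices \<sigma> f = f" if \<sigma>: "finite S" "\<sigma> permutes S" for \<sigma> S
  proof
    fix t :: "nat set \<times> nat list"
    obtain B c where t: "t = (B, c)" by (cases t)
    define A b where "A = inv \<sigma> ` B" and "b = map (inv \<sigma>) c"
    have B: "B = \<sigma> ` A" "c = map \<sigma> b"
      using permutes_surj[OF \<sigma>(2)] by (simp_all add: A_def b_def image_comp surj_iff)
    have "permute_indices \<sigma> f (B, c) = f (A, b) * theta_sign (map \<sigma> (sorted_list_of_set A))"
      unfolding B using \<sigma>(2) by (rule permute_indices_apply) (use deg in blast)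
    also have "\<dots> = f (B, c)"
    proof (cases "finite A")
      case True
      then have "word_coeff f (map \<sigma> (sorted_list_of_set A)) c = f (A, b)"
        using inv[OF \<sigma>, of "sorted_list_of_set A" b] by (simp add: B word_coeff_sorted)
      then have "f (A, b) = theta_sign (map \<sigma> (sorted_list_of_set A)) * f (B, c)"
        using True by (simp add: word_coeff_def B)
      then show ?thesis by (simp add: algebra_simps)
    next
      case False
      then have "infinite B" using \<sigma> by (metis A_def finite_imageI)
      then have "f (A, b) = 0" "f (B, c) = 0" using deg False by blast+
      then show ?thesis by simp
    qed
    finally show "permute_indices \<sigma> f t = f t" using t by simp
  qed
  moreover have "bounded_degree f" unfolding bounded_degree_def using deg by blast
  ultimately show ?thesis unfolding sNCSym_def by blast
qed

lemma sNCSym_finite: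
  assumes "f \<in> sNCSym" "f (A, b) \<noteq> 0"
  shows "finite A"
  using assms unfolding sNCSym_def bounded_degree_def by blast

definition degree_le :: "nat \<Rightarrow> nc_series \<Rightarrow> bool" where
  "degree_le d f \<longleftrightarrow> (\<forall>A b. f (A, b) \<noteq> 0 \<longrightarrow> finite A \<and> card A + length b \<le> d)"

lemma sNCSym_degree: "f \<in> sNCSym \<Longrightarrow> \<exists>d. degree_le d f"
  unfolding sNCSym_def bounded_degree_def degree_le_def by blast

lemma degree_le_mono: "degree_le d f \<Longrightarrow> d \<le> e \<Longrightarrow> degree_le e f"
  unfolding degree_le_def by (meson le_trans)

lemma degree_leD: "degree_le d f \<Longrightarrow> f (A, b) \<noteq> 0 \<Longrightarrow> finite A \<and> card A + length b \<le> d"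
  unfolding degree_le_def by blast

lemma sNCSym_inv:
  assumes f: "f \<in> sNCSym" and \<sigma>: "finite S" "\<sigma> permutes S" and a: "distinct a"
  shows "word_coeff f (map \<sigma> a) (map \<sigma> b) = word_coeff f a b"
proof -
  have "permute_indices \<sigma> f = f" using f \<sigma> unfolding sNCSym_def by blast
  then have "f (\<sigma> ` set a, map \<sigma> b) = f (set a, b) * theta_sign (map \<sigma> (sorted_list_of_set (set a)))"
    using permute_indices_apply[OF \<sigma>(2), of f "set a" b] sNCSym_finite[OF f] by simp
  moreover have "theta_sign (map \<sigma> a) = theta_sign a * theta_sign (map \<sigma> (sorted_list_of_set (set a)))"
    using theta_sign_map[OF a, of "sorted_list_of_set (set a)" \<sigma>] permutes_inj[OF \<sigma>(2)]
    by (simp add: theta_sign_sorted inj_on_subset)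
  ultimately show ?thesis by (simp add: word_coeff_def)
qed

lemma sNCSym_linear:
  assumes "f \<in> sNCSym" "g \<in> sNCSym"
  shows "(\<lambda>t. c * f t + d * g t) \<in> sNCSym"
proof -
  obtain d1 d2 where d: "degree_le d1 f" "degree_le d2 g" using assms sNCSym_degree by blast
  show ?thesis
  proof (rule sNCSymI[of _ "max d1 d2"])
    fix A b assume "c * f (A, b) + d * g (A, b) \<noteq> 0"
    then have "f (A, b) \<noteq> 0 \<or> g (A, b) \<noteq> 0" by auto
    then show "finite A \<and> card A + length b \<le> max d1 d2"
      using degree_leD[OF d(1), of A b] degree_leD[OF d(2), of A b] by auto
  qed (simp add: word_coeff_linear sNCSym_inv assms)
qed

lemma sNCSym_0 [simp]: "(\<lambda>t. 0) \<in> sNCSym"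
  by (rule sNCSymI) auto

lemma sNCSym_sum:
  assumes "\<And>i. i \<in> T \<Longrightarrow> u i \<in> sNCSym"
  shows "(\<lambda>t. \<Sum>i\<in>T. c i * u i t) \<in> sNCSym"
  using assms
proof (induction T rule: infinite_finite_induct)
  case (insert x T)
  then show ?case using sNCSym_linear[of "u x" "\<lambda>t. \<Sum>i\<in>T. c i * u i t" "c x" 1] by simp
qed simp_all

text \<open>Links two actions on a word: exchanging two indices, under which the series are
  invariant, and exchanging two positions, which changes the sign. Where the rest of the monomial is
  unaffected, the coefficient has to vanish.\<close>

lemma map_transpose_eq_permute_list:
  assumes "distinct a" "i < length a" "j < length a"
  shows "map (Transposition.transpose (a ! i) (a ! j)) a = permute_list (Transposition.transpose i j) a"
  using assms
  by (intro nth_equalityI)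
     (auto simp: permute_list_def Transposition.transpose_def nth_eq_iff_index_eq)

text \<open>Exchanging two theta indices that are absent from \<open>b\<close> fixes
  \<open>b\<close> but swaps two thetas, so the coefficient equals its negative.\<close>

lemma sNCSym_vanish:
  assumes f: "f \<in> sNCSym" and c: "\<not> card (A - set b) \<le> 1"
  shows "f (A, b) = 0"
proof (cases "finite A")
  case True
  define a where "a = sorted_list_of_set A"
  have a: "distinct a" "set a = A" using True by (auto simp: a_def)
  have "\<not> (\<exists>x. A - set b \<subseteq> {x})"
    using c card_mono[of "{_}" "A - set b"] by fastforce
  then obtain x y where xy: "x \<noteq> y" "x \<in> A - set b" "y \<in> A - set b" by blast
  obtain i j where ij: "i < length a" "j < length a" "x = a ! i" "y = a ! j"
    using xy a by (metis DiffD1 in_set_conv_nth)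
  let ?\<sigma> = "Transposition.transpose x y"
  have "map ?\<sigma> b = b" using xy by (auto intro!: map_idI simp: Transposition.transpose_def)
  then have "word_coeff f (map ?\<sigma> a) b = word_coeff f a b"
    using sNCSym_inv[OF f _ permutes_swap_id a(1), of "{x, y}" x y b] by simp
  moreover have "map ?\<sigma> a = permute_list (Transposition.transpose i j) a"
    using map_transpose_eq_permute_list[OF a(1) ij(1,2)] ij by simp
  moreover have "word_coeff f (permute_list (Transposition.transpose i j) a) b = - word_coeff f a b"
    using ij xy a by (subst word_coeff_permute) (auto intro!: permutes_swap_id simp: sign_swap_id)
  ultimately have "word_coeff f a b = 0" by simp
  then show ?thesis using a by simp
qed (use sNCSym_finite[OF f] in blast)

lemma words_kernel:
  assumes "(a, b) \<in> words n m K" "(a', b') \<in> words n m K" "distinct a" "distinct a'" "i < m + n" "j < m + n"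
  shows "(a @ b) ! i = (a @ b) ! j \<longleftrightarrow> (a' @ b') ! i = (a' @ b') ! j"
proof -
  note w = wordsD[OF assms(1)] and w' = wordsD[OF assms(2)]
  have ab: "a ! i = b ! j \<longleftrightarrow> a' ! i = b' ! j" if "i < m" "j < n" for i j
    using w(3)[of i "Suc j"] w'(3)[of i "Suc j"] that by simp
  have bb: "b ! i = b ! j \<longleftrightarrow> b' ! i = b' ! j" if "i < n" "j < n" for i j
    using w(4)[of "Suc i" "Suc j"] w'(4)[of "Suc i" "Suc j"] that by simp
  consider "i < m" "j < m" | "i < m" "m \<le> j" | "m \<le> i" "j < m" | "m \<le> i" "m \<le> j" by linarith
  then show ?thesis
  proof cases
    case 1
    then show ?thesis using assms w(1) w'(1) by (simp add: nth_append nth_eq_iff_index_eq)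
  next
    case 2
    then show ?thesis using assms w(1) w'(1) ab[of i "j - m"] by (simp add: nth_append)
  next
    case 3
    then have "b ! (i - m) = a ! j \<longleftrightarrow> b' ! (i - m) = a' ! j"
      using ab[of j "i - m"] assms by auto
    then show ?thesis using 3 assms w(1) w'(1) by (simp add: nth_append)
  next
    case 4
    then show ?thesis using assms w(1) w'(1) bb[of "i - m" "j - m"] by (simp add: nth_append)
  qed
qed

lemma word_coeff_words:
  assumes f: "f \<in> sNCSym" and w: "(a, b) \<in> words n m K" "(a', b') \<in> words n m K"
    and d: "distinct a" "distinct a'"
  shows "word_coeff f a b = word_coeff f a' b'"
proof -
  note l = wordsD(1,2)[OF w(1)] wordsD(1,2)[OF w(2)]
  obtain \<sigma> S where \<sigma>: "finite S" "\<sigma> permutes S" "a' @ b' = map \<sigma> (a @ b)"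
    using ex_permutes_map[of "a @ b" "a' @ b'"] words_kernel[OF w d] l by auto
  then have "a' = map \<sigma> a" "b' = map \<sigma> b" using l by auto
  then show ?thesis using sNCSym_inv[OF f \<sigma>(1,2) d(1)] by simp
qed

section \<open>Coordinates with respect to \<open>nc_m\<close>\<close>

definition coef :: "nat \<Rightarrow> nat \<Rightarrow> nat set list \<Rightarrow> nc_series \<Rightarrow> rat" where
  "coef n m I f = word_coeff f [0..<m] (can_word n I)"

lemma coef_linear: "coef n m I (\<lambda>t. c * f t + d * g t) = c * coef n m I f + d * coef n m I g"
  by (simp add: coef_def word_coeff_linear)

lemma coef_sum: "coef n m I (\<lambda>t. \<Sum>i\<in>T. c i * u i t) = (\<Sum>i\<in>T. c i * coef n m I (u i))"
  by (simp add: coef_def word_coeff_sum)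

lemma coef_0 [simp]: "coef n m I (\<lambda>t. 0) = 0"
  by (simp add: coef_def del: word_coeff_eq_0_iff)

lemma coef_eq_word_coeff:
  assumes "f \<in> sNCSym" "I \<in> set_superpart n m" "(a, b) \<in> words n m I" "distinct a"
  shows "coef n m I f = word_coeff f a b"
  unfolding coef_def
  by (rule word_coeff_words[OF assms(1) can_word_words[OF superpart_supercomp[OF assms(2)]] assms(3) _ assms(4)]) simp

lemma coef_degree:
  assumes "degree_le d f" "coef n m I f \<noteq> 0"
  shows "n \<le> d" "m \<le> d"
proof -
  have "f ({..<m}, can_word n I) \<noteq> 0" using assms(2) by (simp add: coef_def lessThan_atLeast0)
  then have "m + n \<le> d" using degree_leD[OF assms(1)] by fastforce
  then show "n \<le> d" "m \<le> d" by auto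
qed

text \<open>If two thetas are absent from the \<open>x\<close>, or the set of thetas is infinite,
  the coefficient vanishes. Otherwise the thetas can be put into canonical order, and the kernel of
  the word is then a set superpartition.\<close>

lemma coef_eqI:
  assumes f: "f \<in> sNCSym" and g: "g \<in> sNCSym"
    and eq: "\<And>n m I. I \<in> set_superpart n m \<Longrightarrow> coef n m I f = coef n m I g"
  shows "f = g"
proof
  fix t :: "nat set \<times> nat list"
  obtain A b where t: "t = (A, b)" by (cases t)
  show "f t = g t"
  proof (cases "finite A \<and> card (A - set b) \<le> 1")
    case True
    then obtain a where a: "set a = A" "canon a b" using ex_canon by blast
    then obtain I where I: "I \<in> set_superpart (length b) (length a)" "(a, b) \<in> words (length b) (length a) I"
      using ex_superpart by blast
    have "word_coeff f a b = word_coeff g a b"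
      using eq[OF I(1)] coef_eq_word_coeff[OF f I] coef_eq_word_coeff[OF g I] canon_distinct[OF a(2)] by simp
    then show ?thesis using a t by (simp add: word_coeff_def)
  next
    case False
    then show ?thesis using sNCSym_vanish[OF f] sNCSym_vanish[OF g] sNCSym_finite[OF f] sNCSym_finite[OF g] t
      by metis
  qed
qed

section \<open>Antisymmetrized series\<close>

text \<open>The formal sum over all words, with \<open>\<phi> a w\<close> as the coefficient of the
  word with thetas \<open>a\<close>. The series \<open>nc_m\<close>, \<open>nc_h\<close> and
  \<open>com_m\<close> all take this form, with \<phi> free of signs.\<close>

definition alternant :: "(nat list \<Rightarrow> 'w \<Rightarrow> rat) \<Rightarrow> 'w series" where
  "alternant \<phi> = (\<lambda>(A, w). \<Sum>a\<in>permutations_of_set A. theta_sign a * \<phi> a w)"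

lemma alternant_apply: "alternant \<phi> (A, b) = (\<Sum>a\<in>permutations_of_set A. theta_sign a * \<phi> a b)"
  by (simp add: alternant_def)

lemma sum_permutations_of_set:
  fixes f :: "'a list \<Rightarrow> rat"
  assumes "distinct a"
  shows "(\<Sum>a'\<in>permutations_of_set (set a). f a') = (\<Sum>p | p permutes {..<length a}. f (permute_list p a))"
proof -
  have "mfact (mset a) = 1"
    unfolding mfact_def using assms by (intro prod.neutral) (auto simp: distinct_count_atmost_1)
  moreover have "permutations_of_set (set a) = permutations_of_multiset (mset a)"
    using assms by (simp add: permutations_of_set_altdef mset_set_set)
  ultimately show ?thesis by (simp add: sum_permute_list)
qed

lemma word_coeff_alternant:
  assumes "distinct a"
  shows "word_coeff (alternant \<phi>) a b = (\<Sum>p | p permutes {..<length a}. of_int (sign p) * \<phi> (permute_list p a) b)"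
proof -
  have "word_coeff (alternant \<phi>) a b =
      (\<Sum>p | p permutes {..<length a}. theta_sign a * (theta_sign (permute_list p a) * \<phi> (permute_list p a) b))"
    unfolding word_coeff_def alternant_apply sum_permutations_of_set[OF assms] by (simp add: sum_distrib_left)
  also have "\<dots> = (\<Sum>p | p permutes {..<length a}. of_int (sign p) * \<phi> (permute_list p a) b)"
    by (intro sum.cong refl) (simp add: theta_sign_permute assms algebra_simps)
  finally show ?thesis .
qed

lemma alternant_bidegree:
  assumes "\<And>a b. \<phi> a b \<noteq> 0 \<Longrightarrow> length a = m \<and> length b = n" "alternant \<phi> (A, b) \<noteq> 0"
  shows "finite A \<and> card A = m \<and> length b = n"
proof -
  obtain a where "a \<in> permutations_of_set A" "theta_sign a * \<phi> a b \<noteq> 0"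
    using assms(2) unfolding alternant_apply by (meson sum.neutral)
  then show ?thesis using assms(1)[of a b] length_finite_permutations_of_set[of a A]
    by (auto simp: permutations_of_set_def)
qed

lemma word_coeff_alternant_map:
  assumes inv: "\<And>a. \<phi> (map \<sigma> a) w' = \<phi> a w" and \<sigma>: "inj \<sigma>" and a: "distinct a"
  shows "word_coeff (alternant \<phi>) (map \<sigma> a) w' = word_coeff (alternant \<phi>) a w"
proof -
  have d: "distinct (map \<sigma> a)" using a by (simp add: distinct_map inj_on_subset[OF \<sigma>])
  show ?thesis
    unfolding word_coeff_alternant[OF d] word_coeff_alternant[OF a]
    by (intro sum.cong) (simp_all add: permute_list_map inv)
qed

lemma alternant_sNCSym:
  assumes deg: "\<And>a b. \<phi> a b \<noteq> 0 \<Longrightarrow> length a = m \<and> length b = n"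
    and inv: "\<And>(\<sigma> :: nat \<Rightarrow> nat) a b. inj \<sigma> \<Longrightarrow> \<phi> (map \<sigma> a) (map \<sigma> b) = \<phi> a b"
  shows "alternant \<phi> \<in> sNCSym"
proof (rule sNCSymI[of _ "m + n"])
  fix \<sigma> :: "nat \<Rightarrow> nat" and S and a b :: "nat list" assume \<sigma>: "\<sigma> permutes S" and a: "distinct a"
  show "word_coeff (alternant \<phi>) (map \<sigma> a) (map \<sigma> b) = word_coeff (alternant \<phi>) a b"
    using permutes_inj[OF \<sigma>] a by (intro word_coeff_alternant_map inv)
qed (use alternant_bidegree[OF deg] in fastforce)

lemma formal_sum_words:
  fixes c :: "nat list \<times> nat list \<Rightarrow> rat"
  shows "formal_sum W (\<lambda>(a, b) t. c (a, b) * monom a b t) = alternant (\<lambda>a b. if (a, b) \<in> W then c (a, b) else 0)"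
proof
  fix t :: "nat set \<times> nat list"
  obtain A b where t: "t = (A, b)" by (cases t)
  let ?F = "\<lambda>(a, b) t. c (a, b) * monom a b t"
  have *: "?F i (A, b) \<noteq> 0 \<longleftrightarrow> (\<exists>a\<in>permutations_of_set A. i = (a, b) \<and> c (a, b) \<noteq> 0)" for i
    by (cases i) (auto simp: monom_def permutations_of_set_def)
  have "formal_sum W ?F (A, b) = (\<Sum>i\<in>(\<lambda>a. (a, b)) ` permutations_of_set A. if i \<in> W then ?F i (A, b) else 0)"
    unfolding formal_sum_def
  proof (rule sum.mono_neutral_cong_left)
    show "{i \<in> W. ?F i (A, b) \<noteq> 0} \<subseteq> (\<lambda>a. (a, b)) ` permutations_of_set A"
      using * by blast
    show "\<forall>i\<in>(\<lambda>a. (a, b)) ` permutations_of_set A - {i \<in> W. ?F i (A, b) \<noteq> 0}.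
        (if i \<in> W then ?F i (A, b) else 0) = 0"
      by auto
  qed auto
  also have "\<dots> = alternant (\<lambda>a b. if (a, b) \<in> W then c (a, b) else 0) (A, b)"
    unfolding alternant_apply by (subst sum.reindex) (auto simp: inj_on_def monom_def permutations_of_set_def intro!: sum.cong)
  finally show "formal_sum W ?F t = alternant (\<lambda>a b. if (a, b) \<in> W then c (a, b) else 0) t"
    using t by simp
qed

lemma nc_m_alternant: "nc_m n m K = alternant (\<lambda>a b. if (a, b) \<in> words n m K then 1 else 0)"
  using formal_sum_words[of "words n m K" "\<lambda>_. 1"] by (simp add: nc_m_def case_prod_unfold)

lemma words_map:
  assumes "inj \<sigma>"
  shows "(map \<sigma> a, map \<sigma> b) \<in> words n m K \<longleftrightarrow> (a, b) \<in> words n m K"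
proof -
  have "\<sigma> x = \<sigma> y \<longleftrightarrow> x = y" for x y using assms by (auto dest: injD)
  moreover have "map \<sigma> b ! (j - 1) = \<sigma> (b ! (j - 1))" if "j \<in> {1..n}" "length b = n" for j
    using that by (intro nth_map) auto
  ultimately show ?thesis
    unfolding words_def by (auto simp del: One_nat_def)
qed

lemma nc_m_sNCSym: "nc_m n m K \<in> sNCSym"
  unfolding nc_m_alternant
  by (rule alternant_sNCSym[of _ m n]) (auto simp: words_map dest: wordsD split: if_splits)

text \<open>Of all orderings of the thetas only the canonical one can give a word whose kernel is a
  set superpartition, so the antisymmetrization has at most one nonzero term.\<close>

lemma word_coeff_nc_m:
  assumes I: "I \<in> set_superpart n m" and ab: "canon a b"
  shows "word_coeff (nc_m n m I) a b = (if (a, b) \<in> words n m I then 1 else 0)"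
proof -
  have "nc_m n m I (set a, b) = (\<Sum>a'\<in>{a}. if (a', b) \<in> words n m I then theta_sign a' else 0)"
    unfolding nc_m_alternant alternant_apply
  proof (rule sum.mono_neutral_cong_right)
    show "\<forall>a'\<in>permutations_of_set (set a) - {a}. theta_sign a' * (if (a', b) \<in> words n m I then 1 else 0) = 0"
    proof
      fix a' assume a': "a' \<in> permutations_of_set (set a) - {a}"
      have "(a', b) \<notin> words n m I"
        using a' superpart_iff_canon[OF superpart_supercomp[OF I], of a' b] I canon_unique[OF ab, of a']
        by (auto simp: permutations_of_set_def)
      then show "theta_sign a' * (if (a', b) \<in> words n m I then 1 else 0) = 0" by simp
    qed
  qed (use canon_distinct[OF ab] in \<open>auto intro: permutations_of_setI\<close>)
  then show ?thesis by (simp add: word_coeff_def)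
qed

lemma superpart_words_unique:
  assumes I: "I \<in> set_superpart n m" "(a, b) \<in> words n m I" and J: "J \<in> set_superpart n' m'" "(a, b) \<in> words n' m' J"
  shows "n = n'" "m = m'" "I = J"
proof -
  show "n = n'" "m = m'" using wordsD(1,2)[OF I(2)] wordsD(1,2)[OF J(2)] by auto
  then show "I = J" using I J supercomp_unique superpart_supercomp by blast
qed

lemma coef_nc_m:
  assumes I: "I \<in> set_superpart n m" and J: "J \<in> set_superpart n' m'"
  shows "coef n m I (nc_m n' m' J) = (if n = n' \<and> m = m' \<and> I = J then 1 else 0)"
  unfolding coef_def word_coeff_nc_m[OF J can_word_canon[OF I]]
  using superpart_words_unique[OF I can_word_words[OF superpart_supercomp[OF I]] J]
    can_word_words[OF superpart_supercomp[OF I]] by auto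

definition superparts :: "nat \<Rightarrow> (nat \<times> nat \<times> nat set list) set" where
  "superparts d = (SIGMA n:{..d}. SIGMA m:{..d}. set_superpart n m)"

lemma mem_superparts: "(n, m, I) \<in> superparts d \<longleftrightarrow> n \<le> d \<and> m \<le> d \<and> I \<in> set_superpart n m"
  by (auto simp: superparts_def)

lemma finite_superparts [simp]: "finite (superparts d)"
  by (simp add: superparts_def finite_set_superpart)

lemma nc_m_expansion:
  assumes f: "f \<in> sNCSym" and d: "degree_le d f"
  shows "f = (\<lambda>t. \<Sum>x\<in>superparts d. (\<lambda>(n, m, I). coef n m I f) x * (\<lambda>(n, m, I). nc_m n m I) x t)"
proof (rule coef_eqI[OF f sNCSym_sum])
  fix x show "(\<lambda>(n, m, I). nc_m n m I) x \<in> sNCSym" by (cases x) (simp add: nc_m_sNCSym)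
next
  fix n m I assume I: "I \<in> set_superpart n m"
  have "(\<Sum>x\<in>superparts d. (\<lambda>(n, m, I). coef n m I f) x * coef n m I ((\<lambda>(n, m, I). nc_m n m I) x)) =
      (\<Sum>x\<in>superparts d. if x = (n, m, I) then coef n m I f else 0)"
  proof (intro sum.cong refl)
    fix x assume "x \<in> superparts d"
    moreover obtain n' m' J where x: "x = (n', m', J)" by (cases x)
    ultimately have "J \<in> set_superpart n' m'" by (simp add: mem_superparts)
    then show "(\<lambda>(n, m, I). coef n m I f) x * coef n m I ((\<lambda>(n, m, I). nc_m n m I) x) =
        (if x = (n, m, I) then coef n m I f else 0)"
      by (auto simp: x coef_nc_m[OF I])
  qed
  also have "\<dots> = coef n m I f"
    using coef_degree[OF d, of n m I] I by (auto simp: mem_superparts)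
  finally show "coef n m I f =
      coef n m I (\<lambda>t. \<Sum>x\<in>superparts d. (\<lambda>(n, m, I). coef n m I f) x * (\<lambda>(n, m, I). nc_m n m I) x t)"
    unfolding coef_sum by simp
qed

section \<open>Complete functions indexed by words\<close>

lemma kappa_commute:
  "kappa (a, b) (a', b') = kappa (a', b') (a, b)"
proof -
  have "mset (zip a a') + mset (zip b b') = image_mset (\<lambda>(x, y). (y, x)) (mset (zip a' a) + mset (zip b' b))"
    by (simp only: zip_commute[of a a'] zip_commute[of b b'] mset_map image_mset_union)
  then show ?thesis
    unfolding kappa_def fst_conv snd_conv by (simp only:, intro mfact_image_inj) (auto simp: inj_on_def)
qed

lemma kappa_map:
  assumes "inj_on \<sigma> (set a' \<union> set b')"
  shows "kappa k (map \<sigma> a', map \<sigma> b') = kappa k (a', b')"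
proof -
  have "mset (zip (fst k) (map \<sigma> a')) + mset (zip (snd k) (map \<sigma> b')) =
      image_mset (\<lambda>(x, y). (x, \<sigma> y)) (mset (zip (fst k) a') + mset (zip (snd k) b'))"
    by (simp add: zip_map2)
  moreover have "inj_on (\<lambda>(x, y). (x, \<sigma> y)) (set_mset (mset (zip (fst k) a') + mset (zip (snd k) b')))"
    using assms by (auto simp: inj_on_def dest: set_zip_rightD)
  ultimately show ?thesis
    unfolding kappa_def fst_conv snd_conv by (simp only: mfact_image_inj)
qed

lemma kappa_permute_fst:
  assumes "p permutes {..<length a}" "length a = length a'"
  shows "kappa (permute_list p a, b) (permute_list p a', b') = kappa (a, b) (a', b')"
  using assms by (simp add: kappa_def flip: permute_list_zip)

lemma kappa_permute_snd:
  assumes "p permutes {..<length b}" "length b = length b'"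
  shows "kappa (a, permute_list p b) (a', permute_list p b') = kappa (a, b) (a', b')"
  using assms by (simp add: kappa_def flip: permute_list_zip)

text \<open>A permutation of positions fixes the zipped word exactly if it fixes both words, and the
  stabilizer of the zipped word has order \<open>mfact\<close>. Counting common stabilizers exhibits
  \<open>kappa\<close> as a Gram matrix of indicator functions.\<close>

lemma kappa_gram:
  assumes "length a = length a'" "length b = length b'"
  shows "kappa (a, b) (a', b') = card {p. p permutes {..<length a + length b} \<and>
    permute_list p (a @ b) = a @ b \<and> permute_list p (a' @ b') = a' @ b'}"
proof -
  let ?z = "zip (a @ b) (a' @ b')"
  have z: "mset ?z = mset (zip a a') + mset (zip b b')" using assms by simp
  have "permute_list p ?z = ?z \<longleftrightarrow> permute_list p (a @ b) = a @ b \<and> permute_list p (a' @ b') = a' @ b'"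
    if "p permutes {..<length a + length b}" for p
  proof -
    have "permute_list p ?z = zip (permute_list p (a @ b)) (permute_list p (a' @ b'))"
      using that assms by (intro permute_list_zip[where A = "{..<length a + length b}"]) auto
    then show ?thesis using assms by (simp add: zip_eq_conv eq_commute[of "permute_list p _"] del: zip_append)
  qed
  then have "{p. p permutes {..<length a + length b} \<and>
      permute_list p (a @ b) = a @ b \<and> permute_list p (a' @ b') = a' @ b'} =
    {p. p permutes {..<length ?z} \<and> permute_list p ?z = ?z}"
    using assms by auto
  then show ?thesis
    using card_stabilizer[of ?z] by (simp only: kappa_def fst_conv snd_conv z)
qed

text \<open>The complete function of an arbitrary word instead of a set superpartition. This version
  is symmetric in index and argument, and it admits permutations of positions, which need not
  respect the canonical order of the thetas.\<close>

definition hword :: "nat list \<times> nat list \<Rightarrow> nc_series" where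
  "hword k = alternant (\<lambda>a b. if length a = length (fst k) \<and> length b = length (snd k) then of_nat (kappa k (a, b)) else 0)"

lemma hword_sNCSym: "hword k \<in> sNCSym"
  unfolding hword_def
  by (rule alternant_sNCSym[of _ "length (fst k)" "length (snd k)"])
     (auto simp: kappa_map inj_on_subset split: if_splits)

lemma word_coeff_hword:
  assumes "distinct a"
  shows "word_coeff (hword k) a b =
    (if length a = length (fst k) \<and> length b = length (snd k)
     then \<Sum>p | p permutes {..<length a}. of_int (sign p) * of_nat (kappa k (permute_list p a, b)) else 0)"
  unfolding hword_def word_coeff_alternant[OF assms] by auto

lemma hword_bidegree:
  assumes "hword k (A, b) \<noteq> 0"
  shows "finite A \<and> card A = length (fst k) \<and> length b = length (snd k)"
  using assms unfolding hword_def by (rule alternant_bidegree[rotated]) (auto split: if_splits)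

text \<open>On the words summed in \<open>nc_h\<close> the coefficients agree by
  \<open>blocks_fact_meet\<close>. At a monomial with two thetas absent from the \<open>x\<close>,
  \<open>hword\<close> vanishes like every invariant series.\<close>

lemma nc_h_hword:
  assumes K: "K \<in> set_supercomp n m" "(a, b) \<in> words n m K" "distinct a"
  shows "nc_h n m K = hword (a, b)"
proof -
  note wK = wordsD(1,2)[OF K(2)]
  let ?W = "{(a, b). length a = m \<and> length b = n \<and> distinct a \<and> card (set a - set b) \<le> 1}"
  have coeff: "nc_h_coeff n m K (a', b') = kappa (a, b) (a', b')" if "(a', b') \<in> ?W" for a' b'
  proof -
    have "length a' = card (set a')" using that by (simp add: distinct_card)
    also have "\<dots> \<le> card (set a' - set b') + card (set b')"
      by (metis card_mono card_Un_le finite_set finite_UnI finite_Diff le_trans Un_Diff_cancel2 Un_upper1)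
    also have "\<dots> \<le> 1 + n" using that card_length[of b'] by auto
    finally have "m \<le> n + 1" using that by simp
    then have "\<exists>L\<in>set_supercomp n m. (a', b') \<in> words n m L"
      using that by (intro ex_supercomp) auto
    then obtain L where L: "L \<in> set_supercomp n m" "(a', b') \<in> words n m L" by blast
    then show ?thesis
      unfolding nc_h_coeff_def the_supercomp[OF L] using that by (intro blocks_fact_meet[OF K]) auto
  qed
  have "nc_h n m K = alternant (\<lambda>a b. if (a, b) \<in> ?W then of_nat (nc_h_coeff n m K (a, b)) else 0)"
    unfolding nc_h_def by (rule formal_sum_words)
  also have "\<dots> = hword (a, b)"
  proof
    fix t :: "nat set \<times> nat list"
    obtain A b' where t: "t = (A, b')" by (cases t)
    show "alternant (\<lambda>a b. if (a, b) \<in> ?W then of_nat (nc_h_coeff n m K (a, b)) else 0) t = hword (a, b) t"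
    proof (cases "card (A - set b') \<le> 1")
      case True
      then show ?thesis
        unfolding t alternant_apply hword_def
        by (intro sum.cong refl) (auto simp: permutations_of_set_def wK coeff)
    next
      case False
      then have "alternant (\<lambda>a b. if (a, b) \<in> ?W then of_nat (nc_h_coeff n m K (a, b)) else 0) t = 0"
        unfolding t alternant_apply by (intro sum.neutral) (auto simp: permutations_of_set_def)
      then show ?thesis using sNCSym_vanish[OF hword_sNCSym False] t by simp
    qed
  qed
  finally show ?thesis .
qed

lemma nc_h_can_word: "I \<in> set_superpart n m \<Longrightarrow> nc_h n m I = hword ([0..<m], can_word n I)"
  by (rule nc_h_hword) (auto simp: superpart_supercomp can_word_words)

lemma nc_h_sNCSym: "I \<in> set_superpart n m \<Longrightarrow> nc_h n m I \<in> sNCSym"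
  by (simp add: nc_h_can_word hword_sNCSym)

lemma coef_hword_other:
  assumes "n \<noteq> length (snd k) \<or> m \<noteq> length (fst k)"
  shows "coef n m J (hword k) = 0"
  using assms unfolding coef_def by (subst word_coeff_hword) auto

section \<open>Positive definiteness of the change of basis\<close>

text \<open>Elimination of one variable. Let \<open>v\<close> have entry 1 at \<open>x\<close> and
  be annihilated by the rows in \<open>S\<close>; the row of \<open>x\<close> applied to
  \<open>v\<close> then equals the quadratic form of \<open>v\<close> and is positive. A multiple of
  \<open>v\<close> therefore corrects the last equation for a solution \<open>w\<close> over
  \<open>S\<close> without disturbing the others.\<close>

lemma positive_definite_solvable:
  fixes A :: "'i \<Rightarrow> 'i \<Rightarrow> rat"
  assumes "finite S"
    and "\<And>c. \<exists>i\<in>S. c i \<noteq> 0 \<Longrightarrow> (\<Sum>i\<in>S. \<Sum>j\<in>S. c i * c j * A i j) > 0"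
  shows "\<exists>c. \<forall>i\<in>S. (\<Sum>j\<in>S. A i j * c j) = y i"
  using assms
proof (induction S arbitrary: y)
  case (insert x S)
  have pd: "(\<Sum>i\<in>S. \<Sum>j\<in>S. c i * c j * A i j) > 0" if c: "\<exists>i\<in>S. c i \<noteq> 0" for c
  proof -
    let ?c = "c(x := 0)"
    have "(\<Sum>i\<in>insert x S. \<Sum>j\<in>insert x S. ?c i * ?c j * A i j) = (\<Sum>i\<in>S. \<Sum>j\<in>S. ?c i * ?c j * A i j)"
      using insert.hyps by simp
    also have "\<dots> = (\<Sum>i\<in>S. \<Sum>j\<in>S. c i * c j * A i j)"
      using insert.hyps by (intro sum.cong refl) auto
    moreover have "\<exists>i\<in>insert x S. ?c i \<noteq> 0" using c insert.hyps by (metis fun_upd_other insertI2)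
    ultimately show ?thesis using insert.prems[of ?c] by simp
  qed
  note IH = insert.IH[OF pd]
  obtain c where c: "\<forall>i\<in>S. (\<Sum>j\<in>S. A i j * c j) = - A i x" using IH[of "\<lambda>i. - A i x"] by blast
  obtain c' where c': "\<forall>i\<in>S. (\<Sum>j\<in>S. A i j * c' j) = y i" using IH[of y] by blast
  define v where "v = c(x := 1)"
  define w where "w = c'(x := 0)"
  have sv: "(\<Sum>j\<in>insert x S. A i j * v j) = A i x + (\<Sum>j\<in>S. A i j * c j)" for i
    using insert.hyps by (auto simp: v_def intro!: sum.cong)
  have sw: "(\<Sum>j\<in>insert x S. A i j * w j) = (\<Sum>j\<in>S. A i j * c' j)" for i
    using insert.hyps by (auto simp: w_def intro!: sum.cong)
  let ?q = "\<Sum>j\<in>insert x S. A x j * v j"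
  have "0 < (\<Sum>i\<in>insert x S. \<Sum>j\<in>insert x S. v i * v j * A i j)"
    by (rule insert.prems) (simp add: v_def)
  also have "\<dots> = (\<Sum>i\<in>insert x S. v i * (\<Sum>j\<in>insert x S. A i j * v j))"
    by (simp only: sum_distrib_left mult_ac)
  also have "\<dots> = v x * ?q + (\<Sum>i\<in>S. v i * (\<Sum>j\<in>insert x S. A i j * v j))"
    by (rule sum.insert[OF insert.hyps])
  also have "(\<Sum>i\<in>S. v i * (\<Sum>j\<in>insert x S. A i j * v j)) = 0"
    using c by (intro sum.neutral) (simp only: sv, simp)
  finally have q: "?q \<noteq> 0" by (auto simp: v_def)
  define r where "r = (y x - (\<Sum>j\<in>insert x S. A x j * w j)) / ?q"
  have lin: "(\<Sum>j\<in>insert x S. A i j * (w j + r * v j)) =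
      (\<Sum>j\<in>insert x S. A i j * w j) + r * (\<Sum>j\<in>insert x S. A i j * v j)" for i
    unfolding sum_distrib_left by (simp only: sum.distrib[symmetric] distrib_left mult_ac)
  show ?case
  proof (intro exI ballI)
    fix i assume i: "i \<in> insert x S"
    show "(\<Sum>j\<in>insert x S. A i j * (w j + r * v j)) = y i"
    proof (cases "i = x")
      case True
      then show ?thesis unfolding lin using q by (simp only: r_def) (simp add: field_simps)
    next
      case False
      then have "i \<in> S" using i by blast
      then show ?thesis unfolding lin sv sw using c c' by simp
    qed
  qed
qed simp

lemma word_coeff_scale: "word_coeff (\<lambda>t. c * f t) a w = c * word_coeff f a w"
  by (simp add: word_coeff_def)

lemma word_coeff_eqI:
  assumes "f \<in> sNCSym" "g \<in> sNCSym" "\<And>a b. distinct a \<Longrightarrow> word_coeff f a b = word_coeff g a b"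
  shows "f = g"
  using assms by (intro coef_eqI) (auto simp: coef_def)

text \<open>Moving a permutation of the thetas from one word to the other inverts it, which keeps
  its sign; \<open>kappa\<close> itself is symmetric.\<close>

lemma word_coeff_hword_commute:
  assumes d: "distinct a" "distinct a'"
  shows "word_coeff (hword (a, b)) a' b' = word_coeff (hword (a', b')) a b"
proof (cases "length a = length a' \<and> length b = length b'")
  case True
  have "(\<Sum>p | p permutes {..<length a}. of_int (sign p) * of_nat (kappa (a, b) (permute_list p a', b')) :: rat) =
      (\<Sum>p | p permutes {..<length a}. of_int (sign (inv p)) * of_nat (kappa (a, b) (permute_list (inv p) a', b')))"
    by (rule sum_permutations_inverse)
  also have "\<dots> = (\<Sum>p | p permutes {..<length a}. of_int (sign p) * of_nat (kappa (a', b') (permute_list p a, b)))"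
  proof (intro sum.cong refl)
    fix p assume "p \<in> {p. p permutes {..<length a}}"
    then have p: "p permutes {..<length a}" by simp
    have "permute_list p (permute_list (inv p) a') = a'"
      using permute_list_compose[of p a' "inv p"] p True permutes_inv_o[OF p] by simp
    then have "kappa (a, b) (permute_list (inv p) a', b') = kappa (permute_list p a, b) (a', b')"
      using kappa_permute_fst[OF p, of "permute_list (inv p) a'" b b'] True by simp
    moreover have "sign (inv p) = sign p"
      using p by (intro sign_inverse) (auto intro: permutes_imp_permutation)
    ultimately show "of_int (sign (inv p)) * of_nat (kappa (a, b) (permute_list (inv p) a', b')) =
        (of_int (sign p) * of_nat (kappa (a', b') (permute_list p a, b)) :: rat)"
      by (simp add: kappa_commute)
  qed
  finally show ?thesis
    using True by (simp add: word_coeff_hword d)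
qed (auto simp: word_coeff_hword d)

text \<open>By symmetry the index of \<open>hword\<close> behaves like the word on which it is
  evaluated, so the sign rule for coefficients carries over. Invariance under relabelling and
  vanishing are transferred below in the same way.\<close>

lemma hword_permute:
  assumes p: "p permutes {..<length a}" and d: "distinct a"
  shows "hword (permute_list p a, b) = (\<lambda>t. of_int (sign p) * hword (a, b) t)"
proof (rule word_coeff_eqI[OF hword_sNCSym])
  show "(\<lambda>t. of_int (sign p) * hword (a, b) t) \<in> sNCSym"
    using sNCSym_linear[OF hword_sNCSym sNCSym_0, of "of_int (sign p)" "(a, b)" 0] by simp
next
  fix a' b' assume d': "distinct (a' :: nat list)"
  have "word_coeff (hword (permute_list p a, b)) a' b' = of_int (sign p) * word_coeff (hword (a', b')) a b"
    using d d' p by (simp add: word_coeff_hword_commute word_coeff_permute)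
  then show "word_coeff (hword (permute_list p a, b)) a' b' =
      word_coeff (\<lambda>t. of_int (sign p) * hword (a, b) t) a' b'"
    using d d' by (simp only: word_coeff_scale word_coeff_hword_commute)
qed

lemma hword_map:
  assumes \<sigma>: "finite S" "\<sigma> permutes S" and d: "distinct a"
  shows "hword (map \<sigma> a, map \<sigma> b) = hword (a, b)"
proof (rule word_coeff_eqI[OF hword_sNCSym hword_sNCSym])
  fix a' b' assume d': "distinct (a' :: nat list)"
  have "distinct (map \<sigma> a)" using d permutes_inj_on[OF \<sigma>(2)] by (simp add: distinct_map)
  then show "word_coeff (hword (map \<sigma> a, map \<sigma> b)) a' b' = word_coeff (hword (a, b)) a' b'"
    using d d' by (simp add: word_coeff_hword_commute sNCSym_inv[OF hword_sNCSym \<sigma>])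
qed

lemma hword_vanish:
  assumes d: "distinct a" and "\<not> card (set a - set b) \<le> 1"
  shows "hword (a, b) = (\<lambda>t. 0)"
proof (rule word_coeff_eqI[OF hword_sNCSym sNCSym_0])
  fix a' b' assume "distinct (a' :: nat list)"
  then have "word_coeff (hword (a, b)) a' b' = word_coeff (hword (a', b')) a b"
    using d by (simp only: word_coeff_hword_commute)
  also have "\<dots> = 0" using sNCSym_vanish[OF hword_sNCSym] assms by simp
  finally show "word_coeff (hword (a, b)) a' b' = word_coeff (\<lambda>t. 0) a' b'" by simp
qed

definition gram :: "nat \<Rightarrow> nat \<Rightarrow> nat set list \<Rightarrow> nat set list \<Rightarrow> rat" where
  "gram n m I J = coef n m J (nc_h n m I)"

lemma gram_commute:
  assumes "I \<in> set_superpart n m" "J \<in> set_superpart n m"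
  shows "gram n m I J = gram n m J I"
  using assms by (simp add: gram_def nc_h_can_word coef_def word_coeff_hword_commute)

lemma coef_nc_h_other:
  assumes "I \<in> set_superpart n' m'" "n \<noteq> n' \<or> m \<noteq> m'"
  shows "coef n m J (nc_h n' m' I) = 0"
  using assms by (simp add: nc_h_can_word coef_hword_other)

definition fixes_word :: "(nat \<Rightarrow> nat) \<Rightarrow> nat list \<Rightarrow> rat" where
  "fixes_word p w = (if permute_list p w = w then 1 else 0)"

lemma kappa_eq_sum:
  assumes "length a = length a'" "length b = length b'"
  shows "of_nat (kappa (a, b) (a', b')) =
    (\<Sum>p | p permutes {..<length a + length b}. fixes_word p (a @ b) * fixes_word p (a' @ b'))"
proof -
  let ?P = "{p. p permutes {..<length a + length b}}"
  have "(\<Sum>p\<in>?P. fixes_word p (a @ b) * fixes_word p (a' @ b')) =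
      (\<Sum>p\<in>?P. if permute_list p (a @ b) = a @ b \<and> permute_list p (a' @ b') = a' @ b' then 1 else 0)"
    by (intro sum.cong refl) (simp add: fixes_word_def)
  also have "\<dots> = of_nat (card {p \<in> ?P. permute_list p (a @ b) = a @ b \<and> permute_list p (a' @ b') = a' @ b'})"
    by (simp add: finite_permutations flip: sum.inter_filter)
  finally show ?thesis using kappa_gram[OF assms] by simp
qed

text \<open>Antisymmetrizing in both words gives m! equal sums, since a common permutation of the
  thetas does not change \<open>kappa\<close>. This symmetric shape turns the quadratic form into a
  sum of squares.\<close>

lemma fact_gram:
  assumes I: "I \<in> set_superpart n m" and J: "J \<in> set_superpart n m"
  shows "fact m * gram n m I J = (\<Sum>q | q permutes {..<m}. \<Sum>r | r permutes {..<m}.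
    of_int (sign q) * of_int (sign r) *
    of_nat (kappa (permute_list q [0..<m], can_word n I) (permute_list r [0..<m], can_word n J)))"
proof -
  let ?P = "{p. p permutes {..<m}}"
  let ?k = "\<lambda>a a'. of_nat (kappa (a, can_word n I) (a', can_word n J)) :: rat"
  have g: "gram n m I J = (\<Sum>p\<in>?P. of_int (sign p) * ?k [0..<m] (permute_list p [0..<m]))"
    using I by (simp add: gram_def nc_h_can_word coef_def word_coeff_hword)
  have "(\<Sum>r\<in>?P. of_int (sign q) * of_int (sign r) * ?k (permute_list q [0..<m]) (permute_list r [0..<m])) =
      gram n m I J" if "q \<in> ?P" for q
  proof -
    have q: "q permutes {..<m}" using that by simp
    have "(\<Sum>r\<in>?P. of_int (sign q) * of_int (sign r) * ?k (permute_list q [0..<m]) (permute_list r [0..<m])) =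
        (\<Sum>p\<in>?P. of_int (sign q) * of_int (sign (p \<circ> q)) *
          ?k (permute_list q [0..<m]) (permute_list (p \<circ> q) [0..<m]))"
      by (rule sum_permutations_compose_right[OF q])
    also have "\<dots> = (\<Sum>p\<in>?P. of_int (sign p) * ?k [0..<m] (permute_list p [0..<m]))"
    proof (intro sum.cong refl)
      fix p assume "p \<in> ?P"
      then have p: "p permutes {..<m}" by simp
      have "sign (p \<circ> q) = sign p * sign q"
        using p q by (intro sign_compose) (auto intro: permutes_imp_permutation)
      then have "of_int (sign q) * of_int (sign (p \<circ> q)) = (of_int (sign p) :: rat)"
        by (simp add: mult.left_commute flip: of_int_mult)
      moreover have "?k (permute_list q [0..<m]) (permute_list (p \<circ> q) [0..<m]) = ?k [0..<m] (permute_list p [0..<m])"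
        using q by (subst permute_list_compose) (simp_all add: kappa_permute_fst)
      ultimately show "of_int (sign q) * of_int (sign (p \<circ> q)) *
          ?k (permute_list q [0..<m]) (permute_list (p \<circ> q) [0..<m]) =
        of_int (sign p) * ?k [0..<m] (permute_list p [0..<m])"
        by simp
    qed
    finally show ?thesis using g by simp
  qed
  then have "(\<Sum>q\<in>?P. \<Sum>r\<in>?P. of_int (sign q) * of_int (sign r) *
      ?k (permute_list q [0..<m]) (permute_list r [0..<m])) = (\<Sum>q\<in>?P. gram n m I J)"
    by (rule sum.cong[OF refl])
  then show ?thesis by (simp add: card_permutations[OF refl])
qed

text \<open>Equal kernels make the two words relabellings of each other, so the thetas permuted by
  \<open>q\<close> are canonical too; uniqueness of the canonical order leaves only the
  identity.\<close>

lemma superpart_eqI_kernel: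
  assumes I: "I \<in> set_superpart n m" and J: "J \<in> set_superpart n m" and q: "q permutes {..<m}"
    and ker: "\<And>i j. i < m + n \<Longrightarrow> j < m + n \<Longrightarrow>
      ([0..<m] @ can_word n I) ! i = ([0..<m] @ can_word n I) ! j \<longleftrightarrow>
      (permute_list q [0..<m] @ can_word n J) ! i = (permute_list q [0..<m] @ can_word n J) ! j"
  shows "J = I" "q = id"
proof -
  let ?a = "permute_list q [0..<m]"
  obtain \<sigma> S where \<sigma>: "\<sigma> permutes S" "?a @ can_word n J = map \<sigma> ([0..<m] @ can_word n I)"
    using ex_permutes_map[of "[0..<m] @ can_word n I" "?a @ can_word n J"] ker by auto
  then have eq: "?a = map \<sigma> [0..<m]" "can_word n J = map \<sigma> (can_word n I)" by auto
  have w: "(?a, can_word n J) \<in> words n m I"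
    unfolding eq using can_word_words[OF superpart_supercomp[OF I]] words_map permutes_inj[OF \<sigma>(1)] by blast
  then have "canon ?a (can_word n J)"
    using superpart_iff_canon[OF superpart_supercomp[OF I]] I by blast
  then have a: "?a = [0..<m]"
    by (rule canon_unique[OF _ can_word_canon[OF J]]) (use q in simp)
  show "J = I"
    using superpart_words_unique(3)[OF J can_word_words[OF superpart_supercomp[OF J]] I] w a by simp
  show "q = id"
  proof
    fix i show "q i = id i"
    proof (cases "i < m")
      case True
      then have "?a ! i = q i" using permutes_in_image[OF q, of i] permute_list_nth[of q "[0..<m]" i] q by simp
      then show ?thesis using a True by simp
    qed (use permutes_not_in[OF q] in simp)
  qed
qed

text \<open>Up to m!, the quadratic form is the sum of the squares of \<open>\<Phi> p\<close> over
  permutations of all m + n positions, and one nonzero square is enough. It is found at a set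
  superpartition with the fewest letters among those with nonzero coefficient.\<close>

lemma gram_positive:
  assumes c: "\<exists>I\<in>set_superpart n m. c I \<noteq> 0"
  shows "(\<Sum>I\<in>set_superpart n m. \<Sum>J\<in>set_superpart n m. c I * c J * gram n m I J) > 0"
proof -
  let ?S = "set_superpart n m" and ?P = "{p. p permutes {..<m}}" and ?N = "{p. p permutes {..<m + n}}"
  define X where "X = ?S \<times> ?P"
  define s where "s = (\<lambda>(I, q :: nat \<Rightarrow> nat). c I * of_int (sign q) :: rat)"
  define w where "w = (\<lambda>(I, q). permute_list q [0..<m] @ can_word n I)"
  define \<Phi> where "\<Phi> p = (\<Sum>x\<in>X. s x * fixes_word p (w x))" for p
  have finX: "finite X" by (simp add: X_def finite_set_superpart finite_permutations)
  have "fact m * (\<Sum>I\<in>?S. \<Sum>J\<in>?S. c I * c J * gram n m I J) =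
      (\<Sum>I\<in>?S. \<Sum>J\<in>?S. c I * c J * (fact m * gram n m I J))"
    by (simp add: sum_distrib_left algebra_simps)
  also have "\<dots> = (\<Sum>I\<in>?S. \<Sum>J\<in>?S. \<Sum>q\<in>?P. \<Sum>r\<in>?P. \<Sum>p\<in>?N.
      (s (I, q) * fixes_word p (w (I, q))) * (s (J, r) * fixes_word p (w (J, r))))"
  proof (intro sum.cong refl)
    fix I J assume "I \<in> ?S" "J \<in> ?S"
    then show "c I * c J * (fact m * gram n m I J) = (\<Sum>q\<in>?P. \<Sum>r\<in>?P. \<Sum>p\<in>?N.
        (s (I, q) * fixes_word p (w (I, q))) * (s (J, r) * fixes_word p (w (J, r))))"
      by (simp add: fact_gram kappa_eq_sum sum_distrib_left s_def w_def mult_ac)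
  qed
  also have "\<dots> = (\<Sum>I\<in>?S. \<Sum>q\<in>?P. \<Sum>J\<in>?S. \<Sum>r\<in>?P. \<Sum>p\<in>?N.
      (s (I, q) * fixes_word p (w (I, q))) * (s (J, r) * fixes_word p (w (J, r))))"
    by (intro sum.cong refl sum.swap)
  also have "\<dots> = (\<Sum>x\<in>X. \<Sum>y\<in>X. \<Sum>p\<in>?N. (s x * fixes_word p (w x)) * (s y * fixes_word p (w y)))"
    by (simp only: X_def sum.cartesian_product')
  also have "\<dots> = (\<Sum>x\<in>X. \<Sum>p\<in>?N. \<Sum>y\<in>X. (s x * fixes_word p (w x)) * (s y * fixes_word p (w y)))"
    by (intro sum.cong refl sum.swap)
  also have "\<dots> = (\<Sum>p\<in>?N. \<Sum>x\<in>X. \<Sum>y\<in>X. (s x * fixes_word p (w x)) * (s y * fixes_word p (w y)))"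
    by (rule sum.swap)
  also have "\<dots> = (\<Sum>p\<in>?N. \<Phi> p * \<Phi> p)"
    by (simp only: \<Phi>_def sum_product)
  finally have gram: "fact m * (\<Sum>I\<in>?S. \<Sum>J\<in>?S. c I * c J * gram n m I J) = (\<Sum>p\<in>?N. \<Phi> p * \<Phi> p)" .
  \<comment> \<open>Minimality of this number of letters leaves no strictly coarser word with
    nonzero coefficient.\<close>
  define nl where "nl I = card (set ([0..<m] @ can_word n I))" for I
  obtain I where I: "I \<in> ?S" "c I \<noteq> 0" and min: "\<And>J. J \<in> ?S \<Longrightarrow> c J \<noteq> 0 \<Longrightarrow> nl I \<le> nl J"
    using c ex_has_least_nat[of "\<lambda>J. J \<in> ?S \<and> c J \<noteq> 0" _ nl] by metis
  let ?u = "[0..<m] @ can_word n I"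
  \<comment> \<open>The cycles of \<open>p\<close> are the fibres of \<open>?u\<close>, so a word
    fixed by \<open>p\<close> is constant on these fibres.\<close>
  obtain p where p: "p permutes {..<m + n}" "\<And>x. ?u ! p x = ?u ! x"
    and gen: "\<And>v :: nat list. \<forall>x\<in>{..<m + n}. v ! p x = v ! x \<Longrightarrow>
      \<forall>x\<in>{..<m + n}. \<forall>y\<in>{..<m + n}. ?u ! x = ?u ! y \<longrightarrow> v ! x = v ! y"
    using ex_permutation_generating_fibres[of "{..<m + n}" "nth ?u"] by (metis finite_lessThan)
  have fu: "fixes_word p ?u = 1"
    unfolding fixes_word_def using p by (auto simp: permute_list_nth intro!: nth_equalityI)
  have other: "s x * fixes_word p (w x) = 0" if x: "x \<in> X - {(I, id)}" for x
  proof (rule ccontr)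
    obtain J q where Jq: "x = (J, q)" by (cases x)
    let ?v = "w (J, q)"
    have J: "J \<in> ?S" and q: "q permutes {..<m}" using x Jq by (auto simp: X_def)
    assume "s x * fixes_word p (w x) \<noteq> 0"
    then have cJ: "c J \<noteq> 0" and fv: "permute_list p ?v = ?v"
      by (auto simp: Jq s_def fixes_word_def split: if_splits)
    have len: "length ?v = m + n" by (simp add: w_def)
    have "?v ! p x = ?v ! x" if "x < m + n" for x
    proof -
      have "permute_list p ?v ! x = ?v ! p x" using permute_list_nth[of p ?v x] p(1) that len by simp
      then show ?thesis unfolding fv by (rule sym)
    qed
    then have "\<forall>x\<in>{..<m + n}. \<forall>y\<in>{..<m + n}. ?u ! x = ?u ! y \<longrightarrow> ?v ! x = ?v ! y"
      by (intro gen) blast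
    then have sub: "?v ! x = ?v ! y" if "x < m + n" "y < m + n" "?u ! x = ?u ! y" for x y
      using that by blast
    \<comment> \<open>The fixed word is the image of \<open>?u\<close> under \<open>g\<close>;
      having at least as many letters, it makes \<open>g\<close> injective, so both words have the
      same kernel.\<close>
    define g where "g c = ?v ! (SOME i. i < m + n \<and> ?u ! i = c)" for c
    have g: "?v ! i = g (?u ! i)" if i: "i < m + n" for i
    proof -
      let ?k = "SOME k. k < m + n \<and> ?u ! k = ?u ! i"
      have k: "?k < m + n \<and> ?u ! ?k = ?u ! i" by (rule someI[of _ i]) (use i in blast)
      have "?v ! ?k = ?v ! i" by (rule sub[OF conjunct1[OF k] i conjunct2[OF k]])
      then show ?thesis unfolding g_def by (rule sym)
    qed
    have "?v = map g ?u"
    proof (rule nth_equalityI)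
      fix i assume "i < length ?v"
      then have i: "i < m + n" using len by simp
      then have "map g ?u ! i = g (?u ! i)" by (intro nth_map) simp
      then show "?v ! i = map g ?u ! i" using g[OF i] by simp
    qed (simp add: len)
    then have set: "set ?v = g ` set ?u" by (metis set_map)
    have "card (set ?v) = nl J" using q by (simp add: nl_def w_def)
    then have "card (g ` set ?u) = card (set ?u)"
      using min[OF J cJ] set card_image_le[of "set ?u" g] by (simp only: nl_def) simp
    then have inj: "inj_on g (set ?u)" by (rule eq_card_imp_inj_on[rotated]) simp
    have ker: "?u ! x = ?u ! y \<longleftrightarrow> ?v ! x = ?v ! y" if "x < m + n" "y < m + n" for x y
    proof
      assume "?v ! x = ?v ! y"
      then have "g (?u ! x) = g (?u ! y)" using g that by simp
      moreover have "?u ! x \<in> set ?u" "?u ! y \<in> set ?u" using that by (auto intro!: nth_mem simp del: set_append)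
      ultimately show "?u ! x = ?u ! y" using inj by (meson inj_onD)
    qed (use sub that in blast)
    have "J = I" "q = id"
      using superpart_eqI_kernel[OF I(1) J q] ker by (auto simp: w_def)
    then show False using x Jq by simp
  qed
  have "(I, id) \<in> X" using I by (simp add: X_def)
  then have "\<Phi> p = s (I, id) * fixes_word p (w (I, id)) + (\<Sum>x\<in>X - {(I, id)}. s x * fixes_word p (w x))"
    unfolding \<Phi>_def by (rule sum.remove[OF finX])
  also have "(\<Sum>x\<in>X - {(I, id)}. s x * fixes_word p (w x)) = 0" by (rule sum.neutral) (use other in blast)
  also have "s (I, id) * fixes_word p (w (I, id)) + 0 = c I" using fu by (simp add: s_def w_def)
  finally have "\<Phi> p * \<Phi> p > 0" using I by (simp add: zero_less_mult_iff linorder_neq_iff disj_commute)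
  then have "(\<Sum>p\<in>?N. \<Phi> p * \<Phi> p) > 0"
    using p(1) by (intro sum_pos2[of _ p]) (auto simp: finite_permutations)
  then have "0 < fact m * (\<Sum>I\<in>?S. \<Sum>J\<in>?S. c I * c J * gram n m I J)" using gram by simp
  moreover have "(fact m :: rat) > 0" by simp
  ultimately show ?thesis by (simp only: zero_less_mult_iff) auto
qed

section \<open>The form on noncommutative symmetric functions\<close>

lemma sum_delta_pair:
  fixes c :: rat and d e :: nat
  shows "(\<Sum>n'\<le>d. \<Sum>m'\<le>e. if n' = n \<and> m' = m then c else 0) = (if n \<le> d \<and> m \<le> e then c else 0)"
proof -
  have "(\<Sum>n'\<le>d. \<Sum>m'\<le>e. if n' = n \<and> m' = m then c else 0) =
      (\<Sum>x\<in>{..d} \<times> {..e}. if x = (n, m) then c else 0)"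
    by (simp only: sum.cartesian_product' prod.inject)
  also have "\<dots> = (if n \<le> d \<and> m \<le> e then c else 0)"
    by (subst sum.delta) (auto intro: finite_cartesian_product)
  finally show ?thesis .
qed

definition inv_gram :: "nat \<Rightarrow> nat \<Rightarrow> nat set list \<Rightarrow> nat set list \<Rightarrow> rat" where
  "inv_gram n m = (SOME E. \<forall>J\<in>set_superpart n m. \<forall>K\<in>set_superpart n m.
     (\<Sum>I\<in>set_superpart n m. gram n m J I * E I K) = (if J = K then 1 else 0))"

lemma gram_inv_gram:
  assumes "J \<in> set_superpart n m" "K \<in> set_superpart n m"
  shows "(\<Sum>I\<in>set_superpart n m. gram n m J I * inv_gram n m I K) = (if J = K then 1 else 0)"
proof -
  let ?S = "set_superpart n m"
  have "\<exists>c. \<forall>J\<in>?S. (\<Sum>I\<in>?S. gram n m J I * c I) = (if J = K then 1 else 0)" for K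
    by (rule positive_definite_solvable[OF finite_set_superpart gram_positive])
  then obtain E where "\<And>K. \<forall>J\<in>?S. (\<Sum>I\<in>?S. gram n m J I * E K I) = (if J = K then 1 else 0)"
    by metis
  then have "\<exists>E. \<forall>J\<in>?S. \<forall>K\<in>?S. (\<Sum>I\<in>?S. gram n m J I * E I K) = (if J = K then 1 else 0)"
    by (intro exI[of _ "\<lambda>I K. E K I"]) simp
  then have "\<forall>J\<in>?S. \<forall>K\<in>?S. (\<Sum>I\<in>?S. gram n m J I * inv_gram n m I K) = (if J = K then 1 else 0)"
    unfolding inv_gram_def by (rule someI_ex)
  then show ?thesis using assms by blast
qed

text \<open>The coefficient of \<open>nc_h n m I\<close> in the expansion in this basis.\<close>

definition hcoef :: "nat \<Rightarrow> nat \<Rightarrow> nat set list \<Rightarrow> nc_series \<Rightarrow> rat" where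
  "hcoef n m I g = (\<Sum>K\<in>set_superpart n m. inv_gram n m I K * coef n m K g)"

lemma hcoef_linear: "hcoef n m I (\<lambda>t. c * f t + d * g t) = c * hcoef n m I f + d * hcoef n m I g"
  by (simp add: hcoef_def coef_linear algebra_simps sum.distrib sum_distrib_left)

lemma sum_gram_hcoef:
  assumes J: "J \<in> set_superpart n m"
  shows "(\<Sum>I\<in>set_superpart n m. gram n m J I * hcoef n m I g) = coef n m J g"
proof -
  let ?S = "set_superpart n m"
  have "(\<Sum>I\<in>?S. gram n m J I * hcoef n m I g) =
      (\<Sum>I\<in>?S. \<Sum>K\<in>?S. gram n m J I * inv_gram n m I K * coef n m K g)"
    by (simp add: hcoef_def sum_distrib_left mult.assoc)
  also have "\<dots> = (\<Sum>K\<in>?S. (\<Sum>I\<in>?S. gram n m J I * inv_gram n m I K) * coef n m K g)"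
    by (subst sum.swap) (simp add: sum_distrib_right)
  also have "\<dots> = (\<Sum>K\<in>?S. if K = J then coef n m K g else 0)"
    by (intro sum.cong refl) (simp add: gram_inv_gram J)
  finally show ?thesis using J by (simp add: finite_set_superpart)
qed

text \<open>The difference \<open>c\<close> of the two sides is annihilated by the Gram matrix, so
  its quadratic form is zero and positivity forces \<open>c = 0\<close>. This amounts to linear
  independence of the \<open>nc_h\<close>.\<close>

lemma hcoef_nc_h:
  assumes I: "I \<in> set_superpart n m" and J: "J \<in> set_superpart n' m'"
  shows "hcoef n m I (nc_h n' m' J) = (if n = n' \<and> m = m' \<and> I = J then 1 else 0)"
proof (cases "n = n' \<and> m = m'")
  case True
  let ?S = "set_superpart n m"
  define c where "c I = hcoef n m I (nc_h n m J) - (if I = J then 1 else 0)" for I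
  have J: "J \<in> ?S" using J True by simp
  have "(\<Sum>I\<in>?S. gram n m K I * c I) = 0" if K: "K \<in> ?S" for K
  proof -
    have "(\<Sum>I\<in>?S. gram n m K I * c I) =
        (\<Sum>I\<in>?S. gram n m K I * hcoef n m I (nc_h n m J)) - (\<Sum>I\<in>?S. if I = J then gram n m K I else 0)"
      by (simp add: c_def right_diff_distrib sum_subtractf if_distrib[of "\<lambda>x. gram n m K _ * x"] cong: if_cong)
    also have "\<dots> = coef n m K (nc_h n m J) - gram n m K J"
      using sum_gram_hcoef[OF K] J by (simp add: finite_set_superpart)
    also have "\<dots> = 0" using gram_commute[OF J K] by (simp add: gram_def)
    finally show ?thesis .
  qed
  then have "(\<Sum>K\<in>?S. c K * (\<Sum>I\<in>?S. gram n m K I * c I)) = 0" by simp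
  then have "(\<Sum>K\<in>?S. \<Sum>I\<in>?S. c K * c I * gram n m K I) = 0"
    by (simp add: sum_distrib_left mult_ac)
  then have "c I = 0" using gram_positive[of n m c] I by (metis less_irrefl)
  then show ?thesis using True by (auto simp: c_def split: if_splits)
next
  case False
  then show ?thesis by (auto simp: hcoef_def coef_nc_h_other[OF J])
qed

lemma sum_superparts:
  "(\<Sum>x\<in>superparts d. F x) = (\<Sum>n\<le>d. \<Sum>m\<le>d. \<Sum>I\<in>set_superpart n m. F (n, m, I))"
  for F :: "_ \<Rightarrow> rat"
  by (simp add: superparts_def sum.Sigma finite_set_superpart case_prod_unfold)

lemma nc_h_expansion:
  assumes f: "f \<in> sNCSym" and d: "degree_le d f"
  shows "f = (\<lambda>t. \<Sum>x\<in>superparts d. (\<lambda>(n, m, I). hcoef n m I f) x * (\<lambda>(n, m, I). nc_h n m I) x t)"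
proof (rule coef_eqI[OF f sNCSym_sum])
  fix x assume "x \<in> superparts d"
  then show "(\<lambda>(n, m, I). nc_h n m I) x \<in> sNCSym" by (cases x) (simp add: nc_h_sNCSym mem_superparts)
next
  fix n m J assume J: "J \<in> set_superpart n m"
  let ?G = "\<lambda>n' m'. \<Sum>I\<in>set_superpart n' m'. hcoef n' m' I f * coef n m J (nc_h n' m' I)"
  have G: "?G n' m' = (if n' = n \<and> m' = m then coef n m J f else 0)" for n' m'
  proof (cases "n' = n \<and> m' = m")
    case True
    have "?G n m = (\<Sum>I\<in>set_superpart n m. gram n m J I * hcoef n m I f)"
      using gram_commute[OF J] by (intro sum.cong refl) (simp add: mult.commute flip: gram_def)
    then show ?thesis using True sum_gram_hcoef[OF J] by simp
  next
    case False
    then show ?thesis by (auto simp: coef_nc_h_other intro!: sum.neutral)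
  qed
  have "(\<Sum>x\<in>superparts d. (\<lambda>(n, m, I). hcoef n m I f) x * coef n m J ((\<lambda>(n, m, I). nc_h n m I) x)) =
      (\<Sum>n'\<le>d. \<Sum>m'\<le>d. if n' = n \<and> m' = m then coef n m J f else 0)"
    unfolding sum_superparts prod.case G ..
  also have "\<dots> = coef n m J f"
    using coef_degree[OF d, of n m J] by (auto simp: sum_delta_pair)
  finally show "coef n m J f =
      coef n m J (\<lambda>t. \<Sum>x\<in>superparts d. (\<lambda>(n, m, I). hcoef n m I f) x * (\<lambda>(n, m, I). nc_h n m I) x t)"
    unfolding coef_sum by simp
qed

definition pairing :: "nat \<Rightarrow> nat \<Rightarrow> nc_series \<Rightarrow> nc_series \<Rightarrow> rat" where
  "pairing n m f g = (- 1) ^ (m choose 2) * fact n * (\<Sum>I\<in>set_superpart n m. coef n m I f * hcoef n m I g)"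

text \<open>The sum runs over the bidegrees in which \<open>f\<close> has a nonzero coordinate. They
  are finitely many since the degree of \<open>f\<close> is bounded, so no bound enters the
  definition.\<close>

definition nc_form :: "nc_series \<Rightarrow> nc_series \<Rightarrow> rat" where
  "nc_form f g = (if f \<in> sNCSym \<and> g \<in> sNCSym
     then \<Sum>(n, m) | \<exists>I\<in>set_superpart n m. coef n m I f \<noteq> 0. pairing n m f g else 0)"

lemma nc_form_eq:
  assumes "f \<in> sNCSym" "g \<in> sNCSym" and d: "degree_le d f"
  shows "nc_form f g = (\<Sum>n\<le>d. \<Sum>m\<le>d. pairing n m f g)"
proof -
  have "nc_form f g = (\<Sum>(n, m) | \<exists>I\<in>set_superpart n m. coef n m I f \<noteq> 0. pairing n m f g)"
    using assms by (simp add: nc_form_def)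
  also have "\<dots> = (\<Sum>(n, m)\<in>{..d} \<times> {..d}. pairing n m f g)"
  proof (rule sum.mono_neutral_left)
    show "{(n, m). \<exists>I\<in>set_superpart n m. coef n m I f \<noteq> 0} \<subseteq> {..d} \<times> {..d}"
      using coef_degree[OF d] by auto
    show "\<forall>x\<in>{..d} \<times> {..d} - {(n, m). \<exists>I\<in>set_superpart n m. coef n m I f \<noteq> 0}.
        (case x of (n, m) \<Rightarrow> pairing n m f g) = 0"
      by (auto simp: pairing_def intro!: sum.neutral)
  qed simp
  finally show ?thesis by (simp add: sum.cartesian_product)
qed

lemma pairing_linear_right: "pairing n m h (\<lambda>t. c * f t + d * g t) = c * pairing n m h f + d * pairing n m h g"
  by (simp add: pairing_def hcoef_linear algebra_simps sum.distrib sum_distrib_left)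

text \<open>Writing the \<open>nc_m\<close> coordinates of \<open>f\<close> as the Gram matrix times
  its \<open>nc_h\<close> coordinates turns the pairing into a bilinear expression with that
  symmetric matrix.\<close>

lemma pairing_commute: "pairing n m f g = pairing n m g f"
proof -
  let ?S = "set_superpart n m"
  have eq: "(\<Sum>I\<in>?S. coef n m I f * hcoef n m I g) =
      (\<Sum>I\<in>?S. \<Sum>J\<in>?S. gram n m I J * hcoef n m J f * hcoef n m I g)" for f g
    by (intro sum.cong refl) (simp add: sum_gram_hcoef flip: sum_distrib_right)
  have "(\<Sum>I\<in>?S. coef n m I f * hcoef n m I g) = (\<Sum>I\<in>?S. coef n m I g * hcoef n m I f)"
    unfolding eq by (subst sum.swap) (intro sum.cong refl, simp add: gram_commute mult_ac)
  then show ?thesis by (simp add: pairing_def)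
qed

lemma nc_form_commute: "nc_form f g = nc_form g f"
proof (cases "f \<in> sNCSym \<and> g \<in> sNCSym")
  case True
  obtain d1 where d1: "degree_le d1 f" using True sNCSym_degree by blast
  obtain d2 where d2: "degree_le d2 g" using True sNCSym_degree by blast
  have "nc_form f g = (\<Sum>n\<le>max d1 d2. \<Sum>m\<le>max d1 d2. pairing n m f g)"
    using True d1 by (intro nc_form_eq) (auto intro: degree_le_mono)
  also have "\<dots> = (\<Sum>n\<le>max d1 d2. \<Sum>m\<le>max d1 d2. pairing n m g f)"
    by (simp only: pairing_commute[of _ _ f g])
  also have "\<dots> = nc_form g f"
    using True d2 by (intro nc_form_eq[symmetric]) (auto intro: degree_le_mono)
  finally show ?thesis .
qed (auto simp: nc_form_def)

lemma nc_form_linear_right: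
  assumes "f \<in> sNCSym" "g \<in> sNCSym" "h \<in> sNCSym"
  shows "nc_form h (\<lambda>t. c * f t + d * g t) = c * nc_form h f + d * nc_form h g"
proof -
  obtain e where e: "degree_le e h" using assms(3) sNCSym_degree by blast
  show ?thesis
    using assms by (simp add: nc_form_eq[OF _ _ e] sNCSym_linear pairing_linear_right sum.distrib sum_distrib_left)
qed

lemma nc_form_bilinear: "bilinear_form_on sNCSym nc_form"
  unfolding bilinear_form_on_def
proof (intro conjI ballI allI impI)
  fix f g h c d assume V: "f \<in> sNCSym" "g \<in> sNCSym" "h \<in> sNCSym"
  show "nc_form h (\<lambda>t. c * f t + d * g t) = c * nc_form h f + d * nc_form h g"
    using V by (rule nc_form_linear_right)
  then show "nc_form (\<lambda>t. c * f t + d * g t) h = c * nc_form f h + d * nc_form g h"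
    by (simp only: nc_form_commute[of _ h])
next
  fix f g assume "f \<notin> sNCSym \<or> g \<notin> sNCSym"
  then show "nc_form f g = 0" by (auto simp: nc_form_def)
qed

lemma pairing_nc_h:
  assumes J: "J \<in> set_superpart n' m'"
  shows "pairing n m f (nc_h n' m' J) =
    (if n = n' \<and> m = m' then (- 1) ^ (m choose 2) * fact n * coef n m J f else 0)"
proof -
  have "(\<Sum>I\<in>set_superpart n m. coef n m I f * hcoef n m I (nc_h n' m' J)) =
      (\<Sum>I\<in>set_superpart n m. if I = J then (if n = n' \<and> m = m' then coef n m J f else 0) else 0)"
    by (intro sum.cong refl) (simp add: hcoef_nc_h J)
  then show ?thesis using J by (auto simp: pairing_def finite_set_superpart)
qed

lemma nc_form_nc_h:
  assumes f: "f \<in> sNCSym" and J: "J \<in> set_superpart n m"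
  shows "nc_form f (nc_h n m J) = (- 1) ^ (m choose 2) * fact n * coef n m J f"
proof -
  obtain d where d: "degree_le d f" using f sNCSym_degree by blast
  have "nc_form f (nc_h n m J) = (\<Sum>n'\<le>d. \<Sum>m'\<le>d. if n' = n \<and> m' = m
      then (- 1) ^ (m choose 2) * fact n * coef n m J f else 0)"
    unfolding nc_form_eq[OF f nc_h_sNCSym[OF J] d] pairing_nc_h[OF J] by (intro sum.cong refl) auto
  also have "\<dots> = (- 1) ^ (m choose 2) * fact n * coef n m J f"
    using coef_degree[OF d, of n m J] by (auto simp: sum_delta_pair)
  finally show ?thesis .
qed

text \<open>\<open>sNCSym_form\<close> compares \<open>I\<close> and \<open>J\<close> as bare lists,
  so the bidegree must be readable from the list: n from the nonzero elements, m from the blocks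
  that contain 0.\<close>

lemma superpart_bidegree:
  assumes "I \<in> set_superpart n m" "I \<in> set_superpart n' m'"
  shows "n = n'" "m = m'"
proof -
  note I = superpart_supercomp[OF assms(1)] superpart_supercomp[OF assms(2)]
  have "{1..n} = {1..n'}" using I by (simp add: set_supercomp_def)
  then show "n = n'" by (metis card_atLeastAtMost diff_Suc_1)
  have "\<not> m < m'" "\<not> m' < m"
    using supercompD(2,7)[OF I(1)] supercompD(2,7)[OF I(2)] by (metis less_irrefl less_le_trans)+
  then show "m = m'" by simp
qed

lemma sNCSym_form_nc_form: "sNCSym_form nc_form"
  unfolding sNCSym_form_def
proof (intro conjI allI ballI nc_form_bilinear)
  fix n m n' m' I J assume I: "I \<in> set_superpart n m" and J: "J \<in> set_superpart n' m'"
  then show "nc_form (nc_m n m I) (nc_h n' m' J) = (if I = J then (- 1) ^ (m choose 2) * fact n else 0)"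
    using superpart_bidegree[of I n m n' m'] by (auto simp: nc_form_nc_h nc_m_sNCSym coef_nc_m)
qed

lemma bilinear_form_onD:
  assumes "bilinear_form_on V B" "f \<in> V" "g \<in> V" "h \<in> V"
  shows "B (\<lambda>t. c * f t + d * g t) h = c * B f h + d * B g h"
    "B h (\<lambda>t. c * f t + d * g t) = c * B h f + d * B h g"
  using assms by (simp_all add: bilinear_form_on_def)

lemma bilinear_form_on_commute:
  "bilinear_form_on V B \<Longrightarrow> bilinear_form_on V (\<lambda>f g. B g f)"
  unfolding bilinear_form_on_def by blast

lemma bilinear_form_on_sum:
  assumes B: "bilinear_form_on V B" and V: "(\<lambda>t. 0) \<in> V" "\<And>c d f g. f \<in> V \<Longrightarrow> g \<in> V \<Longrightarrow> (\<lambda>t. c * f t + d * g t) \<in> V"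
    and "finite T" "\<And>i. i \<in> T \<Longrightarrow> u i \<in> V" and h: "h \<in> V"
  shows "B (\<lambda>t. \<Sum>i\<in>T. c i * u i t) h = (\<Sum>i\<in>T. c i * B (u i) h) \<and> (\<lambda>t. \<Sum>i\<in>T. c i * u i t) \<in> V"
  using assms(4,5)
proof (induction T)
  case empty
  show ?case using bilinear_form_onD(1)[OF B V(1) V(1) h, of 0 0] V(1) by simp
next
  case (insert x T)
  let ?S = "\<lambda>t. \<Sum>i\<in>T. c i * u i t"
  have IH: "B ?S h = (\<Sum>i\<in>T. c i * B (u i) h)" "?S \<in> V" using insert by auto
  have "B (\<lambda>t. c x * u x t + 1 * ?S t) h = c x * B (u x) h + 1 * B ?S h"
    using insert.prems by (intro bilinear_form_onD(1)[OF B _ IH(2) h]) simp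
  moreover have "(\<lambda>t. c x * u x t + 1 * ?S t) \<in> V" using IH(2) insert.prems V(2) by blast
  ultimately show ?case using insert.hyps IH(1) by simp
qed

text \<open>The two arguments may use different spanning families, as the defining conditions do:
  monomial functions on the left, complete functions on the right.\<close>

lemma bilinear_forms_eq_on_sums:
  assumes B: "bilinear_form_on V B" and B': "bilinear_form_on V B'"
    and V: "(\<lambda>t. 0) \<in> V" "\<And>c d f g. f \<in> V \<Longrightarrow> g \<in> V \<Longrightarrow> (\<lambda>t. c * f t + d * g t) \<in> V"
    and S: "finite S" "\<And>i. i \<in> S \<Longrightarrow> u i \<in> V" and T: "finite T" "\<And>j. j \<in> T \<Longrightarrow> v j \<in> V"
    and f: "f = (\<lambda>t. \<Sum>i\<in>S. c i * u i t)" and g: "g = (\<lambda>t. \<Sum>j\<in>T. d j * v j t)"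
    and eq: "\<And>i j. i \<in> S \<Longrightarrow> j \<in> T \<Longrightarrow> B (u i) (v j) = B' (u i) (v j)"
  shows "B f g = B' f g"
proof -
  have sums: "C f g = (\<Sum>i\<in>S. c i * (\<Sum>j\<in>T. d j * C (u i) (v j)))" if C: "bilinear_form_on V C" for C
  proof -
    have "g \<in> V"
      unfolding g by (rule bilinear_form_on_sum[OF C V(1), THEN conjunct2]) (assumption | rule V T)+
    then have "C f g = (\<Sum>i\<in>S. c i * C (u i) g)"
      unfolding f by (intro bilinear_form_on_sum[OF C V(1), THEN conjunct1]) (assumption | rule V S)+
    also have "\<dots> = (\<Sum>i\<in>S. c i * (\<Sum>j\<in>T. d j * C (u i) (v j)))"
    proof (intro sum.cong refl arg_cong2[where f = times])
      fix i assume "i \<in> S"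
      then have "u i \<in> V" by (rule S)
      then show "C (u i) g = (\<Sum>j\<in>T. d j * C (u i) (v j))"
        unfolding g
        by (intro bilinear_form_on_sum[OF bilinear_form_on_commute[OF C] V(1), THEN conjunct1])
           (assumption | rule V T)+
    qed
    finally show ?thesis .
  qed
  show ?thesis
    unfolding sums[OF B] sums[OF B'] by (intro sum.cong refl arg_cong2[where f = times] eq)
qed

lemma sNCSym_form_unique:
  assumes B: "sNCSym_form B"
  shows "B = nc_form"
proof (intro ext)
  fix f g
  show "B f g = nc_form f g"
  proof (cases "f \<in> sNCSym \<and> g \<in> sNCSym")
    case True
    then obtain d e where de: "degree_le d f" "degree_le e g" using sNCSym_degree by blast
    show ?thesis
    proof (rule bilinear_forms_eq_on_sums[OF _ nc_form_bilinear sNCSym_0 sNCSym_linear finite_superparts _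
          finite_superparts _ nc_m_expansion nc_h_expansion])
      show "bilinear_form_on sNCSym B" using B unfolding sNCSym_form_def by blast
      fix x y assume "x \<in> superparts d" "y \<in> superparts e"
      then show "B ((\<lambda>(n, m, I). nc_m n m I) x) ((\<lambda>(n, m, I). nc_h n m I) y) =
          nc_form ((\<lambda>(n, m, I). nc_m n m I) x) ((\<lambda>(n, m, I). nc_h n m I) y)"
        using B sNCSym_form_nc_form unfolding sNCSym_form_def
        by (cases x; cases y) (auto simp: mem_superparts)
    qed (use True de in \<open>auto simp: nc_m_sNCSym nc_h_sNCSym mem_superparts\<close>)
  next
    case False
    then show ?thesis using B unfolding sNCSym_form_def bilinear_form_on_def nc_form_def by auto
  qed
qed

text \<open>In \<open>nc_h\<close> coordinates the form is the Gram matrix times n! and the sign;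
  the two signs cancel and positivity of the Gram matrix remains.\<close>

lemma nc_form_positive:
  assumes f: "f \<in> sNCSym" "has_bidegree f n m" "f \<noteq> (\<lambda>t. 0)"
  shows "(- 1) ^ (m choose 2) * nc_form f f > 0"
proof -
  let ?S = "set_superpart n m"
  have deg: "degree_le (n + m) f"
    using f(2) unfolding has_bidegree_def degree_le_def by fastforce
  have other: "coef n' m' I f = 0" if "n' \<noteq> n \<or> m' \<noteq> m" for n' m' I
  proof (rule ccontr)
    assume "coef n' m' I f \<noteq> 0"
    then have "f ({..<m'}, can_word n' I) \<noteq> 0" by (simp add: coef_def lessThan_atLeast0)
    then show False using f(2) that unfolding has_bidegree_def by fastforce
  qed
  have "nc_form f f = (\<Sum>n'\<le>n + m. \<Sum>m'\<le>n + m. if n' = n \<and> m' = m then pairing n m f f else 0)"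
    unfolding nc_form_eq[OF f(1) f(1) deg]
    by (intro sum.cong refl) (auto simp: pairing_def other)
  also have "\<dots> = pairing n m f f" by (simp add: sum_delta_pair)
  finally have "(- 1) ^ (m choose 2) * nc_form f f = fact n * (\<Sum>I\<in>?S. coef n m I f * hcoef n m I f)"
    by (simp add: pairing_def flip: power_add mult.assoc mult_2)
  also have "(\<Sum>I\<in>?S. coef n m I f * hcoef n m I f) =
      (\<Sum>I\<in>?S. \<Sum>J\<in>?S. hcoef n m I f * hcoef n m J f * gram n m I J)"
    by (intro sum.cong refl)
       (simp add: sum_gram_hcoef[symmetric] sum_distrib_left sum_distrib_right mult_ac del: sum_gram_hcoef)
  also have "fact n * \<dots> > 0"
  proof -
    have "\<exists>I\<in>?S. hcoef n m I f \<noteq> 0"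
    proof (rule ccontr)
      assume "\<not> ?thesis"
      then have "coef n m J f = 0" if "J \<in> ?S" for J using sum_gram_hcoef[OF that, of f] by simp
      then have "coef n' m' J f = coef n' m' J (\<lambda>t. 0)" if "J \<in> set_superpart n' m'" for n' m' J
        using other that by (cases "n' = n \<and> m' = m") auto
      then have "f = (\<lambda>t. 0)" using f(1) by (intro coef_eqI) auto
      then show False using f(3) by simp
    qed
    then show ?thesis using gram_positive by simp
  qed
  finally show ?thesis .
qed

lemma super_inner_product_nc_form: "super_inner_product nc_form"
  unfolding super_inner_product_def
proof (intro conjI ballI allI impI nc_form_bilinear nc_form_commute nc_form_positive)
  fix f assume f: "f \<in> sNCSym" "f \<noteq> (\<lambda>t. 0)"
  obtain n m I where I: "I \<in> set_superpart n m" "coef n m I f \<noteq> 0"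
    using coef_eqI[OF f(1) sNCSym_0] f(2) by fastforce
  \<comment> \<open>A nonzero \<open>nc_m\<close> coordinate of \<open>f\<close> is detected by the
    complete function dual to it.\<close>
  then have "nc_form f (nc_h n m I) \<noteq> 0" using f by (simp add: nc_form_nc_h)
  then show "\<exists>g\<in>sNCSym. nc_form f g \<noteq> 0" using nc_h_sNCSym[OF I(1)] by blast
qed

text \<open>Extends the duality from set superpartitions to all words with distinct thetas. Sorting
  the thetas costs the same sign on both sides, and if two thetas are absent from \<open>b\<close>
  both sides vanish.\<close>

lemma nc_form_hword:
  assumes f: "f \<in> sNCSym" and a: "distinct a"
  shows "nc_form f (hword (a, b)) = (- 1) ^ (length a choose 2) * fact (length b) * word_coeff f a b"
proof (cases "card (set a - set b) \<le> 1")
  case True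
  then obtain a0 where a0: "set a0 = set a" "canon a0 b" using ex_canon by blast
  have "mset a = mset a0" using a a0 canon_distinct set_eq_iff_mset_eq_distinct by blast
  then obtain p where p: "p permutes {..<length a0}" "permute_list p a0 = a" by (rule mset_eq_permutation)
  have d0: "distinct a0" using a0 canon_distinct by blast
  have len: "length a0 = length a" using p(2) by auto
  obtain I where I: "I \<in> set_superpart (length b) (length a0)" "(a0, b) \<in> words (length b) (length a0) I"
    using ex_superpart a0 by blast
  have "hword (a0, b) = nc_h (length b) (length a0) I"
    using nc_h_hword[OF superpart_supercomp[OF I(1)] I(2) d0] by simp
  then have "nc_form f (hword (a0, b)) = (- 1) ^ (length a choose 2) * fact (length b) * word_coeff f a0 b"
    using nc_form_nc_h[OF f I(1)] coef_eq_word_coeff[OF f I d0] len by simp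
  moreover have "nc_form f (hword (a, b)) = of_int (sign p) * nc_form f (hword (a0, b))"
    using nc_form_linear_right[OF hword_sNCSym sNCSym_0 f, of "of_int (sign p)" "(a0, b)" 0]
      hword_permute[OF p(1) d0, of b] p(2) by simp
  moreover have "word_coeff f a b = of_int (sign p) * word_coeff f a0 b"
    using word_coeff_permute[OF p(1) d0, of f b] p(2) by simp
  ultimately show ?thesis by simp
next
  case False
  then have "hword (a, b) = (\<lambda>t. 0)" using a by (intro hword_vanish)
  moreover have "nc_form f (\<lambda>t. 0) = 0"
    using nc_form_linear_right[OF sNCSym_0 sNCSym_0 f, of 0 0] by simp
  moreover have "word_coeff f a b = 0" using sNCSym_vanish[OF f False] by simp
  ultimately show ?thesis by simp
qed

section \<open>Commutative symmetric functions and the lifting\<close>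

lemma abelianize_apply:
  assumes fin: "\<And>A b. f (A, b) \<noteq> 0 \<Longrightarrow> finite A"
  shows "abelianize f (A, M) = (\<Sum>b\<in>permutations_of_multiset M. f (A, b))"
proof -
  let ?G = "\<lambda>(A, b) t. f (A, b) * monom (sorted_list_of_set A) (mset b) t"
  have sub: "i \<in> (\<lambda>b. (A, b)) ` permutations_of_multiset M" if "?G i (A, M) \<noteq> 0" for i
  proof -
    obtain A' b where i: "i = (A', b)" by (cases i)
    then have "f (A', b) \<noteq> 0" "set (sorted_list_of_set A') = A" "mset b = M"
      using that by (auto simp: monom_def split: if_splits)
    then show ?thesis using i fin by (auto intro: permutations_of_multisetI)
  qed
  have "abelianize f (A, M) = (\<Sum>i\<in>(\<lambda>b. (A, b)) ` permutations_of_multiset M. ?G i (A, M))"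
    unfolding abelianize_def formal_sum_def by (rule sum.mono_neutral_left) (use sub in auto)
  also have "\<dots> = (\<Sum>b\<in>permutations_of_multiset M. ?G (A, b) (A, M))"
    by (subst sum.reindex) (auto simp: inj_on_def)
  also have "\<dots> = (\<Sum>b\<in>permutations_of_multiset M. f (A, b))"
  proof (intro sum.cong refl)
    fix b assume "b \<in> permutations_of_multiset M"
    then have "mset b = M" by (rule permutations_of_multisetD)
    then show "?G (A, b) (A, M) = f (A, b)"
      using fin[of A b] by (cases "f (A, b) = 0") (auto simp: monom_def theta_sign_sorted)
  qed
  finally show ?thesis .
qed

lemma word_coeff_abelianize:
  assumes "f \<in> sNCSym"
  shows "word_coeff (abelianize f) a M = (\<Sum>b\<in>permutations_of_multiset M. word_coeff f a b)"
  using sNCSym_finite[OF assms] by (simp add: word_coeff_def abelianize_apply sum_distrib_left)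

lemma abelianize_linear:
  assumes "f \<in> sNCSym" "g \<in> sNCSym"
  shows "abelianize (\<lambda>t. c * f t + d * g t) = (\<lambda>t. c * abelianize f t + d * abelianize g t)"
proof
  fix t :: "nat set \<times> nat multiset"
  obtain A M where t: "t = (A, M)" by (cases t)
  show "abelianize (\<lambda>t. c * f t + d * g t) t = c * abelianize f t + d * abelianize g t"
    unfolding t using sNCSym_finite[OF assms(1)] sNCSym_finite[OF assms(2)] sNCSym_finite[OF sNCSym_linear[OF assms]]
    by (simp add: abelianize_apply sum.distrib sum_distrib_left)
qed

lemma abelianize_sum:
  assumes "\<And>i. i \<in> T \<Longrightarrow> u i \<in> sNCSym"
  shows "abelianize (\<lambda>t. \<Sum>i\<in>T. c i * u i t) = (\<lambda>t. \<Sum>i\<in>T. c i * abelianize (u i) t)"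
proof
  fix t :: "nat set \<times> nat multiset"
  obtain A M where t: "t = (A, M)" by (cases t)
  have "abelianize (\<lambda>t. \<Sum>i\<in>T. c i * u i t) (A, M) = (\<Sum>b\<in>permutations_of_multiset M. \<Sum>i\<in>T. c i * u i (A, b))"
    using sNCSym_finite[OF sNCSym_sum[of T u c]] assms by (simp add: abelianize_apply)
  also have "\<dots> = (\<Sum>i\<in>T. c i * abelianize (u i) (A, M))"
  proof (subst sum.swap, intro sum.cong refl)
    fix i assume "i \<in> T"
    then show "(\<Sum>b\<in>permutations_of_multiset M. c i * u i (A, b)) = c i * abelianize (u i) (A, M)"
      using sNCSym_finite[OF assms] by (simp add: abelianize_apply sum_distrib_left)
  qed
  finally show "abelianize (\<lambda>t. \<Sum>i\<in>T. c i * u i t) t = (\<Sum>i\<in>T. c i * abelianize (u i) t)" using t by simp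
qed

section \<open>The lifting as averaging over rearrangements\<close>

text \<open>Spreads the coefficient of a commutative monomial evenly over its rearrangements, whose
  number is n!/\<open>mfact\<close>. The formula refers to no basis; \<open>lift_com_m\<close>
  identifies it with the prescribed values.\<close>

definition lift :: "com_series \<Rightarrow> nc_series" where
  "lift g = (\<lambda>(A, b). of_nat (mfact (mset b)) / fact (length b) * g (A, mset b))"

lemma word_coeff_lift:
  "word_coeff (lift g) a b = of_nat (mfact (mset b)) / fact (length b) * word_coeff g a (mset b)"
  by (simp add: word_coeff_def lift_def)

lemma lift_linear: "lift (\<lambda>t. c * f t + d * g t) = (\<lambda>t. c * lift f t + d * lift g t)"
  by (auto simp: lift_def algebra_simps)

lemma lift_abelianize:
  assumes "f \<in> sNCSym"
  shows "lift (abelianize f) (A, b) = (\<Sum>p | p permutes {..<length b}. f (A, permute_list p b)) / fact (length b)"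
  using sNCSym_finite[OF assms] by (simp add: lift_def abelianize_apply sum_permute_list[of "\<lambda>b. f (A, b)" b])

lemma abelianize_lift:
  assumes fin: "\<And>A M. g (A, M) \<noteq> 0 \<Longrightarrow> finite A"
  shows "abelianize (lift g) = g"
proof
  fix t :: "nat set \<times> nat multiset"
  obtain A M where t: "t = (A, M)" by (cases t)
  have "abelianize (lift g) (A, M) = (\<Sum>b\<in>permutations_of_multiset M. lift g (A, b))"
    by (rule abelianize_apply) (use fin in \<open>auto simp: lift_def\<close>)
  also have "\<dots> = (\<Sum>b\<in>permutations_of_multiset M. of_nat (mfact M) / fact (size M) * g (A, M))"
    by (intro sum.cong refl) (auto simp: lift_def permutations_of_multiset_def)
  also have "\<dots> = of_nat (card (permutations_of_multiset M) * mfact M) / fact (size M) * g (A, M)"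
    by simp
  also have "\<dots> = g (A, M)"
    unfolding card_permutations_of_multiset_mfact by simp
  finally show "abelianize (lift g) t = g t" using t by simp
qed

text \<open>The lifted series serves as the preimage, so bounded degree and invariance suffice for
  lying in the image of \<open>abelianize\<close>.\<close>

lemma sSymI:
  assumes deg: "\<And>A M. g (A, M) \<noteq> 0 \<Longrightarrow> finite A \<and> card A + size M \<le> d"
    and inv: "\<And>\<sigma> S a M. finite S \<Longrightarrow> \<sigma> permutes S \<Longrightarrow> distinct a \<Longrightarrow>
      word_coeff g (map \<sigma> a) (image_mset \<sigma> M) = word_coeff g a M"
  shows "g \<in> sSym" "lift g \<in> sNCSym"
proof -
  show "lift g \<in> sNCSym"
  proof (rule sNCSymI[of _ d])
    fix A b assume "lift g (A, b) \<noteq> 0"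
    then have "g (A, mset b) \<noteq> 0" by (simp add: lift_def)
    then show "finite A \<and> card A + length b \<le> d" using deg[of A "mset b"] by simp
  next
    fix \<sigma> :: "nat \<Rightarrow> nat" and S and a b :: "nat list"
    assume \<sigma>: "finite S" "\<sigma> permutes S" and a: "distinct a"
    have "mfact (image_mset \<sigma> (mset b)) = mfact (mset b)"
      using permutes_inj_on[OF \<sigma>(2)] by (rule mfact_image_inj)
    then show "word_coeff (lift g) (map \<sigma> a) (map \<sigma> b) = word_coeff (lift g) a b"
      using inv[OF \<sigma> a, of "mset b"] by (simp add: word_coeff_lift)
  qed
  moreover have "abelianize (lift g) = g" by (rule abelianize_lift) (use deg in blast)
  ultimately show "g \<in> sSym" unfolding sSym_def by force
qed

lemma sSym_degree:
  assumes "g \<in> sSym"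
  shows "\<exists>d. \<forall>A M. g (A, M) \<noteq> 0 \<longrightarrow> finite A \<and> card A + size M \<le> d"
proof -
  obtain f where f: "f \<in> sNCSym" "g = abelianize f" using assms unfolding sSym_def by blast
  obtain d where d: "degree_le d f" using f sNCSym_degree by blast
  have "finite A \<and> card A + size M \<le> d" if gne: "g (A, M) \<noteq> 0" for A M
  proof -
    have "(\<Sum>b\<in>permutations_of_multiset M. f (A, b)) \<noteq> 0"
      using gne f sNCSym_finite[OF f(1)] by (simp add: abelianize_apply)
    then obtain b where b: "b \<in> permutations_of_multiset M" "f (A, b) \<noteq> 0" by (meson sum.neutral)
    then show ?thesis using degree_leD[OF d b(2)] by (auto dest: permutations_of_multisetD)
  qed
  then show ?thesis by blast
qed

lemma sSym_finite: "g \<in> sSym \<Longrightarrow> g (A, M) \<noteq> 0 \<Longrightarrow> finite A"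
  using sSym_degree by blast

lemma sSym_inv:
  assumes g: "g \<in> sSym" and \<sigma>: "finite S" "\<sigma> permutes S" and a: "distinct a"
  shows "word_coeff g (map \<sigma> a) (image_mset \<sigma> M) = word_coeff g a M"
proof -
  obtain f where f: "f \<in> sNCSym" "g = abelianize f" using g unfolding sSym_def by blast
  have "word_coeff g (map \<sigma> a) (image_mset \<sigma> M) =
      (\<Sum>b\<in>map \<sigma> ` permutations_of_multiset M. word_coeff f (map \<sigma> a) b)"
    unfolding f(2) word_coeff_abelianize[OF f(1)] permutations_of_multiset_image ..
  also have "\<dots> = (\<Sum>b\<in>permutations_of_multiset M. word_coeff f (map \<sigma> a) (map \<sigma> b))"
    using permutes_inj[OF \<sigma>(2)] by (subst sum.reindex) (auto intro: inj_on_subset)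
  also have "\<dots> = word_coeff g a M"
    unfolding f(2) word_coeff_abelianize[OF f(1)] using sNCSym_inv[OF f(1) \<sigma> a] by simp
  finally show ?thesis .
qed

lemma sSym_linear:
  assumes "f \<in> sSym" "g \<in> sSym"
  shows "(\<lambda>t. c * f t + d * g t) \<in> sSym"
proof -
  obtain f' g' where "f' \<in> sNCSym" "f = abelianize f'" "g' \<in> sNCSym" "g = abelianize g'"
    using assms unfolding sSym_def by blast
  then have "(\<lambda>t. c * f t + d * g t) = abelianize (\<lambda>t. c * f' t + d * g' t)" "(\<lambda>t. c * f' t + d * g' t) \<in> sNCSym"
    by (simp_all add: abelianize_linear sNCSym_linear)
  then show ?thesis unfolding sSym_def by (rule image_eqI)
qed

lemma abelianize_sSym: "f \<in> sNCSym \<Longrightarrow> abelianize f \<in> sSym"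
  unfolding sSym_def by blast

lemma sSym_0 [simp]: "(\<lambda>t. 0) \<in> sSym"
  by (rule sSymI(1)) auto

lemma sSym_sum:
  assumes "\<And>i. i \<in> T \<Longrightarrow> u i \<in> sSym"
  shows "(\<lambda>t. \<Sum>i\<in>T. c i * u i t) \<in> sSym"
  using assms
proof (induction T rule: infinite_finite_induct)
  case (insert x T)
  then show ?case using sSym_linear[of "u x" "\<lambda>t. \<Sum>i\<in>T. c i * u i t" "c x" 1] by simp
qed simp_all

lemma lift_sNCSym: "g \<in> sSym \<Longrightarrow> lift g \<in> sNCSym"
  using sSym_degree[of g] sSym_inv[of g] sSymI(2)[of g] by metis

text \<open>Exchanging two theta indices with equal exponents fixes the commutative monomial and
  swaps two thetas. This is why the fermionic part of a superpartition is strictly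
  decreasing.\<close>

lemma sSym_vanish:
  assumes g: "g \<in> sSym" and xy: "x \<in> A" "y \<in> A" "x \<noteq> y" "count M x = count M y"
  shows "g (A, M) = 0"
proof (cases "finite A")
  case True
  define a where "a = sorted_list_of_set A"
  have a: "distinct a" "set a = A" using True by (auto simp: a_def)
  obtain i j where ij: "i < length a" "j < length a" "x = a ! i" "y = a ! j"
    using xy a by (metis in_set_conv_nth)
  let ?\<sigma> = "Transposition.transpose x y"
  have "image_mset ?\<sigma> M = M"
  proof (rule multiset_eqI)
    fix z
    have "count (image_mset ?\<sigma> M) (?\<sigma> (?\<sigma> z)) = count M (?\<sigma> z)"
    proof -
      have "?\<sigma> -` {z} \<inter> set_mset M = (if ?\<sigma> z \<in># M then {?\<sigma> z} else {})"
        by (auto simp: transpose_eq_iff)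
      then show ?thesis by (auto simp: count_image_mset not_in_iff)
    qed
    also have "count M (?\<sigma> z) = count M z" using xy by (simp add: Transposition.transpose_def)
    finally show "count (image_mset ?\<sigma> M) z = count M z" by simp
  qed
  then have "word_coeff g (map ?\<sigma> a) M = word_coeff g a M"
    using sSym_inv[OF g _ permutes_swap_id a(1), of "{x, y}" x y M] by simp
  moreover have "map ?\<sigma> a = permute_list (Transposition.transpose i j) a"
    using map_transpose_eq_permute_list[OF a(1) ij(1,2)] ij by simp
  moreover have "word_coeff g (permute_list (Transposition.transpose i j) a) M = - word_coeff g a M"
    using ij xy a by (subst word_coeff_permute) (auto intro!: permutes_swap_id simp: sign_swap_id)
  ultimately have "word_coeff g a M = 0" by simp
  then show ?thesis using a by simp
qed (use sSym_finite[OF g] in blast)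

section \<open>Superpartitions as types of commutative monomials\<close>

text \<open>The superpartition of exponents of the commutative monomial \<open>(a, M)\<close>.\<close>

definition ctype :: "nat list \<Rightarrow> nat multiset \<Rightarrow> nat list \<times> nat list" where
  "ctype a M = (map (count M) a,
     rev (sorted_list_of_multiset (image_mset (count M) (mset_set (set_mset M - set a)))))"

text \<open>The commutative counterpart of \<open>canon\<close>: a normal form for the order of the
  thetas, unique when it exists.\<close>

definition desc :: "nat list \<Rightarrow> nat multiset \<Rightarrow> bool" where
  "desc a M \<longleftrightarrow> sorted_wrt (\<lambda>x y. count M x > count M y) a"

lemma desc_iff: "desc a M \<longleftrightarrow> sorted_wrt (>) (map (count M) a)"
  by (simp add: desc_def sorted_wrt_map)

lemma desc_rev: "desc a M \<longleftrightarrow> sorted_wrt (\<lambda>x y. count M x < count M y) (rev a)"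
  by (simp add: desc_def sorted_wrt_rev)

lemma desc_distinct: "desc a M \<Longrightarrow> distinct a"
  using sorted_wrt_key_distinct[of "count M" "rev a"] by (simp add: desc_rev)

lemma desc_unique: "desc a M \<Longrightarrow> desc a' M \<Longrightarrow> set a = set a' \<Longrightarrow> a = a'"
  using sorted_wrt_key_unique[of "count M" "rev a" "rev a'"] by (simp add: desc_rev)

lemma ex_desc: "finite A \<Longrightarrow> inj_on (count M) A \<Longrightarrow> \<exists>a. set a = A \<and> desc a M"
  using ex_sorted_wrt_key[of A "count M"] desc_rev by (metis rev_rev_ident set_rev)

lemma sum_list_mset: "sum_list (xs :: nat list) = sum_mset (mset xs)"
  by (simp add: sum_mset_sum_list)

lemma ctype_superpart:
  assumes "desc a M"
  shows "ctype a M \<in> superpart (size M) (length a)"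
proof -
  have d: "distinct a" using assms by (rule desc_distinct)
  let ?P = "sorted_list_of_multiset (image_mset (count M) (mset_set (set_mset M - set a)))"
  have "sum_list (map (count M) a) = (\<Sum>x\<in>set a. count M x)"
    using d by (rule sum_list_distinct_conv_sum_set)
  moreover have "sum_list (rev ?P) = (\<Sum>x\<in>set_mset M - set a. count M x)"
    by (simp add: sum_list_mset sum_unfold_sum_mset)
  moreover have "(\<Sum>x\<in>set a. count M x) + (\<Sum>x\<in>set_mset M - set a. count M x) = size M"
  proof -
    have "(\<Sum>x\<in>set a. count M x) + (\<Sum>x\<in>set_mset M - set a. count M x) = (\<Sum>x\<in>set a \<union> set_mset M. count M x)"
      by (subst sum.union_disjoint[symmetric]) (auto intro!: sum.cong)
    also have "\<dots> = size M"
      unfolding size_multiset_overloaded_eq by (rule sum.mono_neutral_right) (auto simp: not_in_iff)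
    finally show ?thesis .
  qed
  moreover have "sorted_wrt (\<ge>) (rev ?P)" by (simp add: sorted_wrt_rev)
  moreover have "\<forall>p\<in>set (rev ?P). 1 \<le> p" by auto
  ultimately show ?thesis
    using assms by (simp add: superpart_def ctype_def desc_iff)
qed

lemma ctype_superpartD:
  assumes "ctype a M \<in> superpart n m"
  shows "desc a M" "m = length a" "n = size M"
proof -
  show "m = length a" "desc a M"
    using assms by (auto simp: superpart_def ctype_def desc_iff)
  then have "ctype a M \<in> superpart (size M) (length a)" using ctype_superpart by blast
  then show "n = size M" using assms by (auto simp: superpart_def split: prod.splits)
qed

lemma superpart_snd_unique:
  assumes "sorted_wrt (\<ge>) P" "mset P = N"
  shows "P = rev (sorted_list_of_multiset N)"
proof -
  have "sorted (rev P)" using assms(1) by (simp add: sorted_wrt_rev)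
  then have "sorted_list_of_multiset (mset P) = rev P"
    by (metis mset_rev sorted_list_of_multiset_mset sorted_sort_id)
  then show ?thesis using assms by (metis rev_rev_ident)
qed

lemma ctype_eq_iff:
  assumes "\<Lambda> \<in> superpart n m"
  shows "ctype a M = \<Lambda> \<longleftrightarrow> map (count M) a = fst \<Lambda> \<and>
    image_mset (count M) (mset_set (set_mset M - set a)) = mset (snd \<Lambda>)"
proof -
  have "sorted_wrt (\<ge>) (snd \<Lambda>)" using assms by (auto simp: superpart_def)
  from superpart_snd_unique[OF this refl] show ?thesis
    by (cases \<Lambda>) (auto simp: ctype_def)
qed

lemma count_image_inj:
  assumes "inj f"
  shows "count (image_mset f M) (f x) = count M x"
proof -
  have "f -` {f x} \<inter> set_mset M = (if x \<in># M then {x} else {})" using assms by (auto dest: injD)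
  then show ?thesis by (auto simp: count_image_mset not_in_iff)
qed

lemma ctype_map:
  assumes "inj \<sigma>"
  shows "ctype (map \<sigma> a) (image_mset \<sigma> M) = ctype a M"
proof -
  have "set_mset (image_mset \<sigma> M) - set (map \<sigma> a) = \<sigma> ` (set_mset M - set a)"
    using assms by (auto dest: injD)
  moreover have "image_mset \<sigma> (mset_set (set_mset M - set a)) = mset_set (\<sigma> ` (set_mset M - set a))"
    using assms by (intro image_mset_mset_set) (auto intro: inj_on_subset)
  ultimately have "image_mset (count (image_mset \<sigma> M)) (mset_set (set_mset (image_mset \<sigma> M) - set (map \<sigma> a))) =
      image_mset (count M) (mset_set (set_mset M - set a))"
    by (metis (no_types, lifting) count_image_inj[OF assms] image_mset_cong multiset.map_comp o_apply)
  then show ?thesis by (simp add: ctype_def count_image_inj[OF assms])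
qed

text \<open>The monomial in \<open>com_terms\<close>, as a multiset of indices. A zero exponent,
  possible for a theta, leaves its index out of the multiset.\<close>

definition rows :: "nat list \<Rightarrow> nat list \<Rightarrow> nat multiset" where
  "rows e is = (\<Sum>j<length e. replicate_mset (e ! j) (is ! j))"

lemma count_rows:
  assumes "length is = length e" "distinct is" "j < length e"
  shows "count (rows e is) (is ! j) = e ! j"
proof -
  have "count (rows e is) (is ! j) = (\<Sum>i<length e. if i = j then e ! i else 0)"
    unfolding rows_def count_sum by (intro sum.cong refl) (use assms in \<open>auto simp: nth_eq_iff_index_eq\<close>)
  then show ?thesis using assms by simp
qed

lemma count_rows_notin: "length is = length e \<Longrightarrow> x \<notin> set is \<Longrightarrow> count (rows e is) x = 0"
  unfolding rows_def count_sum by (intro sum.neutral) auto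

lemma map_count_rows:
  assumes "length is = length e" "distinct is"
  shows "map (count (rows e is)) is = e"
  by (rule nth_equalityI) (use assms count_rows in auto)

lemma rows_eqI:
  assumes "length is = length e" "distinct is" "map (count M) is = e" "set_mset M \<subseteq> set is"
  shows "M = rows e is"
proof (rule multiset_eqI)
  fix x
  show "count M x = count (rows e is) x"
  proof (cases "x \<in> set is")
    case True
    then obtain j where j: "j < length is" "x = is ! j" by (auto simp: in_set_conv_nth)
    then have "count M x = e ! j" using assms(3) by (metis nth_map)
    then show ?thesis using count_rows[OF assms(1,2), of j] j assms(1) by simp
  next
    case False
    then have "x \<notin># M" using assms(4) by blast
    then show ?thesis using count_rows_notin[OF assms(1) False] by (simp add: not_in_iff)
  qed
qed

text \<open>Parts of \<open>P\<close> are positive, so the indices in \<open>c\<close> really occur,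
  while a theta in \<open>a\<close> may have exponent 0; removing \<open>a\<close> from the support
  leaves exactly \<open>c\<close>.\<close>

lemma ctype_rows:
  assumes \<Lambda>: "(F, P) \<in> superpart n m" and len: "length a = length F" "length c = length P" and d: "distinct (a @ c)"
  shows "ctype a (rows (F @ P) (a @ c)) = (F, P)"
proof -
  let ?M = "rows (F @ P) (a @ c)"
  have l: "length (a @ c) = length (F @ P)" using len by simp
  have "map (count ?M) (a @ c) = F @ P" by (rule map_count_rows[OF l d])
  then have cnt: "map (count ?M) a = F" "map (count ?M) c = P" using len by auto
  have "x \<in># ?M" if "x \<in> set c" for x
  proof -
    have "count ?M x \<in> set P" using that cnt(2) by (metis image_eqI set_map)
    then have "count ?M x \<noteq> 0" using \<Lambda> by (auto simp: superpart_def)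
    then show ?thesis by (meson not_in_iff)
  qed
  moreover have "set_mset ?M \<subseteq> set (a @ c)" using count_rows_notin[OF l] by (metis not_in_iff subsetI)
  ultimately have "set_mset ?M - set a = set c" using d by auto
  then have "image_mset (count ?M) (mset_set (set_mset ?M - set a)) = mset (map (count ?M) c)"
    using d by (simp add: mset_set_set)
  then show ?thesis using ctype_eq_iff[OF \<Lambda>] cnt by simp
qed

lemma ex_rows:
  assumes "distinct a" "ctype a M = (F, P)"
  obtains c where "distinct (a @ c)" "length c = length P" "M = rows (F @ P) (a @ c)"
proof -
  obtain c0 where c0: "mset c0 = mset_set (set_mset M - set a)" using ex_mset by blast
  have P: "mset P = image_mset (count M) (mset_set (set_mset M - set a))"
    using assms(2) by (auto simp: ctype_def)
  then have "mset P = mset (map (count M) c0)" using c0 by simp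
  \<comment> \<open>The indices outside \<open>a\<close> are arranged so that their exponents come
    in the order of \<open>P\<close>.\<close>
  then obtain p where p: "p permutes {..<length (map (count M) c0)}" "permute_list p (map (count M) c0) = P"
    by (rule mset_eq_permutation)
  define c where "c = permute_list p c0"
  have pc: "p permutes {..<length c0}" using p by simp
  have mc: "mset c = mset_set (set_mset M - set a)" using pc c0 by (simp add: c_def)
  then have set_c: "set c = set_mset M - set a" by (metis finite_Diff finite_set_mset finite_set_mset_mset_set set_mset_mset)
  have dc: "distinct c" using mc set_c
    by (metis finite_Diff finite_set_mset distinct_count_atmost_1 count_mset_set(1) count_mset_set(3) )
  have cP: "map (count M) c = P" using p(2) pc by (simp add: c_def permute_list_map)
  have "map (count M) a = F" using assms(2) by (simp add: ctype_def)
  then have eq: "map (count M) (a @ c) = F @ P" using cP by simp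
  have d: "distinct (a @ c)" using assms(1) dc set_c by auto
  have "M = rows (F @ P) (a @ c)"
    by (rule rows_eqI[OF _ d eq]) (use arg_cong[OF eq, of length] set_c in auto)
  moreover have "length c = length P" using cP by auto
  ultimately show ?thesis using that d by blast
qed

text \<open>As \<open>com_terms\<close> is a set of series, lists of indices that differ by
  exchanging equal parts of \<open>P\<close> give one term. At a given monomial at most one ordering
  of the thetas has type \<open>\<Lambda>\<close>, since the exponents decrease strictly.\<close>

lemma com_m_alternant:
  assumes \<Lambda>: "\<Lambda> \<in> superpart n m"
  shows "com_m \<Lambda> = alternant (\<lambda>a M. if ctype a M = \<Lambda> then 1 else 0)"
proof
  obtain F P where FP: "\<Lambda> = (F, P)" by (cases \<Lambda>)
  fix t :: "nat set \<times> nat multiset"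
  obtain A M where t: "t = (A, M)" by (cases t)
  let ?T = "{a \<in> permutations_of_set A. ctype a M = \<Lambda>}"
  have terms: "s \<in> com_terms \<Lambda> \<longleftrightarrow> (\<exists>is. s = monom (take (length F) is) (rows (F @ P) is) \<and>
      length is = length (F @ P) \<and> distinct is)" for s
    unfolding com_terms_def FP Let_def by (simp add: rows_def)
  have ser: "{s \<in> com_terms \<Lambda>. s (A, M) \<noteq> 0} = (\<lambda>a. monom a M) ` ?T"
  proof (intro equalityI subsetI)
    fix s assume "s \<in> {s \<in> com_terms \<Lambda>. s (A, M) \<noteq> 0}"
    then obtain xs where xs: "s = monom (take (length F) xs) (rows (F @ P) xs)"
      "length xs = length (F @ P)" "distinct xs" "s (A, M) \<noteq> 0" using terms by auto
    define a c where "a = take (length F) xs" and "c = drop (length F) xs"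
    have ac: "xs = a @ c" "length a = length F" "length c = length P" using xs by (auto simp: a_def c_def)
    have "set a = A" "distinct a" "rows (F @ P) xs = M" using xs by (auto simp: monom_def a_def split: if_splits)
    moreover then have "ctype a M = \<Lambda>" using ctype_rows[of F P n m a c] \<Lambda> FP ac xs by simp
    ultimately have "s = monom a M" "a \<in> ?T" using xs(1) a_def by (auto intro: permutations_of_setI)
    then show "s \<in> (\<lambda>a. monom a M) ` ?T" by (rule image_eqI)
  next
    fix s assume "s \<in> (\<lambda>a. monom a M) ` ?T"
    then obtain a where a: "s = monom a M" "distinct a" "set a = A" "ctype a M = (F, P)"
      using FP by (auto simp: permutations_of_set_def)
    obtain c where c: "distinct (a @ c)" "length c = length P" "M = rows (F @ P) (a @ c)"
      using ex_rows[OF a(2,4)] .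
    have "length a = length F" using a(4) by (auto simp: ctype_def)
    then have "s \<in> com_terms \<Lambda>"
      unfolding terms using a c by (intro exI[of _ "a @ c"]) simp
    then show "s \<in> {s \<in> com_terms \<Lambda>. s (A, M) \<noteq> 0}" using a by (simp add: monom_def)
  qed
  have uni: "a = a'" if "a \<in> ?T" "a' \<in> ?T" for a a'
  proof -
    have "desc a M" "desc a' M" using that \<Lambda> ctype_superpartD(1) by auto
    then show ?thesis using that by (intro desc_unique) (auto simp: permutations_of_set_def)
  qed
  have "com_m \<Lambda> (A, M) = (\<Sum>s\<in>(\<lambda>a. monom a M) ` ?T. s (A, M))"
    unfolding com_m_def formal_sum_def ser ..
  also have "\<dots> = (\<Sum>a\<in>?T. monom a M (A, M))"
    by (subst sum.reindex) (auto intro!: inj_onI uni)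
  also have "\<dots> = (\<Sum>a\<in>?T. theta_sign a)"
    by (intro sum.cong refl) (auto simp: monom_def permutations_of_set_def)
  also have "\<dots> = alternant (\<lambda>a M. if ctype a M = \<Lambda> then 1 else 0) (A, M)"
    unfolding alternant_apply by (intro sum.mono_neutral_cong_left) auto
  finally show "com_m \<Lambda> t = alternant (\<lambda>a M. if ctype a M = \<Lambda> then 1 else 0) t" using t by simp
qed

lemma com_m_sSym:
  assumes \<Lambda>: "\<Lambda> \<in> superpart n m"
  shows "com_m \<Lambda> \<in> sSym"
  unfolding com_m_alternant[OF \<Lambda>]
proof (rule sSymI(1)[of _ "m + n"])
  fix A M assume "alternant (\<lambda>a M. if ctype a M = \<Lambda> then 1 else 0) (A, M) \<noteq> 0"
  then obtain a where "a \<in> permutations_of_set A" "theta_sign a * (if ctype a M = \<Lambda> then 1 else 0) \<noteq> 0"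
    unfolding alternant_apply by (rule sum.not_neutral_contains_not_neutral)
  then have a: "a \<in> permutations_of_set A" "ctype a M = \<Lambda>" by (auto split: if_splits)
  then have "length a = m" "size M = n" using ctype_superpartD[of a M n m] \<Lambda> by auto
  then show "finite A \<and> card A + size M \<le> m + n"
    using a length_finite_permutations_of_set[of a A] by (auto simp: permutations_of_set_def)
next
  fix \<sigma> :: "nat \<Rightarrow> nat" and S and a :: "nat list" and M assume \<sigma>: "\<sigma> permutes S" and a: "distinct a"
  show "word_coeff (alternant (\<lambda>a M. if ctype a M = \<Lambda> then 1 else 0)) (map \<sigma> a) (image_mset \<sigma> M) =
      word_coeff (alternant (\<lambda>a M. if ctype a M = \<Lambda> then 1 else 0)) a M"
    using permutes_inj[OF \<sigma>] a by (intro word_coeff_alternant_map) (simp_all add: ctype_map)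
qed

lemma word_coeff_com_m:
  assumes \<Lambda>: "\<Lambda> \<in> superpart n m" and a: "desc a M"
  shows "word_coeff (com_m \<Lambda>) a M = (if ctype a M = \<Lambda> then 1 else 0)"
proof -
  have "com_m \<Lambda> (set a, M) = (\<Sum>a'\<in>{a}. theta_sign a' * (if ctype a' M = \<Lambda> then 1 else 0))"
    unfolding com_m_alternant[OF \<Lambda>] alternant_apply
  proof (rule sum.mono_neutral_right)
    show "\<forall>a'\<in>permutations_of_set (set a) - {a}. theta_sign a' * (if ctype a' M = \<Lambda> then 1 else 0) = 0"
    proof
      fix a' assume a': "a' \<in> permutations_of_set (set a) - {a}"
      have "ctype a' M \<noteq> \<Lambda>"
      proof
        assume "ctype a' M = \<Lambda>"
        then have "desc a' M" using \<Lambda> ctype_superpartD(1) by blast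
        then show False using desc_unique[OF a] a' by (auto simp: permutations_of_set_def)
      qed
      then show "theta_sign a' * (if ctype a' M = \<Lambda> then 1 else 0) = 0" by simp
    qed
  qed (use desc_distinct[OF a] in \<open>auto intro: permutations_of_setI\<close>)
  then show ?thesis by (simp add: word_coeff_def)
qed

lemma superpart_lengths: "(F, P) \<in> superpart n m \<Longrightarrow> length F = m"
  by (simp add: superpart_def)

section \<open>Coordinates with respect to \<open>com_m\<close>\<close>

definition ccoef :: "nat list \<times> nat list \<Rightarrow> com_series \<Rightarrow> rat" where
  "ccoef \<Lambda> g = word_coeff g [0..<length (fst \<Lambda>)]
     (rows (fst \<Lambda> @ snd \<Lambda>) [0..<length (fst \<Lambda> @ snd \<Lambda>)])"

lemma ctype_standard:
  assumes "\<Lambda> \<in> superpart n m"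
  shows "ctype [0..<length (fst \<Lambda>)] (rows (fst \<Lambda> @ snd \<Lambda>) [0..<length (fst \<Lambda> @ snd \<Lambda>)]) = \<Lambda>"
proof -
  obtain F P where \<Lambda>: "\<Lambda> = (F, P)" by (cases \<Lambda>)
  have "[0..<length (F @ P)] = [0..<length F] @ [length F..<length F + length P]"
    using upt_add_eq_append[of 0 "length F" "length P"] by simp
  then show ?thesis using ctype_rows[of F P n m "[0..<length F]" "[length F..<length F + length P]"] assms \<Lambda>
    by simp
qed

lemma ccoef_com_m:
  assumes "\<Lambda> \<in> superpart n m" "\<Omega> \<in> superpart n' m'"
  shows "ccoef \<Lambda> (com_m \<Omega>) = (if \<Lambda> = \<Omega> then 1 else 0)"
proof -
  have "desc [0..<length (fst \<Lambda>)] (rows (fst \<Lambda> @ snd \<Lambda>) [0..<length (fst \<Lambda> @ snd \<Lambda>)])"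
    using ctype_superpartD(1) ctype_standard[OF assms(1)] assms(1) by metis
  then show ?thesis
    using word_coeff_com_m[OF assms(2)] ctype_standard[OF assms(1)] by (simp add: ccoef_def)
qed

lemma ccoef_eq_word_coeff:
  assumes g: "g \<in> sSym" and a: "desc a M"
  shows "ccoef (ctype a M) g = word_coeff g a M"
proof -
  obtain F P where FP: "ctype a M = (F, P)" by (cases "ctype a M")
  obtain c where c: "distinct (a @ c)" "length c = length P" "M = rows (F @ P) (a @ c)"
    using ex_rows[OF desc_distinct[OF a] FP] .
  have lF: "length a = length F" using FP by (auto simp: ctype_def)
  have "length [0..<length (F @ P)] = length (a @ c)" using lF c by simp
  then obtain \<sigma> S where \<sigma>: "finite S" "\<sigma> permutes S" "a @ c = map \<sigma> [0..<length (F @ P)]"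
    using ex_permutes_map[of "[0..<length (F @ P)]" "a @ c"] c(1) by (auto simp: nth_eq_iff_index_eq)
  have "[0..<length (F @ P)] = [0..<length F] @ [length F..<length F + length P]"
    using upt_add_eq_append[of 0 "length F" "length P"] by simp
  then have "a = map \<sigma> [0..<length F]" using \<sigma>(3) lF by simp
  moreover have "M = image_mset \<sigma> (rows (F @ P) [0..<length (F @ P)])"
  proof -
    have im: "image_mset \<sigma> (\<Sum>j<k. R j) = (\<Sum>j<k. image_mset \<sigma> (R j))" for R :: "nat \<Rightarrow> nat multiset" and k :: nat
      by (induction k) auto
    have "image_mset \<sigma> (rows (F @ P) [0..<length (F @ P)]) =
        (\<Sum>j<length (F @ P). replicate_mset ((F @ P) ! j) (\<sigma> ([0..<length (F @ P)] ! j)))"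
      unfolding rows_def im by simp
    also have "\<dots> = rows (F @ P) (a @ c)"
      unfolding rows_def \<sigma>(3) by (intro sum.cong refl) simp
    finally show ?thesis using c(3) by simp
  qed
  ultimately show ?thesis
    using sSym_inv[OF g \<sigma>(1,2), of "[0..<length F]" "rows (F @ P) [0..<length (F @ P)]"] FP
    by (simp add: ccoef_def)
qed

text \<open>If two thetas have equal exponents the coefficient vanishes; otherwise the thetas can be
  put into decreasing order, and the monomial is a relabelling of a standard one.\<close>

lemma sSym_eqI:
  assumes f: "f \<in> sSym" and g: "g \<in> sSym"
    and eq: "\<And>n m \<Lambda>. \<Lambda> \<in> superpart n m \<Longrightarrow> ccoef \<Lambda> f = ccoef \<Lambda> g"
  shows "f = g"
proof
  fix t :: "nat set \<times> nat multiset"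
  obtain A M where t: "t = (A, M)" by (cases t)
  show "f t = g t"
  proof (cases "finite A \<and> inj_on (count M) A")
    case True
    then obtain a where a: "set a = A" "desc a M" using ex_desc by blast
    have "word_coeff f a M = word_coeff g a M"
      using eq[OF ctype_superpart[OF a(2)]] ccoef_eq_word_coeff[OF f a(2)] ccoef_eq_word_coeff[OF g a(2)] by simp
    then show ?thesis using a t by (simp add: word_coeff_def)
  next
    case False
    then show ?thesis
      using sSym_vanish[OF f] sSym_vanish[OF g] sSym_finite[OF f] sSym_finite[OF g] t
      by (metis inj_onI)
  qed
qed

lemma finite_superpart: "finite (superpart n m)"
proof (rule finite_subset)
  show "superpart n m \<subseteq> {F. set F \<subseteq> {..n} \<and> length F = m} \<times> {P. set P \<subseteq> {..n} \<and> length P \<le> n}"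
  proof
    fix \<Lambda> assume "\<Lambda> \<in> superpart n m"
    then obtain F P where \<Lambda>: "\<Lambda> = (F, P)" "length F = m" "\<forall>p\<in>set P. 1 \<le> p" "sum_list F + sum_list P = n"
      by (auto simp: superpart_def)
    have "length P \<le> sum_list P" if "\<forall>p\<in>set P. 1 \<le> p" for P :: "nat list"
      using that by (induction P) auto
    moreover have "x \<le> n" if "x \<in> set F \<union> set P" for x
      using that \<Lambda>(4) member_le_sum_list[of x F] member_le_sum_list[of x P] by auto
    ultimately show "\<Lambda> \<in> {F. set F \<subseteq> {..n} \<and> length F = m} \<times> {P. set P \<subseteq> {..n} \<and> length P \<le> n}"
      using \<Lambda> by fastforce
  qed
  show "finite ({F. set F \<subseteq> {..n} \<and> length F = m} \<times> {P. set P \<subseteq> {..n :: nat} \<and> length P \<le> n})"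
    using finite_lists_length_eq[of "{..n}" m] finite_lists_length_le[of "{..n}" n] by blast
qed

definition com_superparts :: "nat \<Rightarrow> (nat list \<times> nat list) set" where
  "com_superparts d = (\<Union>n\<le>d. \<Union>m\<le>d. superpart n m)"

lemma finite_com_superparts [simp]: "finite (com_superparts d)"
  by (simp add: com_superparts_def finite_superpart)

lemma com_m_expansion:
  assumes g: "g \<in> sSym"
  shows "\<exists>d. g = (\<lambda>t. \<Sum>\<Lambda>\<in>com_superparts d. ccoef \<Lambda> g * com_m \<Lambda> t)"
proof -
  obtain d where d: "\<And>A M. g (A, M) \<noteq> 0 \<Longrightarrow> finite A \<and> card A + size M \<le> d"
    using sSym_degree[OF g] by blast
  have "g = (\<lambda>t. \<Sum>\<Lambda>\<in>com_superparts d. ccoef \<Lambda> g * com_m \<Lambda> t)"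
  proof (rule sSym_eqI[OF g sSym_sum])
    fix \<Lambda> assume "\<Lambda> \<in> com_superparts d"
    then show "com_m \<Lambda> \<in> sSym" using com_m_sSym unfolding com_superparts_def by blast
  next
    fix n m \<Lambda> assume \<Lambda>: "\<Lambda> \<in> superpart n m"
    let ?a = "[0..<length (fst \<Lambda>)]" and ?M = "rows (fst \<Lambda> @ snd \<Lambda>) [0..<length (fst \<Lambda> @ snd \<Lambda>)]"
    have "m = length ?a" "n = size ?M"
      using ctype_superpartD(2,3)[of ?a ?M n m] ctype_standard[OF \<Lambda>] \<Lambda> by auto
    then have out: "ccoef \<Lambda> g = 0" if "\<Lambda> \<notin> com_superparts d"
      using d[of "set ?a" ?M] \<Lambda> that unfolding ccoef_def word_coeff_eq_0_iff com_superparts_def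
      by (force simp: distinct_card)
    have "ccoef \<Lambda> (\<lambda>t. \<Sum>\<Omega>\<in>com_superparts d. ccoef \<Omega> g * com_m \<Omega> t) =
        (\<Sum>\<Omega>\<in>com_superparts d. ccoef \<Omega> g * ccoef \<Lambda> (com_m \<Omega>))"
      unfolding ccoef_def word_coeff_sum ..
    also have "\<dots> = (\<Sum>\<Omega>\<in>com_superparts d. if \<Omega> = \<Lambda> then ccoef \<Lambda> g else 0)"
    proof (intro sum.cong refl)
      fix \<Omega> assume "\<Omega> \<in> com_superparts d"
      then obtain n' m' where "\<Omega> \<in> superpart n' m'" unfolding com_superparts_def by blast
      then show "ccoef \<Omega> g * ccoef \<Lambda> (com_m \<Omega>) = (if \<Omega> = \<Lambda> then ccoef \<Lambda> g else 0)"
        by (simp add: ccoef_com_m[OF \<Lambda>])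
    qed
    also have "\<dots> = ccoef \<Lambda> g" using out by simp
    finally show "ccoef \<Lambda> g = ccoef \<Lambda> (\<lambda>t. \<Sum>\<Omega>\<in>com_superparts d. ccoef \<Omega> g * com_m \<Omega> t)" by simp
  qed
  then show ?thesis by blast
qed

section \<open>Abelianization of the complete functions\<close>

definition word_set :: "nat \<Rightarrow> nat \<Rightarrow> nat set \<Rightarrow> nat multiset \<Rightarrow> (nat list \<times> nat list) set" where
  "word_set m n A M = {a \<in> permutations_of_set A. length a = m} \<times> {b \<in> permutations_of_multiset M. length b = n}"

lemma mem_word_set:
  "(a, b) \<in> word_set m n A M \<longleftrightarrow> distinct a \<and> set a = A \<and> length a = m \<and> mset b = M \<and> length b = n"
  by (auto simp: word_set_def permutations_of_set_def permutations_of_multiset_def)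

lemma finite_word_set [simp]: "finite (word_set m n A M)"
  by (simp add: word_set_def)

lemma hword_finite: "hword k (A, b) \<noteq> 0 \<Longrightarrow> finite A"
  using hword_bidegree by blast

lemma hword_apply:
  "hword (a, b) (A, b') = (\<Sum>a'\<in>permutations_of_set A.
    theta_sign a' * (if length a' = length a \<and> length b' = length b then of_nat (kappa (a, b) (a', b')) else 0))"
  by (simp add: hword_def alternant_apply)

lemma abelianize_hword_alternant:
  "abelianize (hword (a, b)) (A, M) = (\<Sum>a'\<in>permutations_of_set A. theta_sign a' *
    (if length a' = length a \<and> size M = length b
     then of_nat (\<Sum>b'\<in>permutations_of_multiset M. kappa (a, b) (a', b')) else 0))"
proof -
  have "abelianize (hword (a, b)) (A, M) = (\<Sum>b'\<in>permutations_of_multiset M. hword (a, b) (A, b'))"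
    by (rule abelianize_apply) (rule hword_finite)
  also have "\<dots> = (\<Sum>a'\<in>permutations_of_set A. \<Sum>b'\<in>permutations_of_multiset M.
      theta_sign a' * (if length a' = length a \<and> length b' = length b then of_nat (kappa (a, b) (a', b')) else 0))"
    unfolding hword_apply by (rule sum.swap)
  also have "\<dots> = (\<Sum>a'\<in>permutations_of_set A. theta_sign a' * (if length a' = length a \<and> size M = length b
     then of_nat (\<Sum>b'\<in>permutations_of_multiset M. kappa (a, b) (a', b')) else 0))"
  proof (intro sum.cong refl)
    fix a'
    have "length b' = size M" if "b' \<in> permutations_of_multiset M" for b'
      using that by (auto dest: permutations_of_multisetD)
    then have "(\<Sum>b'\<in>permutations_of_multiset M. theta_sign a' *
        (if length a' = length a \<and> length b' = length b then of_nat (kappa (a, b) (a', b')) else 0)) =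
      (\<Sum>b'\<in>permutations_of_multiset M. theta_sign a' *
        (if length a' = length a \<and> size M = length b then of_nat (kappa (a, b) (a', b')) else 0))"
      by (intro sum.cong refl) simp
    then show "(\<Sum>b'\<in>permutations_of_multiset M. theta_sign a' *
        (if length a' = length a \<and> length b' = length b then of_nat (kappa (a, b) (a', b')) else 0)) =
      theta_sign a' * (if length a' = length a \<and> size M = length b
        then of_nat (\<Sum>b'\<in>permutations_of_multiset M. kappa (a, b) (a', b')) else 0)"
      by (cases "length a' = length a \<and> size M = length b") (auto simp: sum_distrib_left)
  qed
  finally show ?thesis .
qed

lemma abelianize_hword:
  "abelianize (hword (a, b)) (A, M) =
    (\<Sum>w\<in>word_set (length a) (length b) A M. theta_sign (fst w) * of_nat (kappa (a, b) w))"
proof -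
  have B: "{b' \<in> permutations_of_multiset M. length b' = length b} =
      (if size M = length b then permutations_of_multiset M else {})"
    by (auto dest: permutations_of_multisetD)
  show ?thesis
    unfolding abelianize_hword_alternant word_set_def sum.cartesian_product' B
    by (rule sum.mono_neutral_cong_right) (auto simp: sum_distrib_left)
qed

text \<open>Over disjoint alphabets the pairs of letters from the two parts never coincide, so their
  multiplicities do not interact.\<close>

lemma kappa_append:
  assumes "length a = length a1" "length b = length b1"
    and disj: "(set a1 \<union> set b1) \<inter> (set a2 \<union> set b2) = {}"
  shows "kappa (a1 @ a2, b1 @ b2) (a @ a', b @ b') = kappa (a1, b1) (a, b) * kappa (a2, b2) (a', b')"
proof -
  have "set_mset (mset (zip a1 a) + mset (zip b1 b)) \<inter> set_mset (mset (zip a2 a') + mset (zip b2 b')) = {}"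
    using disj by (auto dest!: set_zip_leftD)
  from mfact_union_disjoint[OF this] show ?thesis
    using assms(1,2) by (simp add: kappa_def add_ac)
qed

text \<open>Words of the concatenated length are cut at the lengths of \<open>a1\<close> and
  \<open>b1\<close>. Then \<open>kappa\<close> splits by disjointness of the alphabets, and the
  theta sign splits into the signs of the pieces and the sign that \<open>com_mult\<close>
  produces.\<close>

lemma abelianize_hword_append:
  assumes disj: "(set a1 \<union> set b1) \<inter> (set a2 \<union> set b2) = {}"
  shows "abelianize (hword (a1 @ a2, b1 @ b2)) =
    com_mult (abelianize (hword (a1, b1))) (abelianize (hword (a2, b2)))"
proof
  fix t :: "nat set \<times> nat multiset"
  obtain C M where t: "t = (C, M)" by (cases t)
  let ?f = "abelianize (hword (a1, b1))" and ?g = "abelianize (hword (a2, b2))"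
  let ?m1 = "length a1" and ?m2 = "length a2" and ?n1 = "length b1" and ?n2 = "length b2"
  let ?W = "word_set (length (a1 @ a2)) (length (b1 @ b2)) C M"
  let ?F = "\<lambda>w. theta_sign (fst w) * of_nat (kappa (a1 @ a2, b1 @ b2) w)"
  let ?G = "\<lambda>((A, u), (B, v)) t.
     ?f (A, u) * ?g (B, v) * monom (sorted_list_of_set A @ sorted_list_of_set B) (u + v) t"
  \<comment> \<open>Cuts a word in two and forgets the order within the pieces: this is the pair of
    monomials in whose product the word is counted.\<close>
  define h where "h = (\<lambda>(a :: nat list, b :: nat list). ((set (take ?m1 a), mset (take ?n1 b)), (set (drop ?m1 a), mset (drop ?n1 b))))"
  define app where "app = (\<lambda>((a, b), (a', b')). (a @ a', b @ b') :: nat list \<times> nat list)"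
  have ne: "\<exists>w. w \<in> word_set (length a) (length b) A u" if "abelianize (hword (a, b)) (A, u) \<noteq> 0" for a b A u
    using that unfolding abelianize_hword by (meson sum.neutral)
  have app_in: "app (w1, w2) \<in> ?W \<and> h (app (w1, w2)) = ((A, u), (B, v))"
    if "w1 \<in> word_set ?m1 ?n1 A u" "w2 \<in> word_set ?m2 ?n2 B v" "A \<inter> B = {}" "A \<union> B = C" "u + v = M"
    for w1 w2 A u B v
    using that by (cases w1; cases w2) (auto simp: app_def h_def mem_word_set)
  have sub: "{i \<in> UNIV. ?G i (C, M) \<noteq> 0} \<subseteq> h ` ?W"
  proof
    fix i assume i: "i \<in> {i \<in> UNIV. ?G i (C, M) \<noteq> 0}"
    obtain A u B v where iA: "i = ((A, u), (B, v))" by (metis surj_pair)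
    have nz: "?f (A, u) \<noteq> 0" "?g (B, v) \<noteq> 0"
      and mon: "monom (sorted_list_of_set A @ sorted_list_of_set B) (u + v) (C, M) \<noteq> 0"
      using i iA by auto
    obtain w1 where w1: "w1 \<in> word_set ?m1 ?n1 A u" using ne[OF nz(1)] by blast
    obtain w2 where w2: "w2 \<in> word_set ?m2 ?n2 B v" using ne[OF nz(2)] by blast
    have fin: "finite A" "finite B" using w1 w2 by (metis List.finite_set mem_word_set surj_pair)+
    then have "A \<inter> B = {}" "A \<union> B = C" "u + v = M" using mon by (auto simp: monom_def split: if_splits)
    then have "app (w1, w2) \<in> ?W" "h (app (w1, w2)) = i" using app_in[OF w1 w2] iA by auto
    then show "i \<in> h ` ?W" by (metis image_eqI)
  qed
  \<comment> \<open>The words above one pair of monomials are the concatenations of a word of the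
    first with a word of the second.\<close>
  have group: "(\<Sum>w\<in>{w \<in> ?W. h w = y}. ?F w) = ?G y (C, M)" if y: "y \<in> h ` ?W" for y
  proof -
    obtain a b where ab: "(a, b) \<in> ?W" "y = h (a, b)" using y by auto
    define A u B v where "A = set (take ?m1 a)" and "u = mset (take ?n1 b)"
      and "B = set (drop ?m1 a)" and "v = mset (drop ?n1 b)"
    have yA: "y = ((A, u), (B, v))" using ab by (simp add: h_def A_def u_def B_def v_def)
    have AB: "A \<inter> B = {}"
      using ab(1) set_take_disj_set_drop_if_distinct[of a ?m1 ?m1] by (auto simp: mem_word_set A_def B_def)
    have C: "A \<union> B = C" using ab(1) by (metis A_def B_def append_take_drop_id mem_word_set set_append)
    have M: "u + v = M" using ab(1) by (metis u_def v_def append_take_drop_id mem_word_set mset_append)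
    have "finite A" "finite B" by (auto simp: A_def B_def)
    then have mon: "monom (sorted_list_of_set A @ sorted_list_of_set B) (u + v) (C, M) =
        theta_sign (sorted_list_of_set A @ sorted_list_of_set B)"
      using AB C M by (simp add: monom_def)
    let ?X = "word_set ?m1 ?n1 A u \<times> word_set ?m2 ?n2 B v"
    have fiber: "{w \<in> ?W. h w = y} = app ` ?X"
    proof (intro equalityI subsetI)
      fix w assume w: "w \<in> {w \<in> ?W. h w = y}"
      obtain c d where cd: "w = (c, d)" by (cases w)
      have "(take ?m1 c, take ?n1 d) \<in> word_set ?m1 ?n1 A u" "(drop ?m1 c, drop ?n1 d) \<in> word_set ?m2 ?n2 B v"
        using w by (auto simp: cd mem_word_set yA h_def)
      moreover have "w = app ((take ?m1 c, take ?n1 d), (drop ?m1 c, drop ?n1 d))"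
        by (simp add: app_def cd)
      ultimately show "w \<in> app ` ?X" by blast
    next
      fix w assume "w \<in> app ` ?X"
      then obtain w1 w2 where "w = app (w1, w2)" "w1 \<in> word_set ?m1 ?n1 A u" "w2 \<in> word_set ?m2 ?n2 B v" by auto
      then show "w \<in> {w \<in> ?W. h w = y}" using app_in[OF _ _ AB C M] yA by simp
    qed
    have inj: "inj_on app ?X"
      by (rule inj_onI) (auto simp: app_def mem_word_set)
    have "(\<Sum>w\<in>{w \<in> ?W. h w = y}. ?F w) = (\<Sum>x\<in>?X. ?F (app x))"
      unfolding fiber by (subst sum.reindex[OF inj]) simp
    also have "\<dots> = (\<Sum>x\<in>?X. theta_sign (sorted_list_of_set A @ sorted_list_of_set B) *
        ((theta_sign (fst (fst x)) * of_nat (kappa (a1, b1) (fst x))) *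
         (theta_sign (fst (snd x)) * of_nat (kappa (a2, b2) (snd x)))))"
    proof (intro sum.cong refl)
      fix x assume x: "x \<in> ?X"
      obtain c d c' d' where xc: "x = ((c, d), (c', d'))" by (metis surj_pair)
      have w: "distinct c" "set c = A" "length c = ?m1" "length d = ?n1" "distinct c'" "set c' = B"
        using x xc by (auto simp: mem_word_set)
      then show "?F (app x) = theta_sign (sorted_list_of_set A @ sorted_list_of_set B) *
        ((theta_sign (fst (fst x)) * of_nat (kappa (a1, b1) (fst x))) *
         (theta_sign (fst (snd x)) * of_nat (kappa (a2, b2) (snd x))))"
        using theta_sign_append[of c c'] kappa_append[of c a1 d b1 a2 b2 c' d'] disj
        by (simp add: xc app_def)
    qed
    also have "\<dots> = theta_sign (sorted_list_of_set A @ sorted_list_of_set B) * (?f (A, u) * ?g (B, v))"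
    proof -
      have "?f (A, u) * ?g (B, v) = (\<Sum>x\<in>?X. (theta_sign (fst (fst x)) * of_nat (kappa (a1, b1) (fst x))) *
          (theta_sign (fst (snd x)) * of_nat (kappa (a2, b2) (snd x))))"
        unfolding abelianize_hword sum_product sum.cartesian_product'[of _ "word_set ?m1 ?n1 A u"] fst_conv snd_conv ..
      then show ?thesis by (simp only: sum_distrib_left)
    qed
    also have "\<dots> = ?G y (C, M)"
      by (simp only: yA prod.case mon mult_ac)
    finally show ?thesis .
  qed
  have "com_mult ?f ?g (C, M) = (\<Sum>i\<in>{i \<in> UNIV. ?G i (C, M) \<noteq> 0}. ?G i (C, M))"
    unfolding com_mult_def formal_sum_def ..
  also have "\<dots> = (\<Sum>y\<in>h ` ?W. ?G y (C, M))"
    by (rule sum.mono_neutral_left) (use sub in auto)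
  also have "\<dots> = (\<Sum>y\<in>h ` ?W. \<Sum>w\<in>{w \<in> ?W. h w = y}. ?F w)"
    by (intro sum.cong refl) (rule group[symmetric])
  also have "\<dots> = (\<Sum>w\<in>?W. ?F w)"
    by (rule sum.image_gen[symmetric]) simp
  also have "\<dots> = abelianize (hword (a1 @ a2, b1 @ b2)) (C, M)"
    by (rule abelianize_hword[symmetric])
  finally show "abelianize (hword (a1 @ a2, b1 @ b2)) t = com_mult ?f ?g t" using t by simp
qed

text \<open>Only one multiplicity is raised; the factor is the origin of the weight in
  \<open>com_h_tilde\<close>.\<close>

lemma mfact_add_mset: "mfact (add_mset y M) = (count M y + 1) * mfact M"
proof -
  let ?S = "insert y (set_mset M)"
  have "mfact (add_mset y M) = (\<Prod>x\<in>?S. (if x = y then count M y + 1 else 1) * fact (count M x))"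
    by (subst mfact_eq_prod[of ?S]) (auto intro!: prod.cong)
  also have "\<dots> = (count M y + 1) * (\<Prod>x\<in>?S. fact (count M x))"
    by (simp only: prod.distrib, subst prod.delta) auto
  also have "(\<Prod>x\<in>?S. fact (count M x)) = mfact M"
    by (rule mfact_eq_prod[symmetric]) auto
  finally show ?thesis .
qed

lemma sum_superpart_com_m:
  "(\<Sum>\<Omega>\<in>superpart n m. c \<Omega> * com_m \<Omega> (A, M)) = (\<Sum>a\<in>permutations_of_set A.
    theta_sign a * (if desc a M \<and> length a = m \<and> size M = n then c (ctype a M) else 0))"
proof -
  have "(\<Sum>\<Omega>\<in>superpart n m. c \<Omega> * com_m \<Omega> (A, M)) = (\<Sum>\<Omega>\<in>superpart n m. \<Sum>a\<in>permutations_of_set A.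
      theta_sign a * (if ctype a M = \<Omega> then c \<Omega> else 0))"
    by (intro sum.cong refl)
       (simp add: com_m_alternant alternant_apply sum_distrib_left if_distrib mult_ac cong: if_cong)
  also have "\<dots> = (\<Sum>a\<in>permutations_of_set A. theta_sign a * (\<Sum>\<Omega>\<in>superpart n m. if ctype a M = \<Omega> then c \<Omega> else 0))"
    by (subst sum.swap) (simp add: sum_distrib_left)
  also have "\<dots> = (\<Sum>a\<in>permutations_of_set A.
      theta_sign a * (if desc a M \<and> length a = m \<and> size M = n then c (ctype a M) else 0))"
  proof (intro sum.cong refl)
    fix a
    have "ctype a M \<in> superpart n m \<longleftrightarrow> desc a M \<and> length a = m \<and> size M = n"
      using ctype_superpart ctype_superpartD by blast
    then show "theta_sign a * (\<Sum>\<Omega>\<in>superpart n m. if ctype a M = \<Omega> then c \<Omega> else 0) =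
        theta_sign a * (if desc a M \<and> length a = m \<and> size M = n then c (ctype a M) else 0)"
      by (simp add: finite_superpart)
  qed
  finally show ?thesis .
qed

text \<open>With a single letter in the index word, \<open>kappa\<close> depends only on the content
  of the other word, and the number of rearrangements is k!/\<open>mfact M\<close>. The parameter
  \<open>l\<close> is 1 for a fermionic and 0 for a nonfermionic block.\<close>

lemma sum_kappa_replicate:
  assumes "size M = k"
  shows "(\<Sum>b\<in>permutations_of_multiset M. kappa (replicate l x, replicate k x) (replicate l y, b)) *
    mfact M = fact k * mfact (M + replicate_mset l y)"
proof -
  have "kappa (replicate l x, replicate k x) (replicate l y, b) = mfact (M + replicate_mset l y)"
    if "b \<in> permutations_of_multiset M" for b
  proof -
    have "mset b = M" "length b = k" using that assms by (auto dest: permutations_of_multisetD)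
    then have "kappa (replicate l x, replicate k x) (replicate l y, b) =
        mfact (image_mset (Pair x) (M + replicate_mset l y))"
      by (simp add: kappa_def zip_replicate1 add.commute)
    also have "\<dots> = mfact (M + replicate_mset l y)" by (rule mfact_image_inj) (simp add: inj_on_def)
    finally show ?thesis .
  qed
  then show ?thesis
    using card_permutations_of_multiset_mfact[of M] assms by (simp add: mult.commute mult.left_commute)
qed

text \<open>The quotient of \<open>mfact (add_mset y M)\<close> by \<open>mfact M\<close> is the
  exponent of the theta index plus one, which is the weight in \<open>com_h_tilde\<close>.\<close>

lemma abelianize_hword_fermionic:
  "abelianize (hword ([x], replicate k x)) = (\<lambda>t. fact k * com_h_tilde k t)"
proof
  fix t :: "nat set \<times> nat multiset"
  obtain A M where t: "t = (A, M)" by (cases t)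
  have sum_kappa: "(\<Sum>b\<in>permutations_of_multiset M. kappa ([x], replicate k x) ([y], b)) = fact k * (count M y + 1)"
    if "size M = k" for y
  proof -
    have "(\<Sum>b\<in>permutations_of_multiset M. kappa ([x], replicate k x) ([y], b)) * mfact M =
        fact k * (count M y + 1) * mfact M"
      using sum_kappa_replicate[OF that, of 1 x y] by (simp add: mfact_add_mset algebra_simps)
    then show ?thesis by (metis mfact_nz mult_right_cancel)
  qed
  have "abelianize (hword ([x], replicate k x)) (A, M) = (\<Sum>a\<in>permutations_of_set A.
      fact k * (theta_sign a * (if desc a M \<and> length a = 1 \<and> size M = k then of_nat (hd (fst (ctype a M)) + 1) else 0)))"
    unfolding abelianize_hword_alternant
  proof (intro sum.cong refl)
    fix a
    show "theta_sign a * (if length a = length [x] \<and> size M = length (replicate k x)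
        then of_nat (\<Sum>b'\<in>permutations_of_multiset M. kappa ([x], replicate k x) (a, b')) else 0) =
      fact k * (theta_sign a * (if desc a M \<and> length a = 1 \<and> size M = k then of_nat (hd (fst (ctype a M)) + 1) else 0))"
    proof (cases "length a = 1 \<and> size M = k")
      case True
      then obtain y where "a = [y]" by (auto simp: length_Suc_conv)
      moreover have "desc [y] M" by (simp add: desc_def)
      ultimately show ?thesis using True sum_kappa[of y] by (simp add: ctype_def algebra_simps)
    qed auto
  qed
  also have "\<dots> = fact k * com_h_tilde k (A, M)"
    unfolding com_h_tilde_def sum_superpart_com_m by (simp add: sum_distrib_left)
  finally show "abelianize (hword ([x], replicate k x)) t = fact k * com_h_tilde k t" using t by simp
qed

lemma abelianize_hword_bosonic:
  "abelianize (hword ([], replicate k x)) = (\<lambda>t. fact k * com_h_row k t)"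
proof
  fix t :: "nat set \<times> nat multiset"
  obtain A M where t: "t = (A, M)" by (cases t)
  have sum_kappa: "(\<Sum>b\<in>permutations_of_multiset M. kappa ([], replicate k x) ([], b)) = fact k" if "size M = k"
    using sum_kappa_replicate[OF that, of 0 x] by simp
  have "abelianize (hword ([], replicate k x)) (A, M) = (\<Sum>a\<in>permutations_of_set A.
      fact k * (theta_sign a * (if desc a M \<and> length a = 0 \<and> size M = k then 1 else 0)))"
    unfolding abelianize_hword_alternant
  proof (intro sum.cong refl)
    fix a
    have "desc [] M" by (simp add: desc_def)
    then show "theta_sign a * (if length a = length [] \<and> size M = length (replicate k x)
        then of_nat (\<Sum>b'\<in>permutations_of_multiset M. kappa ([], replicate k x) (a, b')) else 0) =
      fact k * (theta_sign a * (if desc a M \<and> length a = 0 \<and> size M = k then 1 else 0))"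
      using sum_kappa by (cases "length a = 0 \<and> size M = k") auto
  qed
  also have "\<dots> = fact k * com_h_row k (A, M)"
    using sum_superpart_com_m[where c = "\<lambda>_. 1" and n = k and m = 0 and A = A and M = M]
    by (simp add: com_h_row_def sum_distrib_left)
  finally show "abelianize (hword ([], replicate k x)) t = fact k * com_h_row k t" using t by simp
qed

lemma abelianize_hword_Nil: "abelianize (hword ([], [])) = com_one"
proof
  fix t :: "nat set \<times> nat multiset"
  obtain A M where t: "t = (A, M)" by (cases t)
  show "abelianize (hword ([], [])) t = com_one t"
  proof (cases "A = {} \<and> M = {#}")
    case False
    have "abelianize (hword ([], [])) (A, M) = 0"
      unfolding abelianize_hword_alternant
      by (rule sum.neutral) (use False in \<open>auto simp: permutations_of_set_def\<close>)
    then show ?thesis using False by (auto simp: t com_one_def monom_def)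
  qed (simp add: t abelianize_hword_alternant com_one_def monom_def kappa_def)
qed

text \<open>Nonzero scalars keep the set of nonzero members over which \<open>formal_sum\<close>
  sums.\<close>

lemma com_mult_scale:
  assumes "c \<noteq> 0" "d \<noteq> 0"
  shows "com_mult (\<lambda>t. c * f t) (\<lambda>t. d * g t) = (\<lambda>t. c * d * com_mult f g t)"
proof
  fix t
  have eq: "(\<lambda>((A, u), (B, v)) t. c * f (A, u) * (d * g (B, v)) *
        monom (sorted_list_of_set A @ sorted_list_of_set B) (u + v) t) i t =
      c * d * (\<lambda>((A, u), (B, v)) t. f (A, u) * g (B, v) *
        monom (sorted_list_of_set A @ sorted_list_of_set B) (u + v) t) i t" for i
    by (simp add: case_prod_unfold mult_ac)
  show "com_mult (\<lambda>t. c * f t) (\<lambda>t. d * g t) t = c * d * com_mult f g t"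
    unfolding com_mult_def formal_sum_def eq using assms by (simp add: sum_distrib_left)
qed

definition blocks_word :: "nat list \<Rightarrow> nat list \<Rightarrow> nat list" where
  "blocks_word e is = concat (map2 replicate e is)"

lemma blocks_word_Cons: "blocks_word (k # e) (x # xs) = replicate k x @ blocks_word e xs"
  by (simp add: blocks_word_def)

lemma blocks_word_Nil: "blocks_word [] xs = []"
  by (simp add: blocks_word_def)

lemma set_blocks_word: "set (blocks_word e is) \<subseteq> set is"
  by (auto simp: blocks_word_def dest: set_zip_rightD)

lemma mset_blocks_word: "length e = length is \<Longrightarrow> mset (blocks_word e is) = rows e is"
proof (induction e "is" rule: list_induct2)
  case Nil
  then show ?case by (simp add: blocks_word_Nil rows_def)
next
  case (Cons k e x xs)
  have "rows (k # e) (x # xs) = replicate_mset k x + rows e xs"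
    unfolding rows_def by (simp add: sum.lessThan_Suc_shift del: sum.lessThan_Suc)
  then show ?case using Cons by (simp add: blocks_word_Cons)
qed

lemma blocks_word_append:
  "length a = length F \<Longrightarrow> blocks_word (F @ P) (a @ c) = blocks_word F a @ blocks_word P c"
  by (simp add: blocks_word_def)

text \<open>Constant runs are split off from the left, in the order in which \<open>com_h\<close>
  multiplies its factors, and each contributes the factorial of its length. As the letters are
  distinct, every split is over disjoint alphabets.\<close>

lemma abelianize_hword_blocks:
  assumes "length F = length a" "length P = length c" "distinct (a @ c)"
  shows "abelianize (hword (a, blocks_word F a @ blocks_word P c)) =
    (\<lambda>t. of_nat (superpart_fact (F, P)) * com_h (F, P) t)"
  using assms(1,3)
proof (induction F a rule: list_induct2)
  case Nil
  from assms(2) Nil show ?case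
  proof (induction P c rule: list_induct2)
    case Nil
    then show ?case by (simp add: blocks_word_Nil abelianize_hword_Nil com_h_def superpart_fact_def)
  next
    case (Cons p P x c)
    have "abelianize (hword ([] @ [], replicate p x @ blocks_word P c)) =
        com_mult (abelianize (hword ([], replicate p x))) (abelianize (hword ([], blocks_word P c)))"
      by (rule abelianize_hword_append) (use Cons.prems set_blocks_word[of P c] in auto)
    then have "abelianize (hword ([], replicate p x @ blocks_word P c)) =
        com_mult (\<lambda>t. fact p * com_h_row p t) (\<lambda>t. of_nat (superpart_fact ([], P)) * com_h ([], P) t)"
      using Cons by (simp add: abelianize_hword_bosonic blocks_word_Nil)
    also have "\<dots> = (\<lambda>t. fact p * of_nat (superpart_fact ([], P)) * com_mult (com_h_row p) (com_h ([], P)) t)"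
      by (rule com_mult_scale) (auto simp: superpart_fact_def prod_list_zero_iff)
    finally show ?case by (simp add: blocks_word_Nil blocks_word_Cons com_h_def superpart_fact_def)
  qed
next
  case (Cons k F x a)
  have "abelianize (hword ([x] @ a, replicate k x @ (blocks_word F a @ blocks_word P c))) =
      com_mult (abelianize (hword ([x], replicate k x))) (abelianize (hword (a, blocks_word F a @ blocks_word P c)))"
    by (rule abelianize_hword_append)
       (use Cons.prems set_blocks_word[of P c] set_blocks_word[of F a] in auto)
  then have "abelianize (hword (x # a, replicate k x @ (blocks_word F a @ blocks_word P c))) =
      com_mult (\<lambda>t. fact k * com_h_tilde k t) (\<lambda>t. of_nat (superpart_fact (F, P)) * com_h (F, P) t)"
    using Cons by (simp add: abelianize_hword_fermionic)
  also have "\<dots> = (\<lambda>t. fact k * of_nat (superpart_fact (F, P)) * com_mult (com_h_tilde k) (com_h (F, P)) t)"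
    by (rule com_mult_scale) (auto simp: superpart_fact_def prod_list_zero_iff)
  finally show ?case by (simp add: blocks_word_Cons com_h_def superpart_fact_def)
qed

lemma hword_permute_snd:
  assumes p: "p permutes {..<length b}"
  shows "hword (a, permute_list p b) (A, b') = hword (a, b) (A, permute_list (inv p) b')"
proof (cases "length b' = length b")
  case True
  have ip: "inv p permutes {..<length b}" using p by (rule permutes_inv)
  have "permute_list (inv p) (permute_list p b) = b"
    using permute_list_compose[OF ip, of p] permutes_inv_o[OF p] by simp
  then have "kappa (a, permute_list p b) (a', b') = kappa (a, b) (a', permute_list (inv p) b')" for a'
    using kappa_permute_snd[of "inv p" "permute_list p b" b' a a'] ip True by simp
  then show ?thesis by (simp add: hword_apply cong: if_cong)
qed (simp add: hword_apply)

text \<open>A permutation of the positions of the index word can be moved to the argument, where it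
  only permutes the rearrangements over which abelianization sums.\<close>

lemma abelianize_hword_mset:
  assumes "mset b = mset b'"
  shows "abelianize (hword (a, b')) = abelianize (hword (a, b))"
proof
  fix t :: "nat set \<times> nat multiset"
  obtain A M where t: "t = (A, M)" by (cases t)
  obtain p where p: "p permutes {..<length b}" "permute_list p b = b'"
    using mset_eq_permutation[OF assms[symmetric]] .
  have len: "length b' = length b" using assms by (metis mset_eq_length)
  show "abelianize (hword (a, b')) t = abelianize (hword (a, b)) t"
  proof (cases "size M = length b")
    case True
    have ip: "inv p permutes {..<length b}" using p(1) by (rule permutes_inv)
    have len': "length c = length b" if "c \<in> permutations_of_multiset M" for c
      using that True by (auto dest: permutations_of_multisetD)
    have "abelianize (hword (a, b')) (A, M) = (\<Sum>c\<in>permutations_of_multiset M. hword (a, b) (A, permute_list (inv p) c))"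
      unfolding p(2)[symmetric] hword_permute_snd[OF p(1), symmetric] by (rule abelianize_apply) (rule hword_finite)
    also have "\<dots> = (\<Sum>c\<in>permutations_of_multiset M. hword (a, b) (A, c))"
    proof (rule sum.reindex_bij_witness[where i = "permute_list p" and j = "permute_list (inv p)"])
      fix c assume c: "c \<in> permutations_of_multiset M"
      show "permute_list p (permute_list (inv p) c) = c"
        using permute_list_compose[of p c "inv p"] p(1) permutes_inv_o[OF p(1)] len'[OF c] by simp
      show "permute_list (inv p) (permute_list p c) = c"
        using permute_list_compose[of "inv p" c p] ip permutes_inv_o[OF p(1)] len'[OF c] by simp
      show "permute_list p c \<in> permutations_of_multiset M" "permute_list (inv p) c \<in> permutations_of_multiset M"
        using c len'[OF c] p(1) ip by (auto simp: permutations_of_multiset_def)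
    qed simp
    also have "\<dots> = abelianize (hword (a, b)) (A, M)"
      by (rule abelianize_apply[symmetric]) (rule hword_finite)
    finally show ?thesis using t by simp
  next
    case False
    then show ?thesis unfolding t abelianize_hword_alternant by (simp add: len)
  qed
qed

lemma abelianize_hword_ctype:
  assumes a: "desc a (mset b)"
  shows "abelianize (hword (a, b)) =
    (\<lambda>t. of_nat (superpart_fact (ctype a (mset b))) * com_h (ctype a (mset b)) t)"
proof -
  obtain F P where FP: "ctype a (mset b) = (F, P)" by (cases "ctype a (mset b)")
  obtain c where c: "distinct (a @ c)" "length c = length P" "mset b = rows (F @ P) (a @ c)"
    using ex_rows[OF desc_distinct[OF a] FP] .
  have lF: "length a = length F" using FP by (auto simp: ctype_def)
  have "mset (blocks_word F a @ blocks_word P c) = mset b"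
    using c lF by (simp add: mset_blocks_word flip: blocks_word_append mset_append)
  then have "abelianize (hword (a, b)) = abelianize (hword (a, blocks_word F a @ blocks_word P c))"
    by (rule abelianize_hword_mset)
  then show ?thesis using abelianize_hword_blocks[of F a P c] c lF FP by simp
qed

lemma abelianize_scale: "f \<in> sNCSym \<Longrightarrow> abelianize (\<lambda>t. c * f t) = (\<lambda>t. c * abelianize f t)"
  using abelianize_linear[of f "\<lambda>t. 0" c 0] by simp

text \<open>If the multiplicities of the thetas differ, sorting by them gives a superpartition up to
  sign. If two agree, exchanging these indices changes \<open>b\<close> only by a rearrangement and
  yet reverses the sign.\<close>

lemma abelianize_hword_cases:
  assumes a: "distinct a"
  shows "(\<exists>c. \<exists>\<Lambda>\<in>superpart (length b) (length a). abelianize (hword (a, b)) = (\<lambda>t. c * com_h \<Lambda> t))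
    \<or> abelianize (hword (a, b)) = (\<lambda>t. 0)"
proof (cases "inj_on (count (mset b)) (set a)")
  case True
  then obtain a0 where a0: "set a0 = set a" "desc a0 (mset b)" using ex_desc by blast
  have "mset a = mset a0" using a a0 desc_distinct set_eq_iff_mset_eq_distinct by blast
  then obtain p where p: "p permutes {..<length a0}" "permute_list p a0 = a" by (rule mset_eq_permutation)
  have len: "length a0 = length a" using p(2) by auto
  have "abelianize (hword (a, b)) = (\<lambda>t. of_int (sign p) * abelianize (hword (a0, b)) t)"
    using hword_permute[OF p(1) desc_distinct[OF a0(2)], of b] p(2) by (simp add: abelianize_scale hword_sNCSym)
  then have "abelianize (hword (a, b)) = (\<lambda>t. of_int (sign p) * of_nat (superpart_fact (ctype a0 (mset b))) *
      com_h (ctype a0 (mset b)) t)"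
    by (simp add: abelianize_hword_ctype[OF a0(2)] mult.assoc)
  moreover have "ctype a0 (mset b) \<in> superpart (length b) (length a)"
    using ctype_superpart[OF a0(2)] len by simp
  ultimately show ?thesis by blast
next
  case False
  then obtain x y where xy: "x \<in> set a" "y \<in> set a" "x \<noteq> y" "count (mset b) x = count (mset b) y"
    by (auto simp: inj_on_def)
  obtain i j where ij: "i < length a" "j < length a" "x = a ! i" "y = a ! j"
    using xy by (metis in_set_conv_nth)
  let ?\<sigma> = "Transposition.transpose x y" and ?\<tau> = "Transposition.transpose i j"
  have \<tau>: "?\<tau> permutes {..<length a}" using ij by (intro permutes_swap_id) auto
  have "abelianize (hword (a, b)) = abelianize (hword (map ?\<sigma> a, map ?\<sigma> b))"
    using hword_map[OF _ permutes_swap_id a, of "{x, y}" x y b] by simp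
  also have "\<dots> = abelianize (hword (permute_list ?\<tau> a, b))"
  proof -
    have "mset (map ?\<sigma> b) = mset b"
    proof (rule multiset_eqI)
      fix z
      have "count (image_mset ?\<sigma> (mset b)) (?\<sigma> (?\<sigma> z)) = count (mset b) (?\<sigma> z)"
        by (rule count_image_inj) (rule inj_transpose)
      also have "count (mset b) (?\<sigma> z) = count (mset b) z" using xy by (simp add: Transposition.transpose_def)
      finally show "count (mset (map ?\<sigma> b)) z = count (mset b) z" by simp
    qed
    then have "abelianize (hword (map ?\<sigma> a, map ?\<sigma> b)) = abelianize (hword (map ?\<sigma> a, b))"
      by (rule abelianize_hword_mset[OF sym])
    then show ?thesis using map_transpose_eq_permute_list[OF a ij(1,2)] ij by simp
  qed
  also have "\<dots> = (\<lambda>t. - abelianize (hword (a, b)) t)"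
    using hword_permute[OF \<tau> a, of b] ij xy abelianize_scale[OF hword_sNCSym, of "-1" "(a, b)"]
    by (auto simp: sign_swap_id)
  finally have "abelianize (hword (a, b)) t = - abelianize (hword (a, b)) t" for t by metis
  then have "abelianize (hword (a, b)) t = 0" for t by (metis neg_equal_zero)
  then show ?thesis by auto
qed

section \<open>The form on commutative symmetric functions\<close>

lemma mfact_ctype:
  assumes a: "distinct a"
  shows "mfact M = superpart_fact (ctype a M)"
proof -
  have "mfact M = (\<Prod>x\<in>set a \<union> (set_mset M - set a). fact (count M x))"
    by (rule mfact_eq_prod) auto
  also have "\<dots> = (\<Prod>x\<in>set a. fact (count M x)) * (\<Prod>x\<in>set_mset M - set a. fact (count M x))"
    by (rule prod.union_disjoint) auto
  also have "(\<Prod>x\<in>set a. fact (count M x)) = (\<Prod>k\<leftarrow>map (count M) a. fact k)"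
    using prod.distinct_set_conv_list[OF a, of "\<lambda>x. fact (count M x)"] by (simp add: o_def)
  also have "(\<Prod>x\<in>set_mset M - set a. fact (count M x)) = (\<Prod>k\<leftarrow>snd (ctype a M). fact k)"
    by (simp add: ctype_def prod_unfold_prod_mset multiset.map_comp o_def flip: prod_mset_prod_list)
  finally show ?thesis by (simp add: superpart_fact_def ctype_def)
qed

lemma standard_word:
  assumes \<Lambda>: "\<Lambda> \<in> superpart n m"
  obtains a b where "length a = m" "length b = n" "desc a (mset b)" "ctype a (mset b) = \<Lambda>"
proof -
  obtain F P where FP: "\<Lambda> = (F, P)" by (cases \<Lambda>)
  define a c where "a = [0..<length F]" and "c = [length F..<length F + length P]"
  define b where "b = blocks_word (F @ P) (a @ c)"
  have "mset b = rows (F @ P) (a @ c)" by (simp add: b_def mset_blocks_word a_def c_def)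
  then have ty: "ctype a (mset b) = \<Lambda>"
    using ctype_rows[of F P n m a c] \<Lambda> FP by (simp add: a_def c_def)
  then show ?thesis using that[of a b] ctype_superpartD[of a "mset b" n m] \<Lambda> by simp
qed

lemma superpart_fact_nz [simp]: "superpart_fact \<Lambda> \<noteq> 0"
  by (auto simp: superpart_fact_def prod_list_zero_iff)

lemma com_h_eq:
  assumes "desc a (mset b)" "ctype a (mset b) = \<Lambda>"
  shows "com_h \<Lambda> = (\<lambda>t. 1 / of_nat (superpart_fact \<Lambda>) * abelianize (hword (a, b)) t)"
  using abelianize_hword_ctype[OF assms(1)] assms(2) by (auto simp: fun_eq_iff)

lemma com_h_sSym:
  assumes "\<Lambda> \<in> superpart n m"
  shows "com_h \<Lambda> \<in> sSym"
proof -
  obtain a b where "desc a (mset b)" "ctype a (mset b) = \<Lambda>" using standard_word[OF assms] by blast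
  then show ?thesis
    using sSym_linear[OF abelianize_sSym[OF hword_sNCSym] sSym_0, of "1 / of_nat (superpart_fact \<Lambda>)" "(a, b)" 0]
    by (simp add: com_h_eq)
qed

text \<open>The expansion in \<open>nc_h\<close> is pushed down by \<open>abelianize\<close>.
  Several set superpartitions may give the same superpartition, so the sum stays indexed by the
  former and is labelled by \<open>L\<close>; uniqueness of the form asks only for spanning.\<close>

lemma com_h_expansion:
  assumes g: "g \<in> sSym"
  shows "\<exists>(T :: (nat \<times> nat \<times> nat set list) set) c L. finite T \<and> (\<forall>x\<in>T. \<exists>n m. L x \<in> superpart n m) \<and>
    g = (\<lambda>t. \<Sum>x\<in>T. c x * com_h (L x) t)"
proof -
  obtain f where f: "f \<in> sNCSym" "g = abelianize f" using g unfolding sSym_def by blast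
  obtain d where d: "degree_le d f" using f(1) sNCSym_degree by blast
  let ?T = "superparts d"
  let ?h = "\<lambda>(n, m, I). nc_h n m I" and ?c = "\<lambda>(n, m, I). hcoef n m I f"
  have "\<exists>c \<Lambda>. (\<exists>n m. \<Lambda> \<in> superpart n m) \<and> abelianize (?h x) = (\<lambda>t. c * com_h \<Lambda> t)" if x: "x \<in> ?T" for x
  proof -
    obtain n m I where I: "x = (n, m, I)" "I \<in> set_superpart n m" using x by (auto simp: superparts_def)
    let ?b = "can_word n I"
    have h: "?h x = hword ([0..<m], ?b)" using I by (simp add: nc_h_can_word)
    \<comment> \<open>A label for the summands that abelianize to zero; they get the coefficient
      0.\<close>
    have "ctype [] (mset ?b) \<in> superpart (size (mset ?b)) (length ([] :: nat list))"
      by (rule ctype_superpart) (simp add: desc_def)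
    then have "\<exists>n m. ctype [] (mset ?b) \<in> superpart n m" by blast
    moreover have "(\<lambda>t. 0) = (\<lambda>t. 0 * com_h (ctype [] (mset ?b)) t)" by simp
    ultimately show ?thesis
      unfolding h using abelianize_hword_cases[of "[0..<m]" ?b] by (metis distinct_upt)
  qed
  then obtain c L where cL: "\<And>x. x \<in> ?T \<Longrightarrow> (\<exists>n m. L x \<in> superpart n m) \<and> abelianize (?h x) = (\<lambda>t. c x * com_h (L x) t)"
    by metis
  have h: "?h x \<in> sNCSym" if "x \<in> ?T" for x
    using that by (cases x) (simp add: nc_h_sNCSym mem_superparts)
  have "g = abelianize (\<lambda>t. \<Sum>x\<in>?T. ?c x * ?h x t)"
    using nc_h_expansion[OF f(1) d] f(2) by simp
  also have "\<dots> = (\<lambda>t. \<Sum>x\<in>?T. ?c x * abelianize (?h x) t)"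
    by (rule abelianize_sum) (rule h)
  also have "\<dots> = (\<lambda>t. \<Sum>x\<in>?T. (?c x * c x) * com_h (L x) t)"
    using cL by (intro ext sum.cong refl) simp
  finally show ?thesis using cL by (intro exI[of _ ?T] exI[of _ "\<lambda>x. ?c x * c x"] exI[of _ L]) simp
qed

text \<open>The pull-back along the lifting, so that the lifting preserves the form by construction.
  What remains is to recognize it by its values on \<open>com_m\<close> and
  \<open>com_h\<close>.\<close>

definition com_form :: "com_series \<Rightarrow> com_series \<Rightarrow> rat" where
  "com_form f g = (if f \<in> sSym \<and> g \<in> sSym then nc_form (lift f) (lift g) else 0)"

lemma com_form_bilinear: "bilinear_form_on sSym com_form"
  unfolding bilinear_form_on_def
proof (intro conjI ballI allI impI)
  fix f g h c d assume V: "f \<in> sSym" "g \<in> sSym" "h \<in> sSym"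
  note L = lift_sNCSym[OF V(1)] lift_sNCSym[OF V(2)] lift_sNCSym[OF V(3)]
  show "com_form h (\<lambda>t. c * f t + d * g t) = c * com_form h f + d * com_form h g"
    using V bilinear_form_onD(2)[OF nc_form_bilinear L] by (simp add: com_form_def sSym_linear lift_linear)
  show "com_form (\<lambda>t. c * f t + d * g t) h = c * com_form f h + d * com_form g h"
    using V bilinear_form_onD(1)[OF nc_form_bilinear L] by (simp add: com_form_def sSym_linear lift_linear)
next
  fix f g assume "f \<notin> sSym \<or> g \<notin> sSym"
  then show "com_form f g = 0" by (auto simp: com_form_def)
qed

text \<open>Lifting after abelianization averages over the positions of the argument; by
  \<open>hword_permute_snd\<close> the average may be taken over the index word instead.\<close>

lemma lift_com_h:
  assumes ab: "desc a (mset b)" "ctype a (mset b) = \<Lambda>"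
  shows "lift (com_h \<Lambda>) = (\<lambda>t. \<Sum>p | p permutes {..<length b}.
    1 / (of_nat (superpart_fact \<Lambda>) * fact (length b)) * hword (a, permute_list p b) t)"
proof
  fix t :: "nat set \<times> nat list"
  obtain A b' where t: "t = (A, b')" by (cases t)
  let ?P = "{p. p permutes {..<length b}}"
  have "lift (com_h \<Lambda>) (A, b') = 1 / of_nat (superpart_fact \<Lambda>) * lift (abelianize (hword (a, b))) (A, b')"
    by (simp add: com_h_eq[OF ab] lift_def)
  also have "lift (abelianize (hword (a, b))) (A, b') = (\<Sum>p\<in>?P. hword (a, permute_list p b) (A, b')) / fact (length b)"
  proof (cases "length b' = length b")
    case True
    have "(\<Sum>p\<in>?P. hword (a, b) (A, permute_list p b')) = (\<Sum>p\<in>?P. hword (a, b) (A, permute_list (inv p) b'))"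
      by (rule sum_permutations_inverse)
    also have "\<dots> = (\<Sum>p\<in>?P. hword (a, permute_list p b) (A, b'))"
      by (intro sum.cong refl) (simp add: hword_permute_snd)
    finally show ?thesis using True by (simp add: lift_abelianize[OF hword_sNCSym])
  next
    case False
    then show ?thesis by (simp add: lift_abelianize[OF hword_sNCSym] hword_apply)
  qed
  finally show "lift (com_h \<Lambda>) t = (\<Sum>p\<in>?P.
      1 / (of_nat (superpart_fact \<Lambda>) * fact (length b)) * hword (a, permute_list p b) t)"
    by (simp add: t sum_divide_distrib mult.commute)
qed

text \<open>Every rearrangement of \<open>b\<close> pairs equally with the lifted monomial function.
  The factorial in the form cancels against the denominator of the lifting,
  \<open>superpart_fact\<close> against the one in \<open>com_h\<close>, and the number of
  permutations against the denominator of the average.\<close>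

lemma com_form_com_m_com_h:
  assumes \<Lambda>: "\<Lambda> \<in> superpart n m" and \<Omega>: "\<Omega> \<in> superpart n' m'"
  shows "com_form (com_m \<Lambda>) (com_h \<Omega>) = (if \<Lambda> = \<Omega> then (- 1) ^ (m choose 2) else 0)"
proof -
  obtain a b where ab: "length a = m'" "length b = n'" "desc a (mset b)" "ctype a (mset b) = \<Omega>"
    using standard_word[OF \<Omega>] .
  let ?P = "{p. p permutes {..<length b}}"
  have L: "lift (com_m \<Lambda>) \<in> sNCSym" using com_m_sSym[OF \<Lambda>] by (rule lift_sNCSym)
  have each: "nc_form (lift (com_m \<Lambda>)) (hword (a, permute_list p b)) =
      (- 1) ^ (m' choose 2) * of_nat (superpart_fact \<Omega>) * (if \<Lambda> = \<Omega> then 1 else 0)" if "p \<in> ?P" for p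
  proof -
    have "nc_form (lift (com_m \<Lambda>)) (hword (a, permute_list p b)) =
        (- 1) ^ (m' choose 2) * fact n' * word_coeff (lift (com_m \<Lambda>)) a (permute_list p b)"
      using nc_form_hword[OF L desc_distinct[OF ab(3)], of "permute_list p b"] ab by simp
    also have "word_coeff (lift (com_m \<Lambda>)) a (permute_list p b) =
        of_nat (superpart_fact \<Omega>) / fact n' * (if \<Lambda> = \<Omega> then 1 else 0)"
      using that ab mfact_ctype[OF desc_distinct[OF ab(3)], of "mset b"] word_coeff_com_m[OF \<Lambda> ab(3)]
      by (simp add: word_coeff_lift)
    finally show ?thesis by simp
  qed
  have "com_form (com_m \<Lambda>) (com_h \<Omega>) = nc_form (lift (com_m \<Lambda>)) (lift (com_h \<Omega>))"
    using com_m_sSym[OF \<Lambda>] com_h_sSym[OF \<Omega>] by (simp add: com_form_def)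
  also have "\<dots> = (\<Sum>p\<in>?P. 1 / (of_nat (superpart_fact \<Omega>) * fact (length b)) *
      nc_form (lift (com_m \<Lambda>)) (hword (a, permute_list p b)))"
    unfolding lift_com_h[OF ab(3,4)]
    by (rule bilinear_form_on_sum[OF bilinear_form_on_commute[OF nc_form_bilinear], THEN conjunct1])
       (simp_all add: sNCSym_linear finite_permutations hword_sNCSym L)
  also have "\<dots> = (\<Sum>p\<in>?P. (- 1) ^ (m' choose 2) * (if \<Lambda> = \<Omega> then 1 else 0) / fact (length b))"
    by (intro sum.cong refl) (simp add: each)
  also have "\<dots> = (- 1) ^ (m' choose 2) * (if \<Lambda> = \<Omega> then 1 else 0)"
    by (simp add: card_permutations[OF refl])
  also have "\<dots> = (if \<Lambda> = \<Omega> then (- 1) ^ (m choose 2) else 0)"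
    using \<Lambda> \<Omega> superpart_lengths[of "fst \<Lambda>" "snd \<Lambda>" n m] superpart_lengths[of "fst \<Omega>" "snd \<Omega>" n' m'] by auto
  finally show ?thesis .
qed

lemma sSym_form_com_form: "sSym_form com_form"
  unfolding sSym_form_def using com_form_bilinear com_form_com_m_com_h by blast

lemma sSym_form_unique:
  assumes C: "sSym_form C"
  shows "C = com_form"
proof (intro ext)
  fix f g
  show "C f g = com_form f g"
  proof (cases "f \<in> sSym \<and> g \<in> sSym")
    case True
    obtain d where f: "f = (\<lambda>t. \<Sum>\<Lambda>\<in>com_superparts d. ccoef \<Lambda> f * com_m \<Lambda> t)"
      using com_m_expansion True by blast
    obtain T :: "(nat \<times> nat \<times> nat set list) set" and c L
      where T: "finite T" "\<forall>x\<in>T. \<exists>n m. L x \<in> superpart n m" and g: "g = (\<lambda>t. \<Sum>x\<in>T. c x * com_h (L x) t)"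
      using com_h_expansion True by blast
    have M: "com_m \<Lambda> \<in> sSym" if "\<Lambda> \<in> com_superparts d" for \<Lambda>
      using that com_m_sSym unfolding com_superparts_def by blast
    have H: "com_h (L x) \<in> sSym" if "x \<in> T" for x using that T com_h_sSym by blast
    show ?thesis
    proof (rule bilinear_forms_eq_on_sums[OF _ com_form_bilinear sSym_0 sSym_linear finite_com_superparts M T(1) H f g])
      show "bilinear_form_on sSym C" using C unfolding sSym_form_def by blast
      fix \<Lambda> x assume \<Lambda>x: "\<Lambda> \<in> com_superparts d" "x \<in> T"
      obtain n m where 1: "\<Lambda> \<in> superpart n m" using \<Lambda>x unfolding com_superparts_def by blast
      obtain n' m' where 2: "L x \<in> superpart n' m'" using T \<Lambda>x by blast
      have "C (com_m \<Lambda>) (com_h (L x)) = (if \<Lambda> = L x then (- 1) ^ (m choose 2) else 0)"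
        using C 1 2 unfolding sSym_form_def by blast
      then show "C (com_m \<Lambda>) (com_h (L x)) = com_form (com_m \<Lambda>) (com_h (L x))"
        using com_form_com_m_com_h[OF 1 2] by simp
    qed
  next
    case False
    then show ?thesis using C unfolding sSym_form_def bilinear_form_on_def com_form_def by auto
  qed
qed

section \<open>The lifting map\<close>

definition lifting :: "com_series \<Rightarrow> nc_series" where
  "lifting g = (if g \<in> sSym then lift g else (\<lambda>t. 0))"

text \<open>Strict sorting forces distinct entries, so exactly one permutation sorts
  \<open>xs\<close>; the least number of transpositions therefore has the parity of this
  permutation.\<close>

lemma sorting_sign:
  fixes xs :: "nat list"
  assumes p: "p permutes {..<length xs}" "sorted_wrt (>) (permute_list p xs)"
  shows "(- 1) ^ (LEAST k. \<exists>q. q permutes {..<length xs} \<and> swapidseq k q \<and> sorted_wrt (>) (permute_list q xs)) = sign p"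
proof -
  let ?Q = "\<lambda>k q. q permutes {..<length xs} \<and> swapidseq k q \<and> sorted_wrt (>) (permute_list q xs)"
  define k where "k = (LEAST k. \<exists>q. ?Q k q)"
  have "permutation p" using p(1) by (auto intro: permutes_imp_permutation)
  then have "\<exists>k q. ?Q k q" using p unfolding permutation_def by blast
  then have "\<exists>q. ?Q k q" unfolding k_def by (rule LeastI_ex)
  then obtain q where q: "?Q k q" by blast
  have strict: "sorted (rev ys) \<and> distinct (rev ys)" if "sorted_wrt (>) ys" for ys :: "nat list"
    using that strict_sorted_iff[of "rev ys"] by (simp add: sorted_wrt_rev)
  have "rev (permute_list q xs) = rev (permute_list p xs)"
    by (rule sorted_distinct_set_unique) (use strict[of "permute_list q xs"] strict[of "permute_list p xs"] p q in auto)
  then have eq: "permute_list q xs = permute_list p xs" by simp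
  have d: "distinct xs" using strict[OF p(2)] p(1) by simp
  have "q i = p i" for i
  proof (cases "i < length xs")
    case True
    have "xs ! q i = xs ! p i" using eq permute_list_nth[of q xs i] permute_list_nth[of p xs i] p(1) q True by metis
    moreover have "q i < length xs" "p i < length xs"
      using True p(1) q permutes_in_image[of q "{..<length xs}" i] permutes_in_image[of p "{..<length xs}" i] by auto
    ultimately show ?thesis using d by (simp add: nth_eq_iff_index_eq)
  next
    case False
    then show ?thesis using permutes_not_in[OF p(1), of i] permutes_not_in[OF conjunct1[OF q], of i] by simp
  qed
  then have "q = p" by auto
  then have "swapidseq k p" using q by simp
  then have "evenperm p = even k" by (rule evenperm_unique) simp
  then show ?thesis by (simp add: sign_def flip: k_def)
qed

text \<open>The coefficients are compared on canonical words. There the lifting weights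
  \<open>com_m\<close> by \<open>mfact\<close>/n!, which is Lambda!/n! on words of type
  \<open>\<Lambda>\<close>, and passing from the canonical to the decreasing order of the thetas
  gives the sign counted by \<open>sort_swaps\<close>.\<close>

lemma lift_com_m:
  assumes \<Lambda>: "\<Lambda> \<in> superpart n m"
  shows "lift (com_m \<Lambda>) = (\<lambda>t. of_nat (superpart_fact \<Lambda>) / fact n *
    (\<Sum>I\<in>{I \<in> set_superpart n m. distinct (map card (take m I)) \<and> superpart_of m I = \<Lambda>}.
      (- 1) ^ sort_swaps m I * nc_m n m I t))"
proof -
  define X where "X = {I \<in> set_superpart n m. distinct (map card (take m I)) \<and> superpart_of m I = \<Lambda>}"
  define s where "s = (\<lambda>I. of_nat (superpart_fact \<Lambda>) / fact n * (- 1) ^ sort_swaps m I :: rat)"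
  have finX: "finite X" by (simp add: X_def finite_set_superpart)
  have "lift (com_m \<Lambda>) = (\<lambda>t. \<Sum>I\<in>X. s I * nc_m n m I t)"
  proof (rule coef_eqI[OF lift_sNCSym[OF com_m_sSym[OF \<Lambda>]] sNCSym_sum[OF nc_m_sNCSym]])
    fix n' m' J assume J: "J \<in> set_superpart n' m'"
    let ?b = "can_word n' J" and ?a = "[0..<m']"
    let ?M = "mset ?b"
    note sc = superpart_supercomp[OF J]
    note w = can_word_words[OF sc]
    have rhs: "coef n' m' J (\<lambda>t. \<Sum>I\<in>X. s I * nc_m n m I t) = (if n' = n \<and> m' = m \<and> J \<in> X then s J else 0)"
    proof -
      have "coef n' m' J (\<lambda>t. \<Sum>I\<in>X. s I * nc_m n m I t) =
          (\<Sum>I\<in>X. if I = J then (if n' = n \<and> m' = m then s J else 0) else 0)"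
        unfolding coef_sum by (intro sum.cong refl) (auto simp: X_def coef_nc_m[OF J])
      then show ?thesis using finX by simp
    qed
    have take: "take m' J = map (\<lambda>c. insert 0 (occ ?b c)) ?a"
      using supercomp_fermionic[OF sc w] supercompD(2)[OF sc] by (intro nth_equalityI) auto
    have drop: "distinct (drop m' J)" "set (drop m' J) = occ ?b ` (set_mset ?M - set ?a)"
      using sorted_wrt_key_distinct[OF supercompD(8)[OF sc]] supercomp_bosonic[OF sc w] by auto
    have fer: "map card (take m' J) = map (\<lambda>c. Suc (count ?M c)) ?a"
      "map (\<lambda>B. card B - 1) (take m' J) = map (count ?M) ?a"
      by (simp_all add: take card_occ)
    have dist: "distinct (map card (take m' J)) \<longleftrightarrow> inj_on (count ?M) (set ?a)"
      by (auto simp: fer distinct_map inj_on_def)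
    have bos: "mset (map card (drop m' J)) = image_mset (count ?M) (mset_set (set_mset ?M - set ?a))"
    proof -
      have "mset (drop m' J) = mset_set (occ ?b ` (set_mset ?M - set ?a))"
        using drop by (metis mset_set_set)
      also have "\<dots> = image_mset (occ ?b) (mset_set (set_mset ?M - set ?a))"
        by (rule image_mset_mset_set[symmetric]) (auto intro: inj_on_subset[OF inj_on_occ])
      finally show ?thesis by (simp add: multiset.map_comp o_def card_occ)
    qed
    have snd: "snd (superpart_of m' J) = snd (ctype ?a ?M)"
      unfolding superpart_of_def ctype_def snd_conv bos[symmetric] sorted_list_of_multiset_mset ..
    have lhs: "coef n' m' J (lift (com_m \<Lambda>)) = of_nat (mfact ?M) / fact n' * word_coeff (com_m \<Lambda>) ?a ?M"
      by (simp add: coef_def word_coeff_lift)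
    show "coef n' m' J (lift (com_m \<Lambda>)) = coef n' m' J (\<lambda>t. \<Sum>I\<in>X. s I * nc_m n m I t)"
    proof (cases "inj_on (count ?M) (set ?a)")
      \<comment> \<open>Two fermionic blocks have equal size: \<open>J\<close> is not in the index
        set, and the left side vanishes by antisymmetry.\<close>
      case False
      then obtain x y where "x \<in> set ?a" "y \<in> set ?a" "x \<noteq> y" "count ?M x = count ?M y"
        by (auto simp: inj_on_def)
      then have "com_m \<Lambda> (set ?a, ?M) = 0" by (intro sSym_vanish[OF com_m_sSym[OF \<Lambda>]])
      moreover have "\<not> (m' = m \<and> J \<in> X)" using False dist by (auto simp: X_def)
      ultimately show ?thesis unfolding lhs rhs by (auto simp: word_coeff_def)
    next
      case True
      then obtain a0 where a0: "set a0 = set ?a" "desc a0 ?M" using ex_desc[of "set ?a"] by blast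
      have "mset a0 = mset ?a" using a0 desc_distinct distinct_upt set_eq_iff_mset_eq_distinct by blast
      \<comment> \<open>\<open>p\<close> sorts the thetas by decreasing exponent, and with them the
        sizes of the fermionic blocks.\<close>
      then obtain p where p: "p permutes {..<length ?a}" "permute_list p ?a = a0" by (rule mset_eq_permutation)
      have len: "length a0 = m'" using p(2) by auto
      have pm: "p permutes {..<m'}" using p(1) by simp
      have "word_coeff (com_m \<Lambda>) a0 ?M = of_int (sign p) * word_coeff (com_m \<Lambda>) ?a ?M"
        using word_coeff_permute[OF p(1) distinct_upt] p(2) by simp
      then have wc: "word_coeff (com_m \<Lambda>) ?a ?M = of_int (sign p) * (if ctype a0 ?M = \<Lambda> then 1 else 0)"
        using word_coeff_com_m[OF \<Lambda> a0(2)] by (simp flip: mult.assoc of_int_mult)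
      have perm: "permute_list p (map (count ?M) ?a) = map (count ?M) a0"
        using permute_list_map[OF p(1)] p(2) by simp
      have desc: "sorted_wrt (>) (map (count ?M) a0)" using a0(2) by (simp add: desc_iff)
      then have "sorted_wrt (\<ge>) (map (count ?M) a0)" by (rule sorted_wrt_mono_rel[rotated]) simp
      moreover have "mset (map (count ?M) a0) = mset (map (count ?M) ?a)" using \<open>mset a0 = mset ?a\<close> by simp
      ultimately have "map (count ?M) a0 = rev (sort (map (count ?M) ?a))"
        using superpart_snd_unique by (metis sorted_list_of_multiset_mset)
      then have "fst (superpart_of m' J) = fst (ctype a0 ?M)"
        unfolding superpart_of_def ctype_def fst_conv fer(2) by (rule sym)
      moreover have "snd (superpart_of m' J) = snd (ctype a0 ?M)"
        unfolding snd ctype_def snd_conv a0(1) ..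
      ultimately have sp: "superpart_of m' J = ctype a0 ?M" by (rule prod_eqI)
      have swaps: "(- 1) ^ sort_swaps m' J = sign p"
        using sorting_sign[of p "map (count ?M) ?a"] pm desc unfolding sort_swaps_def fer(2) perm by simp
      show ?thesis
      proof (cases "ctype a0 ?M = \<Lambda>")
        case True
        then have nm: "n' = n" "m' = m" using ctype_superpartD(2,3)[of a0 ?M n m] \<Lambda> len by auto
        have "J \<in> X" using J nm sp True dist \<open>inj_on (count ?M) (set ?a)\<close> by (simp add: X_def)
        moreover have "mfact ?M = superpart_fact \<Lambda>" using mfact_ctype[OF desc_distinct[OF a0(2)], of ?M] True by simp
        moreover have "of_int (sign p) = ((- 1) ^ sort_swaps m' J :: rat)"
          unfolding swaps[symmetric] by simp
        ultimately show ?thesis unfolding lhs rhs wc using True nm by (simp add: s_def)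
      next
        case False
        then have "\<not> (m' = m \<and> J \<in> X)" using sp by (auto simp: X_def)
        then show ?thesis unfolding lhs rhs wc using False by auto
      qed
    qed
  qed
  also have "\<dots> = (\<lambda>t. of_nat (superpart_fact \<Lambda>) / fact n * (\<Sum>I\<in>X. (- 1) ^ sort_swaps m I * nc_m n m I t))"
    by (simp add: s_def sum_distrib_left mult.assoc)
  finally show ?thesis unfolding X_def .
qed

lemma lifting_map_lifting: "lifting_map lifting"
  unfolding lifting_map_def
proof (intro conjI allI ballI)
  show "linear_on sSym lifting"
    unfolding linear_on_def by (simp add: lifting_def sSym_linear lift_linear)
  show "lifting ` sSym \<subseteq> sNCSym" by (auto simp: lifting_def lift_sNCSym)
next
  fix n m \<Lambda> assume \<Lambda>: "\<Lambda> \<in> superpart n m"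
  show "lifting (com_m \<Lambda>) = (\<lambda>t. of_nat (superpart_fact \<Lambda>) / fact n *
    (\<Sum>I\<in>{I \<in> set_superpart n m. distinct (map card (take m I)) \<and> superpart_of m I = \<Lambda>}.
      (- 1) ^ sort_swaps m I * nc_m n m I t))"
    using com_m_sSym[OF \<Lambda>] lift_com_m[OF \<Lambda>] by (simp add: lifting_def)
qed

lemma linear_onD:
  "linear_on V R \<Longrightarrow> f \<in> V \<Longrightarrow> g \<in> V \<Longrightarrow> R (\<lambda>t. c * f t + d * g t) = (\<lambda>t. c * R f t + d * R g t)"
  by (simp add: linear_on_def)

lemma linear_on_sum:
  assumes R: "linear_on sSym R" and "finite T" "\<And>i. i \<in> T \<Longrightarrow> u i \<in> sSym"
  shows "R (\<lambda>t. \<Sum>i\<in>T. c i * u i t) = (\<lambda>t. \<Sum>i\<in>T. c i * R (u i) t)"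
  using assms(2,3)
proof (induction T)
  case empty
  show ?case using linear_onD[OF R sSym_0 sSym_0, of 0 0] by simp
next
  case (insert x T)
  have "u x \<in> sSym" "(\<lambda>t. \<Sum>i\<in>T. c i * u i t) \<in> sSym"
    using insert.prems sSym_sum[of T u c] by auto
  from linear_onD[OF R this, of "c x" 1] show ?case using insert by simp
qed

lemma lifting_map_unique:
  assumes R: "lifting_map R"
  shows "R = lifting"
proof
  fix f
  show "R f = lifting f"
  proof (cases "f \<in> sSym")
    case True
    obtain d where f: "f = (\<lambda>t. \<Sum>\<Lambda>\<in>com_superparts d. ccoef \<Lambda> f * com_m \<Lambda> t)"
      using com_m_expansion[OF True] by blast
    have M: "com_m \<Lambda> \<in> sSym" if "\<Lambda> \<in> com_superparts d" for \<Lambda>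
      using that com_m_sSym unfolding com_superparts_def by blast
    have eq: "R' f = (\<lambda>t. \<Sum>\<Lambda>\<in>com_superparts d. ccoef \<Lambda> f * R' (com_m \<Lambda>) t)" if "lifting_map R'" for R'
    proof -
      have "linear_on sSym R'" using that unfolding lifting_map_def by blast
      then show ?thesis by (subst f) (rule linear_on_sum, use M in simp_all)
    qed
    have "R (com_m \<Lambda>) = lifting (com_m \<Lambda>)" if \<Lambda>: "\<Lambda> \<in> com_superparts d" for \<Lambda>
    proof -
      obtain n m where "\<Lambda> \<in> superpart n m" using \<Lambda> unfolding com_superparts_def by blast
      then have "R' (com_m \<Lambda>) = lift (com_m \<Lambda>)" if "lifting_map R'" for R'
        using that lift_com_m unfolding lifting_map_def by simp
      then show ?thesis using R lifting_map_lifting by simp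
    qed
    then show ?thesis using eq[OF R] eq[OF lifting_map_lifting] by simp
  next
    case False
    then show ?thesis using R unfolding lifting_map_def linear_on_def lifting_def by auto
  qed
qed

theorem proposition5p11:
  shows "(\<exists>!B. sNCSym_form B) \<and> (\<exists>!C. sSym_form C) \<and> (\<exists>!R. lifting_map R) \<and>
    (\<forall>B. sNCSym_form B \<longrightarrow> super_inner_product B) \<and>
    (\<forall>B C R. sNCSym_form B \<longrightarrow> sSym_form C \<longrightarrow> lifting_map R \<longrightarrow>
       (\<forall>f\<in>sSym. \<forall>g\<in>sSym. B (R f) (R g) = C f g))"
proof (intro conjI allI impI ballI)
  show "\<exists>!B. sNCSym_form B" using sNCSym_form_nc_form sNCSym_form_unique by blast
  show "\<exists>!C. sSym_form C" using sSym_form_com_form sSym_form_unique by blast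
  show "\<exists>!R. lifting_map R" using lifting_map_lifting lifting_map_unique by blast
  show "super_inner_product B" if "sNCSym_form B" for B
    using sNCSym_form_unique[OF that] super_inner_product_nc_form by simp
  fix B C R f g
  assume "sNCSym_form B" "sSym_form C" "lifting_map R" and fg: "f \<in> sSym" "g \<in> sSym"
  then have "B = nc_form" "C = com_form" "R = lifting"
    using sNCSym_form_unique sSym_form_unique lifting_map_unique by blast+
  then show "B (R f) (R g) = C f g" using fg by (simp add: lifting_def com_form_def)
qed

end
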